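(* Let $p,q\in(0,1)$ and $(z_1,z_2)\in\mathbb D^2$. If there exists a real number $r$ such that $-p<r<\min\{1,p/q\}$ and $$r=\frac{p(pz_1z_2^2+qz_1^2z_2-2pz_1z_2-2qz_1z_2+pz_1+qz_2-z_1^2+2z_1z_2-z_2^2)}{pqz_1^2z_2^2-2pqz_1z_2-pz_1^2z_2-qz_1z_2^2+2pz_1z_2+2qz_1z_2+pq-pz_2-qz_1},$$ then $$g_{\mathbb D^2}((z_1,z_2),(p,0),(0,q))=\log\left|\frac{pqz_1z_2-pz_1z_2-qz_1z_2-pq+pz_2+qz_1}{pqz_1z_2-pq-pz_1-qz_2+p+q}\right|.$$ If there exists a real number $r$ such that $\max\{-1,-p/q\}<r<-p$ and $$r=\frac{p(pz_1z_2^2+qz_1^2z_2+2pz_1z_2+2qz_1z_2+pz_1+qz_2-z_1^2+2z_1z_2-z_2^2)}{pqz_1^2z_2^2-2pqz_1z_2-pz_1^2z_2-qz_1z_2^2-2pz_1z_2-2qz_1z_2+pq-pz_2-qz_1},$$ then $$g_{\mathbb D^2}((z_1,z_2),(p,0),(0,q))=\log\left|\frac{pqz_1z_2+pz_1z_2+qz_1z_2-pq+pz_2+qz_1}{pqz_1z_2-pq-pz_1-qz_2-p-q}\right|.$$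
   Context: $\mathbb D$ is the unit disk in $\mathbb C$. For distinct $P,Q\in\mathbb D^2$, the pluricomplex Green function $g_{\mathbb D^2}(x,P,Q)$ is the supremum of $f(x)$ over all negative plurisubharmonic $f$ on $\mathbb D^2$ (values in $[-\infty,0)$) with logarithmic poles of weight $1$ at $P$ and $Q$, i.e. $f(y)-\log|y-a|\le O(1)$ as $y\to a$ for $a\in\{P,Q\}$. The displayed quotients for $r$ are understood to have nonzero denominators. *)

theory Defs
  imports "HOL-Analysis.Analysis"
begin

definition upper_semicontinuous_on :: "'a::topological_space set \<Rightarrow> ('a \<Rightarrow> ereal) \<Rightarrow> bool" where
  "upper_semicontinuous_on U f \<longleftrightarrow> (\<forall>c. openin (top_of_set U) {x \<in> U. f x < c})"

text \<open>
  Mean over the circle with centre \<open>a\<close> and radius \<open>r\<close> with respect to normalised arc length, as the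
  difference of the means of the positive and negative parts.  It is only used for functions that are
  upper semicontinuous and \<open>< \<infinity>\<close> on the circle, whose positive part has a finite mean; the
  difference is therefore never \<open>\<infinity> - \<infinity>\<close>, but it may be \<open>-\<infinity>\<close>.
\<close>

definition circle_mean :: "(complex \<Rightarrow> ereal) \<Rightarrow> complex \<Rightarrow> real \<Rightarrow> ereal" where
  "circle_mean f a r =
     (let M = uniform_measure lborel {0..2 * pi} in
        enn2ereal (\<integral>\<^sup>+ t. e2ennreal (f (a + complex_of_real r * cis t)) \<partial>M)
      - enn2ereal (\<integral>\<^sup>+ t. e2ennreal (- f (a + complex_of_real r * cis t)) \<partial>M))"

text \<open>The function that is identically \<open>-\<infinity>\<close> counts as subharmonic and as plurisubharmonic.\<close>

definition subharmonic_on :: "complex set \<Rightarrow> (complex \<Rightarrow> ereal) \<Rightarrow> bool" where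
  "subharmonic_on U f \<longleftrightarrow>
     upper_semicontinuous_on U f \<and> (\<forall>x\<in>U. f x < \<infinity>) \<and>
     (\<forall>a r. r > 0 \<longrightarrow> cball a r \<subseteq> U \<longrightarrow> f a \<le> circle_mean f a r)"

definition plurisubharmonic_on :: "(complex \<times> complex) set \<Rightarrow> (complex \<times> complex \<Rightarrow> ereal) \<Rightarrow> bool" where
  "plurisubharmonic_on \<Omega> f \<longleftrightarrow>
     upper_semicontinuous_on \<Omega> f \<and> (\<forall>x\<in>\<Omega>. f x < \<infinity>) \<and>
     (\<forall>a1 a2 b1 b2.
        subharmonic_on {w. (a1 + w * b1, a2 + w * b2) \<in> \<Omega>} (\<lambda>w. f (a1 + w * b1, a2 + w * b2)))"

definition has_log_pole :: "(complex \<times> complex) set \<Rightarrow> (complex \<times> complex \<Rightarrow> ereal) \<Rightarrow> complex \<times> complex \<Rightarrow> bool" where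
  "has_log_pole \<Omega> f a \<longleftrightarrow>
     (\<exists>C::real. \<forall>\<^sub>F y in at a within \<Omega>. f y - ereal (ln (norm (y - a))) \<le> ereal C)"

definition pluricomplex_green ::
  "(complex \<times> complex) set \<Rightarrow> complex \<times> complex \<Rightarrow> complex \<times> complex \<Rightarrow> complex \<times> complex \<Rightarrow> ereal" where
  "pluricomplex_green \<Omega> x P Q =
     Sup {f x | f. plurisubharmonic_on \<Omega> f \<and> (\<forall>y\<in>\<Omega>. f y < 0) \<and>
                   has_log_pole \<Omega> f P \<and> has_log_pole \<Omega> f Q}"

abbreviation bidisk :: "(complex \<times> complex) set" where
  "bidisk \<equiv> ball 0 1 \<times> ball 0 1"

text \<open>\<open>log_abs w\<close> is \<open>log \<bar>w\<bar>\<close> with \<open>log 0 = -\<infinity>\<close>, whereas \<open>ln 0 = 0\<close> in the library.\<close>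

definition log_abs :: "complex \<Rightarrow> ereal" where
  "log_abs w = (if w = 0 then - \<infinity> else ereal (ln (norm w)))"

end

theory Submission
  imports Defs "HOL-Complex_Analysis.Complex_Analysis" "HOL-Probability.Probability_Measure"
begin

text \<open>
  The Green function is squeezed between a holomorphic function on the bidisk and a holomorphic disc
  in it.

  In the coordinates \<open>h = (1 + y) / (1 - y)\<close>, which map the unit disc to the right half-plane, the
  quotient of the statement becomes \<open>F = (W - 1) / (W + 1)\<close>, where \<open>W\<close> is a linear combination of the two
  coordinates \<open>h1, h2\<close> with positive coefficients (\<open>inner_quotient_cayley\<close>).  So \<open>F\<close> maps the bidisk into the unit disc; it
  vanishes at both poles, and \<open>ln \<bar>F\<bar>\<close> is a competitor in the supremum (\<open>plurisubharmonic_on_log_abs\<close>,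
  \<open>has_log_pole_log_abs\<close>).

  In the same coordinates the equation defining \<open>r\<close> is a real conic through the two poles
  (\<open>level_conic\<close>), and the bounds on \<open>r\<close> say that it is the curve
  \<open>h1 = l1 * s + l2 / s, h2 = k1 * s + k2 / s\<close> with positive coefficients (\<open>level_parameter\<close>,
  \<open>conic_coefficients\<close>).  For complex \<open>s\<close> with \<open>Re s > 0\<close> this is a holomorphic disc in the bidisk
  that passes through the point \<open>z\<close>, and through the poles at \<open>s = 1\<close> and \<open>s = \<sigma>\<close>.  Since \<open>W\<close> is
  linear in \<open>h1, h2\<close>, it is again of the form \<open>a * s + b / s\<close> on the disc, and \<open>F\<close> becomes the Blaschke
  product with zeros \<open>1\<close> and \<open>\<sigma>\<close> (\<open>extremal_disc_eq\<close>).  Every competitor restricted to the disc is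
  bounded by the logarithm of this Blaschke product, so it is at most \<open>ln \<bar>F\<bar>\<close> at \<open>z\<close>.

  The last step needs the maximum principle for a plurisubharmonic function along a curved disc,
  whereas the definition speaks of complex lines only.  The function is truncated and
  convolved with a kernel, after which the disc may be replaced by its tangent line up to an error
  \<open>O(r\<^sup>3)\<close> in the mean over a circle of radius \<open>r\<close> (\<open>smooth_disc_submean\<close>); a maximum principle that
  tolerates such an error (\<open>maximum_principle\<close>) then gives the bound (\<open>psh_disc_upper_bound\<close>).  The
  same maximum principle shows that \<open>ln \<bar>G\<bar>\<close> is subharmonic for holomorphic \<open>G\<close> with zeros
  (\<open>log_abs_submean\<close>).

  The second half of the statement is the first one after the substitution of \<open>- p, - q, - z, - r\<close> for
  \<open>p, q, z, r\<close>.  Therefore \<open>p\<close> and \<open>q\<close> are real numbers of equal sign throughout, and a sign \<open>e\<close> moves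
  between \<open>y\<close> and the point \<open>e * y\<close> of the bidisk.
\<close>


section \<open>Means over circles\<close>

abbreviation circ :: "real measure" where
  "circ \<equiv> uniform_measure lborel {0..2 * pi}"

lemma prob_space_circ: "prob_space circ"
  by (rule prob_space_uniform_measure) (auto simp: ennreal_eq_0_iff pi_gt_zero[unfolded not_le[symmetric]])

lemma sets_circ: "sets circ = sets borel"
  by simp

lemma borel_measurable_circ_iff: "f \<in> borel_measurable circ \<longleftrightarrow> f \<in> borel_measurable borel"
  by (rule iffI) (simp_all add: measurable_cong_sets[OF sets_circ refl])

lemma circ_integrable_bounded:
  fixes f :: "real \<Rightarrow> 'b :: {banach, second_countable_topology}"
  assumes "f \<in> borel_measurable borel" "\<And>t. norm (f t) \<le> B"
  shows "integrable circ f"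
proof -
  interpret prob_space circ by (rule prob_space_circ)
  show ?thesis
    by (rule integrable_const_bound[where B = B]) (use assms in \<open>auto simp: borel_measurable_circ_iff\<close>)
qed

lemma circ_integrable_continuous:
  fixes f :: "complex \<Rightarrow> 'b :: {banach, second_countable_topology}"
  assumes "continuous_on (sphere 0 1) f"
  shows "integrable circ (\<lambda>t. f (cis t))"
proof -
  have "continuous_on UNIV (\<lambda>t. f (cis t))"
    by (rule continuous_on_compose2[OF assms]) (auto intro!: continuous_intros)
  then have m: "(\<lambda>t. f (cis t)) \<in> borel_measurable borel"
    by (rule borel_measurable_continuous_onI)
  have "bounded (f ` sphere 0 1)"
    by (intro compact_imp_bounded compact_continuous_image assms) auto
  then obtain B where "\<forall>x\<in>sphere 0 1. norm (f x) \<le> B"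
    unfolding bounded_iff by auto
  then show ?thesis
    by (intro circ_integrable_bounded[OF m, where B = B]) auto
qed

lemma circle_in_cball:
  "norm w = 1 \<Longrightarrow> 0 \<le> r \<Longrightarrow> z + complex_of_real r * w \<in> cball z r"
  by (simp add: dist_norm norm_mult)

lemma continuous_on_circle:
  assumes "continuous_on (cball z r) u" "0 \<le> r"
  shows "continuous_on (sphere 0 1) (\<lambda>w. u (z + complex_of_real r * w))"
  by (rule continuous_on_compose2[OF assms(1)])
    (use circle_in_cball assms(2) in \<open>auto intro!: continuous_intros simp del: mem_cball\<close>)

lemma circ_integrable_circle:
  fixes u :: "complex \<Rightarrow> 'b :: {banach, second_countable_topology}"
  assumes "continuous_on (cball z r) u" "0 \<le> r"
  shows "integrable circ (\<lambda>t. u (z + complex_of_real r * cis t))"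
  by (rule circ_integrable_continuous[OF continuous_on_circle[OF assms]])

lemma circ_integral_eq:
  fixes f :: "real \<Rightarrow> 'b :: euclidean_space"
  assumes f: "continuous_on UNIV f"
  shows "integral\<^sup>L circ f = (1 / (2 * pi)) *\<^sub>R integral {0..2 * pi} f"
proof -
  have m [measurable]: "f \<in> borel_measurable borel"
    by (rule borel_measurable_continuous_onI) fact
  have c: "continuous_on {0..2 * pi} f"
    by (rule continuous_on_subset[OF f]) simp
  have "circ = density lborel (\<lambda>t. ennreal (indicator {0..2 * pi} t / (2 * pi)))"
    unfolding uniform_measure_def
    by (intro density_cong)
      (auto split: split_indicator simp: ennreal_divide_numeral divide_ennreal[symmetric] simp flip: ennreal_1)
  then have "integral\<^sup>L circ f = (LINT t|lborel. (indicator {0..2 * pi} t / (2 * pi)) *\<^sub>R f t)"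
    by (simp add: integral_density)
  also have "\<dots> = (LINT t|lborel. (1 / (2 * pi)) *\<^sub>R (indicator {0..2 * pi} t *\<^sub>R f t))"
    by (intro Bochner_Integration.integral_cong) (auto split: split_indicator)
  also have "\<dots> = (1 / (2 * pi)) *\<^sub>R (LINT t:{0..2 * pi}|lborel. f t)"
    unfolding set_lebesgue_integral_def by (rule integral_scaleR_right)
  also have "(LINT t:{0..2 * pi}|lborel. f t) = integral {0..2 * pi} f"
    by (rule set_borel_integral_eq_integral(2)) (rule borel_integrable_compact[OF _ c, folded set_integrable_def], simp)
  finally show ?thesis .
qed

text \<open>Gauss's mean value property is Cauchy's formula at the centre of the circle.\<close>

lemma mean_value_holomorphic:
  fixes f :: "complex \<Rightarrow> complex"
  assumes f: "continuous_on (cball a r) f" "f holomorphic_on ball a r" and r: "r > 0"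
  shows "(LINT t|circ. f (a + complex_of_real r * cis t)) = f a"
proof -
  have c: "continuous_on UNIV (\<lambda>t. f (a + complex_of_real r * cis t))"
    by (rule continuous_on_compose2[OF f(1)])
      (use r in \<open>auto intro!: continuous_intros circle_in_cball simp del: mem_cball\<close>)
  have "((\<lambda>u. f u / (u - a)) has_contour_integral (2 * of_real pi * \<i> * f a)) (circlepath a r)"
    by (rule Cauchy_integral_circlepath[OF f]) (use r in simp)
  then have "((\<lambda>t. f (a + r * cis t) / (a + r * cis t - a) * r * \<i> * cis t)
      has_integral (2 * of_real pi * \<i> * f a)) {0..2 * pi}"
    unfolding circlepath_def by (subst (asm) has_contour_integral_part_circlepath_iff) auto
  then have "((\<lambda>t. (f (a + r * cis t) / (a + r * cis t - a) * r * \<i> * cis t) * (1 / (2 * of_real pi * \<i>)))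
      has_integral (2 * of_real pi * \<i> * f a) * (1 / (2 * of_real pi * \<i>))) {0..2 * pi}"
    by (rule has_integral_mult_left)
  then have "((\<lambda>t. f (a + r * cis t) * (1 / (2 * of_real pi))) has_integral f a) {0..2 * pi}"
    using r by (simp add: field_simps)
  then have "((\<lambda>t. f (a + r * cis t) * (1 / (2 * of_real pi)) * (2 * of_real pi)) has_integral f a * (2 * of_real pi)) {0..2 * pi}"
    by (rule has_integral_mult_left)
  then have "integral {0..2 * pi} (\<lambda>t. f (a + r * cis t)) = f a * (2 * of_real pi)"
    by (intro integral_unique) simp
  then show ?thesis
    unfolding circ_integral_eq[OF c] by (simp add: scaleR_conv_of_real)
qed

text \<open>Off the zeros of a holomorphic function, the logarithm of its modulus is the real part of a
  holomorphic logarithm.\<close>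

lemma mean_value_ln_norm:
  fixes f :: "complex \<Rightarrow> complex"
  assumes f: "f holomorphic_on S" "open S" "cball a r \<subseteq> S" and nz: "\<And>z. z \<in> cball a r \<Longrightarrow> f z \<noteq> 0" and r: "r > 0"
  shows "(LINT t|circ. ln (norm (f (a + complex_of_real r * cis t)))) = ln (norm (f a))"
proof -
  have hol: "f holomorphic_on cball a r"
    using f by (meson holomorphic_on_subset)
  obtain g where g: "g holomorphic_on cball a r" "\<And>z. z \<in> cball a r \<Longrightarrow> f z = exp (g z)"
    using contractible_imp_holomorphic_log[OF hol convex_imp_contractible nz] by (metis convex_cball)
  have ln: "ln (norm (f z)) = Re (g z)" if "z \<in> cball a r" for z
    using g(2)[OF that] by simp
  have cg: "continuous_on (cball a r) g"
    by (rule holomorphic_on_imp_continuous_on) fact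
  have int: "integrable circ (\<lambda>t. g (a + complex_of_real r * cis t))"
    by (rule circ_integrable_circle[OF cg]) (use r in simp)
  have "(LINT t|circ. ln (norm (f (a + complex_of_real r * cis t)))) = (LINT t|circ. Re (g (a + complex_of_real r * cis t)))"
    by (intro Bochner_Integration.integral_cong refl ln) (use r in \<open>auto simp: dist_norm norm_mult\<close>)
  also have "\<dots> = Re (LINT t|circ. g (a + complex_of_real r * cis t))"
    by (rule integral_Re[OF int])
  also have "(LINT t|circ. g (a + complex_of_real r * cis t)) = g a"
    using mean_value_holomorphic[OF cg _ r] g(1) by (meson ball_subset_cball holomorphic_on_subset)
  also have "Re (g a) = ln (norm (f a))"
    using ln[of a] r by simp
  finally show ?thesis .
qed

section \<open>A maximum principle\<close>

lemma mean_norm_square: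
  "(LINT t|circ. (norm (a + complex_of_real r * cis t))\<^sup>2) = (norm a)\<^sup>2 + r\<^sup>2"
proof (cases "r = 0")
  case True
  interpret prob_space circ by (rule prob_space_circ)
  show ?thesis using True by (simp add: prob_space)
next
  case False
  interpret prob_space circ by (rule prob_space_circ)
  define f :: "complex \<Rightarrow> complex" where "f = (\<lambda>z. 2 * cnj a * complex_of_real r * z)"
  have mv: "(LINT t|circ. f (0 + complex_of_real 1 * cis t)) = f 0"
    by (rule mean_value_holomorphic) (auto simp: f_def intro!: continuous_intros holomorphic_intros)
  have int: "integrable circ (\<lambda>t. f (cis t))"
    by (rule circ_integrable_continuous) (auto simp: f_def intro!: continuous_intros)
  have eq: "(norm (a + complex_of_real r * cis t))\<^sup>2 = ((norm a)\<^sup>2 + r\<^sup>2) + Re (f (cis t))" for t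
  proof -
    have "(cmod (a + r * cis t))\<^sup>2 = (cmod a)\<^sup>2 + (cmod (r * cis t))\<^sup>2 + 2 * Re (cnj a * (r * cis t))"
      unfolding cmod_power2 by (simp add: power2_eq_square algebra_simps)
    then show ?thesis by (simp add: f_def norm_mult algebra_simps)
  qed
  have "(LINT t|circ. (norm (a + complex_of_real r * cis t))\<^sup>2) =
      (LINT t|circ. ((norm a)\<^sup>2 + r\<^sup>2)) + (LINT t|circ. Re (f (cis t)))"
    unfolding eq using int by (intro Bochner_Integration.integral_add) auto
  also have "(LINT t|circ. Re (f (cis t))) = Re (f 0)"
    using mv integral_Re[OF int] by simp
  also have "f 0 = 0" by (simp add: f_def)
  finally show ?thesis by (simp add: prob_space)
qed

text \<open>The error term \<open>C * r ^ 3\<close> is harmless because the addition of \<open>e * (norm t)\<^sup>2\<close> raises every mean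
  over a circle of radius \<open>r\<close> by \<open>e * r\<^sup>2\<close>.\<close>

lemma maximum_principle:
  fixes v :: "complex \<Rightarrow> real"
  assumes K: "compact K" and v: "continuous_on K v" and U: "open U" "U \<subseteq> K"
    and bd: "\<And>t. t \<in> K - U \<Longrightarrow> v t \<le> c"
    and sub: "\<And>t. t \<in> U \<Longrightarrow> \<exists>C. \<exists>r0>0. \<forall>r. 0 < r \<and> r < r0 \<longrightarrow>
        v t \<le> (LINT s|circ. v (t + complex_of_real r * cis s)) + C * r ^ 3"
    and t1: "t1 \<in> K"
  shows "v t1 \<le> c"
proof (rule ccontr)
  interpret prob_space circ by (rule prob_space_circ)
  assume "\<not> v t1 \<le> c"
  then have gt: "c < v t1" by simp
  obtain T where T: "\<And>t. t \<in> K \<Longrightarrow> norm t \<le> T"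
    using compact_imp_bounded[OF K] unfolding bounded_iff by blast
  \<comment> \<open>Small enough that the perturbed function still has no maximum over \<open>K\<close> outside \<open>U\<close>.\<close>
  define e where "e = (v t1 - c) / (2 * (T\<^sup>2 + 1))"
  have T1: "T\<^sup>2 + 1 > 0" by (smt (verit) zero_le_power2)
  have e: "e > 0" unfolding e_def using gt T1 by simp
  have eT: "e * T\<^sup>2 < v t1 - c"
  proof -
    have "e * T\<^sup>2 \<le> e * (T\<^sup>2 + 1)" using e by simp
    also have "\<dots> = (v t1 - c) / 2" using T1 unfolding e_def by (simp add: field_simps)
    finally show ?thesis using gt by simp
  qed
  define w where "w = (\<lambda>t. v t + e * (norm t)\<^sup>2)"
  have cw: "continuous_on K w"
    unfolding w_def by (intro continuous_intros v)
  obtain t where t: "t \<in> K" "\<And>y. y \<in> K \<Longrightarrow> w y \<le> w t"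
    using continuous_attains_sup[OF K _ cw] t1 by blast
  have "t \<in> U"
  proof (rule ccontr)
    assume "t \<notin> U"
    then have "v t \<le> c" using bd t by auto
    moreover have "(norm t)\<^sup>2 \<le> T\<^sup>2" using T[OF t(1)] by (simp add: power_mono)
    ultimately have "w t \<le> c + e * T\<^sup>2" unfolding w_def using e by (intro add_mono mult_left_mono) auto
    also have "\<dots> < v t1" using eT by simp
    also have "\<dots> \<le> w t1" unfolding w_def using e by simp
    also have "\<dots> \<le> w t" by (rule t(2)[OF t1])
    finally show False by simp
  qed
  obtain C r0 where r0: "r0 > 0" and sm: "\<And>r. 0 < r \<Longrightarrow> r < r0 \<Longrightarrow>
      v t \<le> (LINT s|circ. v (t + complex_of_real r * cis s)) + C * r ^ 3"
    using sub[OF \<open>t \<in> U\<close>] by blast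
  obtain r1 where r1: "r1 > 0" "cball t r1 \<subseteq> U"
    using open_contains_cball U(1) \<open>t \<in> U\<close> by blast
  define r where "r = min (r0 / 2) (min r1 (e / (2 * (\<bar>C\<bar> + 1))))"
  have r: "0 < r" "r < r0" "r \<le> r1" "r \<le> e / (2 * (\<bar>C\<bar> + 1))"
    unfolding r_def using r0 r1 e by (auto simp: min_less_iff_disj)
  have sub: "cball t r \<subseteq> K"
    using subset_cball[OF r(3)] r1(2) U(2) by blast
  have inK: "t + complex_of_real r * cis s \<in> K" for s
    using r by (intro subsetD[OF sub] circle_in_cball) auto
  have int: "integrable circ (\<lambda>s. v (t + complex_of_real r * cis s))"
    by (rule circ_integrable_circle[OF continuous_on_subset[OF v sub]]) (use r in simp)
  have int2: "integrable circ (\<lambda>s. (norm (t + complex_of_real r * cis s))\<^sup>2)"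
    by (rule circ_integrable_continuous) (auto intro!: continuous_intros)
  have "(LINT s|circ. w (t + complex_of_real r * cis s)) \<le> (LINT s|circ. w t)"
    unfolding w_def by (rule integral_mono)
      (use int int2 t(2)[OF inK] in \<open>auto simp: w_def\<close>)
  also have "(LINT s|circ. w t) = w t" by (simp add: prob_space)
  also have "(LINT s|circ. w (t + complex_of_real r * cis s)) =
      (LINT s|circ. v (t + complex_of_real r * cis s)) + e * ((norm t)\<^sup>2 + r\<^sup>2)"
    unfolding w_def using int int2 by (simp add: mean_norm_square)
  finally have "v t - C * r ^ 3 + e * ((norm t)\<^sup>2 + r\<^sup>2) \<le> v t + e * (norm t)\<^sup>2"
    using sm[OF r(1,2)] unfolding w_def by simp
  then have "e * r\<^sup>2 \<le> C * r ^ 3" by (simp add: algebra_simps)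
  then have "r\<^sup>2 * e \<le> r\<^sup>2 * (C * r)" by (simp add: power2_eq_square power3_eq_cube mult_ac)
  then have "e \<le> C * r" using r(1) by simp
  also have "\<dots> \<le> (\<bar>C\<bar> + 1) * r" using r(1) by (intro mult_right_mono) auto
  also have "\<dots> \<le> (\<bar>C\<bar> + 1) * (e / (2 * (\<bar>C\<bar> + 1)))" using r(4) by (intro mult_left_mono) auto
  also have "\<dots> = e / 2" by (simp add: field_simps)
  finally show False using e by simp
qed

lemma circ_integral_rotate:
  fixes f :: "complex \<Rightarrow> 'b :: euclidean_space"
  assumes f: "continuous_on (sphere 0 1) f"
  shows "(LINT s|circ. f (cis (s + \<tau>))) = (LINT s|circ. f (cis s))"
proof -
  define h where "h = (\<lambda>s. f (cis s))"
  have ch: "continuous_on A h" for A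
    unfolding h_def by (rule continuous_on_compose2[OF f]) (auto intro!: continuous_intros)
  have per: "h (s + 2 * pi) = h s" for s
    unfolding h_def by (simp add: cis_mult[symmetric])
  have io: "h integrable_on {a..b}" for a b
    by (rule integrable_continuous_real[OF ch])
  have shift: "integral {a..b} (\<lambda>s. h (s + c)) = integral {a + c..b + c} h" for a b c
    using integral_shift_real_ivl[of "a + c" c "b + c" h] by simp
  have main: "integral {0..2 * pi} (\<lambda>s. h (s + x)) = integral {0..2 * pi} h" if x: "0 \<le> x" "x \<le> 2 * pi" for x
  proof -
    have "integral {0..2 * pi} (\<lambda>s. h (s + x)) = integral {x..2 * pi + x} h"
      using shift[of 0 "2 * pi" x] by simp
    also have "\<dots> = integral {x..2 * pi} h + integral {2 * pi..2 * pi + x} h"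
      using Henstock_Kurzweil_Integration.integral_combine[of x "2 * pi" "2 * pi + x" h] x io by simp
    also have "integral {2 * pi..2 * pi + x} h = integral {0..x} (\<lambda>s. h (s + 2 * pi))"
      using shift[of 0 x "2 * pi"] x by (simp add: add.commute)
    also have "\<dots> = integral {0..x} h" by (simp add: per)
    also have "integral {x..2 * pi} h + integral {0..x} h = integral {0..2 * pi} h"
      using Henstock_Kurzweil_Integration.integral_combine[of 0 x "2 * pi" h] x io by (simp add: add.commute)
    finally show ?thesis .
  qed
  define x where "x = Arg2pi (cis \<tau>)"
  have x: "0 \<le> x" "x \<le> 2 * pi" "cis x = cis \<tau>"
  proof -
    show "0 \<le> x" "x \<le> 2 * pi"
      unfolding x_def using Arg2pi_ge_0[of "cis \<tau>"] Arg2pi_lt_2pi[of "cis \<tau>"] by auto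
    show "cis x = cis \<tau>"
      unfolding x_def using Arg2pi_eq[of "cis \<tau>"] by (simp only: cis_conv_exp[of "Arg2pi _"]) simp
  qed
  have eq: "f (cis (s + \<tau>)) = h (s + x)" for s
    unfolding h_def by (simp add: cis_mult[symmetric] x(3))
  have "continuous_on UNIV (\<lambda>s. h (s + x))"
    by (rule continuous_on_compose2[OF ch[of UNIV]]) (auto intro!: continuous_intros)
  then show ?thesis
    using circ_integral_eq[of "\<lambda>s. h (s + x)"] circ_integral_eq[OF ch] main[OF x(1,2)]
    unfolding eq by (simp add: h_def)
qed

lemma circ_mean_swap:
  fixes f :: "real \<Rightarrow> real \<Rightarrow> real"
  assumes c: "continuous_on UNIV (\<lambda>x. f (fst x) (snd x))" and b: "\<And>s t. \<bar>f s t\<bar> \<le> B"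
  shows "(LINT s|circ. LINT t|circ. f s t) = (LINT t|circ. LINT s|circ. f s t)"
proof -
  interpret C: prob_space circ by (rule prob_space_circ)
  interpret P: pair_prob_space circ circ by standard
  have "(\<lambda>x. f (fst x) (snd x)) \<in> borel_measurable borel"
    by (rule borel_measurable_continuous_onI[OF c])
  moreover have "sets (circ \<Otimes>\<^sub>M circ) = sets (borel :: (real \<times> real) measure)"
    unfolding borel_prod[symmetric] by (intro sets_pair_measure_cong) auto
  ultimately have "case_prod f \<in> borel_measurable (circ \<Otimes>\<^sub>M circ)"
    unfolding case_prod_beta' by (subst measurable_cong_sets[OF _ refl]) auto
  then have "integrable (circ \<Otimes>\<^sub>M circ) (case_prod f)"
    by (intro P.P.integrable_const_bound[where B = B]) (auto simp: b)
  from P.Fubini_integral[OF this] show ?thesis by simp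
qed

section \<open>The logarithm of the modulus of a holomorphic function\<close>

text \<open>The function \<open>ln (max \<bar>G\<bar> e)\<close> satisfies the mean value inequality on all circles below a fixed
  radius: where \<open>\<bar>G\<bar> > e\<close> at the centre, uniform continuity keeps a whole disc free of zeros, and
  elsewhere the centre carries the minimal value.  Averaging over rotations about \<open>a\<close> preserves this and
  makes the function radial, so the maximum principle compares the centre with the boundary circle; this
  gives the mean value inequality for the given circle without a factorization of \<open>G\<close>.\<close>

lemma ln_norm_truncated_submean:
  fixes G :: "complex \<Rightarrow> complex"
  assumes G: "G holomorphic_on S" "open S" "cball a R \<subseteq> S" and R: "R > 0" and e: "e > 0"
  shows "ln (max (norm (G a)) e) \<le> (LINT s|circ. ln (max (norm (G (a + complex_of_real R * cis s))) e))"
proof -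
  interpret prob_space circ by (rule prob_space_circ)
  define u where "u = (\<lambda>z. ln (max (norm (G z)) e))"
  have cG: "continuous_on (cball a R) G"
    using G by (meson holomorphic_on_imp_continuous_on holomorphic_on_subset)
  have cu: "continuous_on (cball a R) u"
    unfolding u_def using e by (intro continuous_intros cG) auto
  have ucG: "uniformly_continuous_on (cball a R) G" and ucu: "uniformly_continuous_on (cball a R) u"
    using cG cu by (auto intro: compact_uniformly_continuous)
  have ue: "ln e \<le> u z" for z unfolding u_def using e by simp
  obtain d where d: "d > 0" "\<And>x y. x \<in> cball a R \<Longrightarrow> y \<in> cball a R \<Longrightarrow> dist y x < d \<Longrightarrow> dist (G y) (G x) < e"
    using ucG e unfolding uniformly_continuous_on_def by metis
  obtain B where B: "\<And>z. z \<in> cball a R \<Longrightarrow> \<bar>u z\<bar> \<le> B"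
    using compact_imp_bounded[OF compact_continuous_image[OF cu compact_cball]]
    unfolding bounded_iff by (metis imageI real_norm_def)
  have intu: "integrable circ (\<lambda>t. u (z + complex_of_real r * cis t))" if "cball z r \<subseteq> cball a R" "r \<ge> 0" for z r
    by (rule circ_integrable_circle[OF continuous_on_subset[OF cu that(1)] that(2)])
  have loc: "u z \<le> (LINT t|circ. u (z + complex_of_real r * cis t))"
    if zr: "cball z r \<subseteq> cball a R" "0 < r" "r < d" for z r
  proof (cases "norm (G z) \<le> e")
    case True
    then have "u z = ln e" by (simp add: u_def)
    then have "u z = (LINT t|circ. ln e)" by (simp add: prob_space)
    also have "\<dots> \<le> (LINT t|circ. u (z + complex_of_real r * cis t))"
      using ue intu zr by (intro integral_mono) auto
    finally show ?thesis .
  next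
    case False
    have zin: "z \<in> cball a R" using zr(1,2) by (intro subsetD[OF zr(1)]) simp
    have nz: "G y \<noteq> 0" if y: "y \<in> cball z r" for y
    proof
      assume "G y = 0"
      moreover have "dist (G y) (G z) < e"
      proof (rule d(2)[OF zin])
        show "y \<in> cball a R" using y zr(1) by blast
        show "dist y z < d" using y zr(3) by (simp add: dist_commute)
      qed
      ultimately show False using False by (simp add: dist_norm)
    qed
    have lnu: "ln (norm (G y)) \<le> u y" if y: "y \<in> cball z r" for y
      unfolding u_def using nz[OF y] e by (subst ln_le_cancel_iff) auto
    have sub: "cball z r \<subseteq> S" using zr G(3) by auto
    have cl: "continuous_on (cball z r) (\<lambda>y. ln (norm (G y)))"
      using nz by (intro continuous_intros continuous_on_subset[OF cG zr(1)]) auto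
    have il: "integrable circ (\<lambda>t. ln (norm (G (z + complex_of_real r * cis t))))"
      by (rule circ_integrable_circle[OF cl]) (use zr in simp)
    have "u z = ln (norm (G z))" unfolding u_def using False by simp
    also have "\<dots> = (LINT t|circ. ln (norm (G (z + complex_of_real r * cis t))))"
      by (rule mean_value_ln_norm[OF G(1,2) sub nz zr(2), symmetric])
    also have "\<dots> \<le> (LINT t|circ. u (z + complex_of_real r * cis t))"
      by (rule integral_mono) (use il intu[of z r] zr lnu in \<open>auto simp: dist_norm norm_mult\<close>)
    finally show ?thesis .
  qed
  define ub where "ub = (\<lambda>w. LINT s|circ. u (a + w * cis s))"
  have iub: "integrable circ (\<lambda>s. u (a + w * cis s))" if "norm w \<le> R" for w
    by (rule circ_integrable_continuous, rule continuous_on_compose2[OF cu])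
      (use that in \<open>auto intro!: continuous_intros simp: dist_norm norm_mult\<close>)
  have cub: "continuous_on (cball 0 R) ub"
    unfolding continuous_on_iff
  proof (intro ballI allI impI)
    fix w :: complex and \<epsilon> :: real
    assume w: "w \<in> cball 0 R" and \<epsilon>: "\<epsilon> > 0"
    obtain \<delta> where \<delta>: "\<delta> > 0" "\<And>x y. x \<in> cball a R \<Longrightarrow> y \<in> cball a R \<Longrightarrow> dist y x < \<delta> \<Longrightarrow> dist (u y) (u x) < \<epsilon> / 2"
      using ucu \<epsilon> unfolding uniformly_continuous_on_def by (metis half_gt_zero)
    have "dist (ub w') (ub w) < \<epsilon>" if w': "w' \<in> cball 0 R" "dist w' w < \<delta>" for w'
    proof -
      have i: "integrable circ (\<lambda>s. u (a + w' * cis s))" "integrable circ (\<lambda>s. u (a + w * cis s))"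
        using iub w w' by auto
      have p: "\<bar>u (a + w' * cis s) - u (a + w * cis s)\<bar> \<le> \<epsilon> / 2" for s
      proof -
        have "dist (a + w' * cis s) (a + w * cis s) = dist w' w"
          by (simp add: dist_norm norm_mult flip: left_diff_distrib)
        then have "dist (u (a + w' * cis s)) (u (a + w * cis s)) < \<epsilon> / 2"
          using w w' by (intro \<delta>(2)) (auto simp: dist_norm norm_mult)
        then show ?thesis by (simp add: dist_real_def)
      qed
      have "\<bar>ub w' - ub w\<bar> = \<bar>LINT s|circ. (u (a + w' * cis s) - u (a + w * cis s))\<bar>"
        unfolding ub_def using i by simp
      also have "\<dots> \<le> (LINT s|circ. \<bar>u (a + w' * cis s) - u (a + w * cis s)\<bar>)"
        by (rule integral_abs_bound)
      also have "\<dots> \<le> (LINT s|circ. \<epsilon> / 2)"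
        by (rule integral_mono) (use i p in auto)
      also have "\<dots> < \<epsilon>" using \<epsilon> by (simp add: prob_space)
      finally show ?thesis by (simp add: dist_real_def)
    qed
    then show "\<exists>d>0. \<forall>x'\<in>cball 0 R. dist x' w < d \<longrightarrow> dist (ub x') (ub w) < \<epsilon>"
      using \<delta>(1) by blast
  qed
  have "ub 0 \<le> ub (complex_of_real R)"
  proof (rule maximum_principle[OF compact_cball cub, where U = "ball 0 R"])
    show "ub t \<le> ub (complex_of_real R)" if "t \<in> cball 0 R - ball 0 R" for t
    proof -
      have "norm t = R" using that by auto
      then have t: "t = complex_of_real R * cis (Arg2pi t)"
        using Arg2pi_eq[of t] by (simp only: cis_conv_exp)
      have c: "continuous_on (sphere 0 1) (\<lambda>z. u (a + complex_of_real R * z))"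
        by (rule continuous_on_circle[OF cu]) (use R in simp)
      have "ub t = (LINT s|circ. u (a + complex_of_real R * cis (s + Arg2pi t)))"
        unfolding ub_def by (subst t) (simp add: cis_mult add.commute mult.assoc)
      also have "\<dots> = ub (complex_of_real R)"
        unfolding ub_def using circ_integral_rotate[OF c] by simp
      finally show ?thesis by simp
    qed
    show "\<exists>C. \<exists>r0>0. \<forall>r. 0 < r \<and> r < r0 \<longrightarrow> ub t \<le> (LINT s|circ. ub (t + complex_of_real r * cis s)) + C * r ^ 3"
      if t: "t \<in> ball 0 R" for t
    proof (rule exI[of _ 0], rule exI[of _ "min d (R - norm t)"], intro conjI allI impI)
      show "0 < min d (R - norm t)" using d t by auto
      fix r assume r: "0 < r \<and> r < min d (R - norm t)"
      have inR: "norm (t + complex_of_real r * cis \<tau>) \<le> R" for \<tau>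
      proof -
        have "norm (t + complex_of_real r * cis \<tau>) \<le> norm t + r"
          using norm_triangle_ineq[of t "complex_of_real r * cis \<tau>"] r by (simp add: norm_mult)
        then show ?thesis using r by linarith
      qed
      have inball: "a + (t + complex_of_real r * cis \<tau>) * cis s \<in> cball a R" for s \<tau>
        using inR[of \<tau>] by (simp add: dist_norm norm_mult)
      have sub: "cball (a + t * cis s) r \<subseteq> cball a R" for s
      proof
        fix y assume "y \<in> cball (a + t * cis s) r"
        then have "dist a y \<le> norm (t * cis s) + r"
          using dist_triangle[of a y "a + t * cis s"] by (simp add: dist_norm)
        then show "y \<in> cball a R" using r by (simp add: norm_mult)
      qed
      have "ub t \<le> (LINT s|circ. LINT \<tau>|circ. u (a + (t + complex_of_real r * cis \<tau>) * cis s))"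
        unfolding ub_def
      proof (rule integral_mono)
        show "integrable circ (\<lambda>s. u (a + t * cis s))" using iub t by auto
        have eq: "(LINT \<tau>|circ. u (a + (t + complex_of_real r * cis \<tau>) * cis s)) =
            (LINT \<tau>|circ. u ((a + t * cis s) + complex_of_real r * cis \<tau>))" for s
        proof -
          have "continuous_on (sphere 0 1) (\<lambda>z. u ((a + t * cis s) + complex_of_real r * z))"
            by (rule continuous_on_circle[OF continuous_on_subset[OF cu sub]]) (use r in simp)
          from circ_integral_rotate[OF this, of s] show ?thesis
            by (simp add: cis_mult[symmetric] algebra_simps)
        qed
        show "u (a + t * cis s) \<le> (LINT \<tau>|circ. u (a + (t + complex_of_real r * cis \<tau>) * cis s))" for s
          unfolding eq by (rule loc[OF sub]) (use r in auto)
        have mk: "(\<lambda>x. u (a + (t + complex_of_real r * cis (snd x)) * cis (fst x))) \<in> borel_measurable (circ \<Otimes>\<^sub>M circ)"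
        proof -
          have "continuous_on UNIV (\<lambda>x. u (a + (t + complex_of_real r * cis (snd x)) * cis (fst x)))"
            by (rule continuous_on_compose2[OF cu]) (use inball in \<open>auto intro!: continuous_intros\<close>)
          moreover have "sets (circ \<Otimes>\<^sub>M circ) = sets (borel :: (real \<times> real) measure)"
            unfolding borel_prod[symmetric] by (intro sets_pair_measure_cong) auto
          ultimately show ?thesis
            by (subst measurable_cong_sets[OF _ refl]) (auto intro!: borel_measurable_continuous_onI)
        qed
        then have "(\<lambda>s. LINT \<tau>|circ. u (a + (t + complex_of_real r * cis \<tau>) * cis s)) \<in> borel_measurable circ"
          by (intro borel_measurable_lebesgue_integral) (simp add: case_prod_beta')
        then show "integrable circ (\<lambda>s. LINT \<tau>|circ. u (a + (t + complex_of_real r * cis \<tau>) * cis s))"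
        proof (rule integrable_const_bound[where B = B, rotated], intro AE_I2)
          fix s
          have "\<bar>LINT \<tau>|circ. u (a + (t + complex_of_real r * cis \<tau>) * cis s)\<bar> \<le>
              (LINT \<tau>|circ. \<bar>u (a + (t + complex_of_real r * cis \<tau>) * cis s)\<bar>)"
            by (rule integral_abs_bound)
          also have "\<dots> \<le> (LINT \<tau>|circ. B)"
          proof (rule integral_mono')
            show "\<bar>u (a + (t + complex_of_real r * cis \<tau>) * cis s)\<bar> \<le> B" for \<tau>
              by (rule B[OF inball])
            show "0 \<le> B" using order_trans[OF abs_ge_zero B[OF inball[of 0 0]]] .
          qed simp
          finally show "norm (LINT \<tau>|circ. u (a + (t + complex_of_real r * cis \<tau>) * cis s)) \<le> B"
            by (simp add: prob_space)
        qed
      qed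
      also have "\<dots> = (LINT \<tau>|circ. LINT s|circ. u (a + (t + complex_of_real r * cis \<tau>) * cis s))"
      proof (rule circ_mean_swap)
        show "continuous_on UNIV (\<lambda>x. u (a + (t + complex_of_real r * cis (snd x)) * cis (fst x)))"
          by (rule continuous_on_compose2[OF cu]) (use inball in \<open>auto intro!: continuous_intros\<close>)
        show "\<bar>u (a + (t + complex_of_real r * cis \<tau>) * cis s)\<bar> \<le> B" for s \<tau>
          by (rule B[OF inball])
      qed
      finally show "ub t \<le> (LINT s|circ. ub (t + complex_of_real r * cis s)) + 0 * r ^ 3"
        unfolding ub_def by simp
    qed
  qed (use R in auto)
  then show ?thesis
    unfolding ub_def u_def by (simp add: prob_space)
qed

text \<open>The truncation level \<open>exp (- n)\<close> tends to \<open>0\<close>; monotone convergence applies because the logarithms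
  are nonpositive, and it also covers circles that meet zeros of \<open>G\<close>.\<close>

lemma log_abs_submean:
  fixes G :: "complex \<Rightarrow> complex"
  assumes G: "G holomorphic_on S" "open S" "cball a R \<subseteq> S" and R: "R > 0"
    and le1: "\<And>z. z \<in> S \<Longrightarrow> norm (G z) \<le> 1"
  shows "log_abs (G a) \<le> circle_mean (\<lambda>z. log_abs (G z)) a R"
proof -
  interpret prob_space circ by (rule prob_space_circ)
  define g where "g = (\<lambda>s. G (a + complex_of_real R * cis s))"
  have inS: "a + complex_of_real R * cis s \<in> S" for s
    using R by (intro subsetD[OF G(3)] circle_in_cball) auto
  have cG: "continuous_on S G"
    using G by (simp add: holomorphic_on_imp_continuous_on)
  have cg: "continuous_on UNIV g"
    unfolding g_def by (rule continuous_on_compose2[OF cG]) (use inS in \<open>auto intro!: continuous_intros\<close>)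
  have mg [measurable]: "g \<in> borel_measurable borel"
    by (rule borel_measurable_continuous_onI[OF cg])
  define h where "h = (\<lambda>n s. - ln (max (norm (g s)) (exp (- real n))))"
  have aS: "a \<in> S" using G(3) R by auto
  have hle: "h n s \<le> n" "0 \<le> h n s" for n s
  proof -
    have "ln (exp (- real n)) \<le> ln (max (norm (g s)) (exp (- real n)))"
      by (subst ln_le_cancel_iff) (auto simp: max_def)
    then show "h n s \<le> n" unfolding h_def by simp
    have "ln (max (norm (g s)) (exp (- real n))) \<le> ln 1"
      by (subst ln_le_cancel_iff) (use le1[OF inS[of s]] in \<open>auto simp: g_def max_def\<close>)
    then show "0 \<le> h n s" unfolding h_def by simp
  qed
  have mh [measurable]: "h n \<in> borel_measurable borel" for n
    unfolding h_def by measurable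
  have ih: "integrable circ (h n)" for n
    by (rule circ_integrable_bounded[where B = n]) (use hle in auto)
  have bound: "(\<integral>\<^sup>+ s. ennreal (h n s) \<partial>circ) \<le> e2ennreal (- log_abs (G a))" for n
  proof -
    have "(\<integral>\<^sup>+ s. ennreal (h n s) \<partial>circ) = ennreal (LINT s|circ. h n s)"
      by (rule nn_integral_eq_integral[OF ih]) (use hle in auto)
    also have "(LINT s|circ. h n s) \<le> - ln (max (norm (G a)) (exp (- real n)))"
      using ln_norm_truncated_submean[OF G R, of "exp (- real n)"] unfolding h_def g_def by simp
    then have "ennreal (LINT s|circ. h n s) \<le> ennreal (- ln (max (norm (G a)) (exp (- real n))))"
      by (rule ennreal_leI)
    also have "\<dots> \<le> e2ennreal (- log_abs (G a))"
    proof (cases "G a = 0")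
      case True
      then show ?thesis by (simp add: log_abs_def)
    next
      case False
      then have "ln (norm (G a)) \<le> ln (max (norm (G a)) (exp (- real n)))"
        by (subst ln_le_cancel_iff) (auto simp: less_max_iff_disj)
      then show ?thesis using False
        by (simp add: log_abs_def flip: ennreal.abs_eq) (simp add: e2ennreal_ereal ennreal_leI)
    qed
    finally show ?thesis .
  qed
  have sup: "e2ennreal (- log_abs (g s)) \<le> (SUP n. ennreal (h n s))" for s
  proof (cases "g s = 0")
    case True
    then have "h n s = real n" for n by (simp add: h_def)
    then have "(SUP n. ennreal (h n s)) = (SUP n. of_nat n)" by (simp add: ennreal_of_nat_eq_real_of_nat)
    also have "\<dots> = (top :: ennreal)" by (rule ennreal_SUP_of_nat_eq_top)
    finally have "(SUP n. ennreal (h n s)) = top" .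
    then show ?thesis by (metis top_greatest)
  next
    case False
    obtain n :: nat where n: "real n > - ln (norm (g s))" using reals_Archimedean2 by blast
    have "exp (- real n) \<le> exp (ln (norm (g s)))" using n by (subst exp_le_cancel_iff) simp
    then have "h n s = - ln (norm (g s))" using False by (simp add: h_def max_def)
    then have "e2ennreal (- log_abs (g s)) = ennreal (h n s)"
      using False by (simp add: log_abs_def e2ennreal_ereal)
    then show ?thesis by (metis SUP_upper UNIV_I)
  qed
  have inc: "incseq (\<lambda>n s. ennreal (h n s))"
  proof (intro incseq_SucI le_funI ennreal_leI)
    show "h n s \<le> h (Suc n) s" for n s
      unfolding h_def by (simp, subst ln_le_cancel_iff) (auto simp: max_def intro: order_trans)
  qed
  have "(\<integral>\<^sup>+ s. e2ennreal (- log_abs (g s)) \<partial>circ) \<le> (\<integral>\<^sup>+ s. (SUP n. ennreal (h n s)) \<partial>circ)"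
    by (intro nn_integral_mono sup)
  also have "\<dots> = (SUP n. \<integral>\<^sup>+ s. ennreal (h n s) \<partial>circ)"
    by (rule nn_integral_monotone_convergence_SUP[OF inc]) (simp add: borel_measurable_circ_iff)
  also have "\<dots> \<le> e2ennreal (- log_abs (G a))"
    by (intro SUP_least bound)
  finally have neg: "(\<integral>\<^sup>+ s. e2ennreal (- log_abs (g s)) \<partial>circ) \<le> e2ennreal (- log_abs (G a))" .
  have np: "log_abs (G z) \<le> 0" if "z \<in> S" for z
    using le1[OF that] by (auto simp: log_abs_def)
  then have "e2ennreal (log_abs (g s)) = 0" for s
    unfolding g_def by (intro e2ennreal_neg np inS)
  then have "(\<integral>\<^sup>+ s. e2ennreal (log_abs (g s)) \<partial>circ) = 0" by simp
  then have "circle_mean (\<lambda>z. log_abs (G z)) a R = - enn2ereal (\<integral>\<^sup>+ s. e2ennreal (- log_abs (g s)) \<partial>circ)"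
    unfolding circle_mean_def Let_def g_def by (simp add: zero_ennreal.rep_eq)
  moreover have "enn2ereal (\<integral>\<^sup>+ s. e2ennreal (- log_abs (g s)) \<partial>circ) \<le> - log_abs (G a)"
  proof -
    have "0 \<le> - log_abs (G a)" using np[OF aS] by (metis ereal_0_le_uminus_iff)
    then have "enn2ereal (e2ennreal (- log_abs (G a))) = - log_abs (G a)" by (rule enn2ereal_e2ennreal)
    then show ?thesis using neg by (metis less_eq_ennreal.rep_eq)
  qed
  ultimately show ?thesis by (metis ereal_uminus_le_reorder ereal_uminus_uminus)
qed

section \<open>Smoothing along complex lines\<close>

definition cmul :: "complex \<Rightarrow> complex \<times> complex \<Rightarrow> complex \<times> complex" where
  "cmul w d = (w * fst d, w * snd d)"

lemma norm_cmul [simp]: "norm (cmul w d) = norm w * norm d"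
proof -
  have "(norm w * norm (fst d))\<^sup>2 + (norm w * norm (snd d))\<^sup>2 = (norm w)\<^sup>2 * ((norm (fst d))\<^sup>2 + (norm (snd d))\<^sup>2)"
    by (simp add: algebra_simps power_mult_distrib)
  then show ?thesis
    by (cases d) (simp add: cmul_def norm_Pair norm_mult real_sqrt_mult)
qed

lemma cmul_cmul: "cmul a (cmul b d) = cmul (a * b) d"
  by (simp add: cmul_def mult.assoc)

lemma cmul_add: "cmul a (x + y) = cmul a x + cmul a y"
  by (simp add: cmul_def algebra_simps)

lemma cmul_one [simp]: "cmul 1 d = d"
  by (simp add: cmul_def)

lemma continuous_on_cmul [continuous_intros]:
  "continuous_on A f \<Longrightarrow> continuous_on A g \<Longrightarrow> continuous_on A (\<lambda>x. cmul (f x) (g x))"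
  unfolding cmul_def by (intro continuous_intros)

lemma borel_measurable_cmul [measurable (raw)]:
  assumes "f \<in> borel_measurable M" "g \<in> borel_measurable M"
  shows "(\<lambda>x. cmul (f x) (g x)) \<in> borel_measurable M"
  by (rule borel_measurable_continuous_Pair[OF assms]) (auto intro!: continuous_intros)

text \<open>The mean value inequality on closed discs in complex lines, for real-valued functions.  The
  direction \<open>d\<close> carries the radius.\<close>

definition line_submean :: "(complex \<times> complex) set \<Rightarrow> (complex \<times> complex \<Rightarrow> real) \<Rightarrow> bool" where
  "line_submean X g \<longleftrightarrow>
     (\<forall>x d. (\<forall>w\<in>cball 0 1. x + cmul w d \<in> X) \<longrightarrow> g x \<le> (LINT s|circ. g (x + cmul (cis s) d)))"

text \<open>The square makes this radial kernel continuously differentiable with Lipschitz gradient, which is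
  all that the second-order estimate below requires.\<close>

definition bump :: "real \<Rightarrow> 'a::real_inner \<Rightarrow> real" where
  "bump \<delta> y = (max 0 (\<delta>\<^sup>2 - (norm y)\<^sup>2))\<^sup>2"

lemma bump_nonneg: "bump \<delta> y \<ge> 0"
  by (simp add: bump_def)

lemma bump_eq_0: "0 \<le> \<delta> \<Longrightarrow> \<delta> \<le> norm y \<Longrightarrow> bump \<delta> y = 0"
  by (simp add: bump_def power_mono max_def)

lemma bump_le_1: "0 \<le> \<delta> \<Longrightarrow> \<delta> \<le> 1 \<Longrightarrow> bump \<delta> y \<le> 1"
proof -
  assume "0 \<le> \<delta>" "\<delta> \<le> 1"
  then have "\<delta>\<^sup>2 \<le> 1" by (simp add: power_le_one)
  then have "\<delta>\<^sup>2 - (norm y)\<^sup>2 \<le> 1" using zero_le_power2[of "norm y"] by linarith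
  then show ?thesis
    unfolding bump_def by (intro power_le_one) auto
qed

lemma continuous_on_bump [continuous_intros]:
  "continuous_on A f \<Longrightarrow> continuous_on A (\<lambda>x. bump \<delta> (f x))"
  unfolding bump_def by (intro continuous_intros)

lemma borel_measurable_bump [measurable (raw)]:
  fixes f :: "'b \<Rightarrow> 'a :: euclidean_space"
  assumes "f \<in> borel_measurable M"
  shows "(\<lambda>x. bump \<delta> (f x)) \<in> borel_measurable M"
  using measurable_comp[OF assms borel_measurable_continuous_onI[of "bump \<delta> :: 'a \<Rightarrow> real"]]
    continuous_on_bump[OF continuous_on_id, of UNIV \<delta>]
  by (simp add: comp_def)

lemma pos_part_square_taylor: "\<bar>(max 0 (s + t))\<^sup>2 - (max 0 s)\<^sup>2 - 2 * max 0 s * t\<bar> \<le> (t::real)\<^sup>2"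
proof (cases "0 \<le> s")
  case s: True
  show ?thesis
  proof (cases "0 \<le> s + t")
    case True
    then show ?thesis using s by (simp add: max_def power2_eq_square algebra_simps)
  next
    case False
    then have "0 \<le> s" "s \<le> - t" using s by auto
    then have "0 \<le> s * s" "s * s \<le> s * (- t)" "s * (- t) \<le> (- t) * (- t)" "0 \<le> s * (- t)"
      by (intro mult_left_mono mult_right_mono mult_nonneg_nonneg; simp)+
    moreover have "(max 0 (s + t))\<^sup>2 - (max 0 s)\<^sup>2 - 2 * max 0 s * t = - (s * s) + 2 * (s * (- t))"
      using False s by (simp add: max_def power2_eq_square)
    moreover have "0 \<le> (s + t) * (s + t)" by simp
    then have "- (s * s) + 2 * (s * (- t)) \<le> t * t" by (simp add: algebra_simps)
    ultimately show ?thesis unfolding power2_eq_square[of t] by auto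
  qed
next
  case s: False
  show ?thesis
  proof (cases "0 \<le> s + t")
    case True
    then have "(s + t)\<^sup>2 \<le> t\<^sup>2" using s by (intro power_mono) auto
    then show ?thesis using s True by (simp add: max_def)
  next
    case False
    then show ?thesis using s by (simp add: max_def)
  qed
qed

text \<open>The gradient of \<open>bump \<delta>\<close> at \<open>y\<close> is \<open>- 4 * max 0 (\<delta>\<^sup>2 - (norm y)\<^sup>2) *\<^sub>R y\<close>, and it is Lipschitz; the
  first-order term of the displacement \<open>k\<close> may therefore be taken at \<open>y\<close> instead of \<open>y - h\<close>.\<close>

lemma bump_second_order:
  fixes y h k :: "'a :: real_inner"
  assumes d: "0 \<le> \<delta>" "\<delta> \<le> 1" and y: "norm y \<le> 2" and h: "norm h \<le> 1" and k: "norm k \<le> 1"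
  shows "\<bar>bump \<delta> (y - h - k) - bump \<delta> (y - h) - 4 * max 0 (\<delta>\<^sup>2 - (norm y)\<^sup>2) * (y \<bullet> k)\<bar>
    \<le> 51 * (norm k)\<^sup>2 + 44 * norm h * norm k"
proof -
  \<comment> \<open>Since \<open>norm a \<le> 3\<close>, the argument of the positive part changes by at most \<open>7 * norm k\<close>: this gives \<open>49\<close>, and
    the quadratic term of the change gives \<open>2\<close> more.  Replacing \<open>a\<close> by \<open>y\<close> in the gradient costs \<open>4 * (1 + 10)\<close>.\<close>
  define a where "a = y - h"
  have na: "norm a \<le> 3" unfolding a_def using norm_triangle_ineq4[of y h] y h by linarith
  define s where "s = \<delta>\<^sup>2 - (norm a)\<^sup>2"
  define s' where "s' = \<delta>\<^sup>2 - (norm y)\<^sup>2"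
  define t where "t = 2 * (a \<bullet> k) - (norm k)\<^sup>2"
  have d2: "\<delta>\<^sup>2 \<le> 1" using d by (simp add: power_le_one)
  have s1: "0 \<le> max 0 s" "max 0 s \<le> 1"
    unfolding s_def using d2 zero_le_power2[of "norm a"] by linarith+
  have ak: "\<bar>a \<bullet> k\<bar> \<le> 3 * norm k"
    using Cauchy_Schwarz_ineq2[of a k] mult_right_mono[OF na norm_ge_zero[of k]] by linarith
  have k2: "(norm k)\<^sup>2 \<le> norm k" using k by (simp add: power2_eq_square mult_left_le)
  have t: "\<bar>t\<bar> \<le> 7 * norm k" unfolding t_def using ak k2 by (smt (verit) zero_le_power2)
  have t2: "t\<^sup>2 \<le> 49 * (norm k)\<^sup>2"
    using power_mono[OF t, of 2] by (simp add: power_mult_distrib)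
  have "norm (a - k) ^ 2 = (norm a)\<^sup>2 - 2 * (a \<bullet> k) + (norm k)\<^sup>2"
    by (simp add: power2_norm_eq_inner inner_diff_left inner_diff_right inner_commute algebra_simps)
  then have bak: "bump \<delta> (a - k) = (max 0 (s + t))\<^sup>2"
    unfolding bump_def s_def t_def by (simp add: algebra_simps)
  have ba: "bump \<delta> a = (max 0 s)\<^sup>2" unfolding bump_def s_def by simp
  have e1: "\<bar>bump \<delta> (a - k) - bump \<delta> a - 2 * max 0 s * t\<bar> \<le> 49 * (norm k)\<^sup>2"
    unfolding bak ba using pos_part_square_taylor[of s t] t2 by linarith
  have e2: "\<bar>2 * max 0 s * t - 4 * max 0 s * (a \<bullet> k)\<bar> \<le> 2 * (norm k)\<^sup>2"
  proof -
    have "2 * max 0 s * t - 4 * max 0 s * (a \<bullet> k) = - (2 * max 0 s * (norm k)\<^sup>2)"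
      unfolding t_def by (simp add: algebra_simps)
    moreover have "max 0 s * (norm k)\<^sup>2 \<le> 1 * (norm k)\<^sup>2" using s1 by (intro mult_right_mono) auto
    moreover have "0 \<le> max 0 s * (norm k)\<^sup>2" using s1 by simp
    ultimately show ?thesis by auto
  qed
  have e3: "\<bar>4 * max 0 s * (a \<bullet> k) - 4 * max 0 s' * (y \<bullet> k)\<bar> \<le> 44 * norm h * norm k"
  proof -
    have "max 0 s * (a \<bullet> k) - max 0 s' * (y \<bullet> k) = - (max 0 s * (h \<bullet> k)) + (max 0 s - max 0 s') * (y \<bullet> k)"
      unfolding a_def by (simp add: inner_diff_left algebra_simps)
    moreover have "\<bar>max 0 s * (h \<bullet> k)\<bar> \<le> 1 * (norm h * norm k)"
      unfolding abs_mult using s1 Cauchy_Schwarz_ineq2[of h k] by (intro mult_mono) auto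
    moreover have "\<bar>(max 0 s - max 0 s') * (y \<bullet> k)\<bar> \<le> (5 * norm h) * (2 * norm k)"
    proof -
      have "\<bar>max 0 s - max 0 s'\<bar> \<le> \<bar>s - s'\<bar>" by (auto simp: max_def)
      also have "\<dots> = \<bar>norm y - norm a\<bar> * \<bar>norm y + norm a\<bar>"
        unfolding s_def s'_def abs_mult[symmetric] by (simp add: power2_eq_square algebra_simps)
      also have "\<dots> \<le> norm h * 5"
      proof (intro mult_mono)
        show "\<bar>norm y - norm a\<bar> \<le> norm h"
          using norm_triangle_ineq3[of y a] unfolding a_def by simp
        show "\<bar>norm y + norm a\<bar> \<le> 5" using y na by simp
      qed auto
      finally have A: "\<bar>max 0 s - max 0 s'\<bar> \<le> 5 * norm h" by simp
      have B: "\<bar>y \<bullet> k\<bar> \<le> 2 * norm k"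
        using Cauchy_Schwarz_ineq2[of y k] mult_right_mono[OF y norm_ge_zero[of k]] by linarith
      show ?thesis unfolding abs_mult by (intro mult_mono A B) auto
    qed
    ultimately have "\<bar>max 0 s * (a \<bullet> k) - max 0 s' * (y \<bullet> k)\<bar> \<le> 1 * (norm h * norm k) + (5 * norm h) * (2 * norm k)"
      by linarith
    moreover have "4 * max 0 s * (a \<bullet> k) - 4 * max 0 s' * (y \<bullet> k) = 4 * (max 0 s * (a \<bullet> k) - max 0 s' * (y \<bullet> k))"
      by (simp add: algebra_simps)
    ultimately show ?thesis by (simp only: abs_mult) simp
  qed
  show ?thesis
    using e1 e2 e3 unfolding a_def[symmetric] s'_def[symmetric] by linarith
qed

lemma bump_lipschitz:
  assumes d: "0 \<le> \<delta>" "\<delta> \<le> 1"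
  shows "\<bar>bump \<delta> a - bump \<delta> b\<bar> \<le> 4 * norm (a - b)"
proof -
  define m where "m = (\<lambda>y::'a. min \<delta> (norm y))"
  have b: "bump \<delta> y = (\<delta>\<^sup>2 - (m y)\<^sup>2)\<^sup>2" for y
    unfolding bump_def m_def by (cases "norm y \<le> \<delta>") (use d in \<open>auto simp: max_def min_def power_mono\<close>)
  have m: "0 \<le> m y" "m y \<le> 1" for y unfolding m_def using d by auto
  have lip: "\<bar>m b - m a\<bar> \<le> norm (a - b)"
    using norm_triangle_ineq3[of a b] unfolding m_def by linarith
  have d2: "0 \<le> \<delta>\<^sup>2" "\<delta>\<^sup>2 \<le> 1" using d by (auto simp: power_le_one)
  have p: "0 \<le> \<delta>\<^sup>2 - (m y)\<^sup>2" "\<delta>\<^sup>2 - (m y)\<^sup>2 \<le> 1" for y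
  proof -
    have "(m y)\<^sup>2 \<le> \<delta>\<^sup>2" using m by (intro power_mono) (auto simp: m_def)
    then show "0 \<le> \<delta>\<^sup>2 - (m y)\<^sup>2" by simp
    show "\<delta>\<^sup>2 - (m y)\<^sup>2 \<le> 1" using d2 by (smt (verit) zero_le_power2)
  qed
  have "bump \<delta> a - bump \<delta> b = (m b - m a) * ((m b + m a) * ((\<delta>\<^sup>2 - (m a)\<^sup>2) + (\<delta>\<^sup>2 - (m b)\<^sup>2)))"
    unfolding b by (simp add: power2_eq_square algebra_simps)
  also have "\<bar>\<dots>\<bar> = \<bar>m b - m a\<bar> * (\<bar>m b + m a\<bar> * \<bar>(\<delta>\<^sup>2 - (m a)\<^sup>2) + (\<delta>\<^sup>2 - (m b)\<^sup>2)\<bar>)"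
    by (simp add: abs_mult)
  also have "\<dots> \<le> norm (a - b) * (2 * 2)"
    using m[of a] m[of b] p[of a] p[of b] by (intro mult_mono lip) auto
  finally show ?thesis by simp
qed

definition smooth :: "real \<Rightarrow> (complex \<times> complex \<Rightarrow> real) \<Rightarrow> complex \<times> complex \<Rightarrow> real" where
  "smooth \<delta> g x = (LINT y|lborel. g (x + y) * bump \<delta> y)"

lemma lborel_integral_translate:
  fixes f :: "'a::euclidean_space \<Rightarrow> real"
  assumes [measurable]: "f \<in> borel_measurable borel"
  shows "(LINT y|lborel. f (c + y)) = (LINT y|lborel. f y)"
proof -
  have "(LINT y|lborel. f y) = (LINT y|distr lborel borel ((+) c). f y)"
    by (simp only: lborel_distr_plus)
  also have "\<dots> = (LINT y|lborel. f (c + y))"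
    by (subst integral_distr) auto
  finally show ?thesis ..
qed

lemma smooth_shift:
  assumes [measurable]: "g \<in> borel_measurable borel"
  shows "smooth \<delta> g (x + h) = (LINT y|lborel. g (x + y) * bump \<delta> (y - h))"
proof -
  have "(LINT y|lborel. g (x + (h + y)) * bump \<delta> (h + y - h)) = (LINT y|lborel. g (x + y) * bump \<delta> (y - h))"
    by (rule lborel_integral_translate) measurable
  then show ?thesis by (simp add: smooth_def add.assoc)
qed

lemma integrable_cball_bounded:
  fixes f :: "'a::euclidean_space \<Rightarrow> real"
  assumes [measurable]: "f \<in> borel_measurable borel"
    and b: "\<And>y. \<bar>f y\<bar> \<le> B * indicator (cball x \<rho>) y"
  shows "integrable lborel f"
proof (rule Bochner_Integration.integrable_bound)
  show "integrable lborel (\<lambda>y. B * indicator (cball x \<rho>) y :: real)"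
    by (intro integrable_mult_right integrable_real_indicator) (use emeasure_lborel_cball_finite in auto)
  show "AE y in lborel. norm (f y) \<le> norm (B * indicator (cball x \<rho>) y :: real)"
    unfolding real_norm_def by (intro AE_I2 order_trans[OF b abs_ge_self])
qed simp

lemma bump_prod_bound:
  assumes "0 \<le> \<delta>" "\<delta> \<le> 1" "\<bar>c\<bar> \<le> N"
  shows "\<bar>c * bump \<delta> y\<bar> \<le> N * indicator (cball 0 \<delta>) y"
proof (cases "norm y \<le> \<delta>")
  case True
  then show ?thesis
    using mult_mono[OF assms(3) bump_le_1[OF assms(1,2), of y]] assms(3) bump_nonneg[of \<delta> y]
    by (simp add: abs_mult)
next
  case False
  then show ?thesis using bump_eq_0[OF assms(1), of y] by simp
qed

text \<open>Fubini for a circle and a Euclidean space: the bound makes the integrand integrable on the product.\<close>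

lemma circ_lborel_swap:
  fixes k :: "real \<Rightarrow> 'a::euclidean_space \<Rightarrow> real"
  assumes m: "(\<lambda>x. k (fst x) (snd x)) \<in> borel_measurable borel"
    and b: "\<And>s y. \<bar>k s y\<bar> \<le> B * indicator (cball 0 \<rho>) y"
  shows "(LINT s|circ. LINT y|lborel. k s y) = (LINT y|lborel. LINT s|circ. k s y)"
    and "integrable circ (\<lambda>s. LINT y|lborel. k s y)"
    and "integrable lborel (\<lambda>y. LINT s|circ. k s y)"
proof -
  interpret C: prob_space circ by (rule prob_space_circ)
  interpret P: pair_sigma_finite circ "lborel :: 'a measure" by standard
  have sets: "sets (circ \<Otimes>\<^sub>M (lborel :: 'a measure)) = sets (borel :: (real \<times> 'a) measure)"
    unfolding borel_prod[symmetric] by (intro sets_pair_measure_cong) auto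
  have mk: "case_prod k \<in> borel_measurable (circ \<Otimes>\<^sub>M (lborel :: 'a measure))"
    unfolding case_prod_beta' by (subst measurable_cong_sets[OF sets refl]) (rule m)
  have int: "integrable (circ \<Otimes>\<^sub>M (lborel :: 'a measure)) (case_prod k)"
  proof (rule Bochner_Integration.integrable_bound[OF _ mk])
    have i: "integrable lborel (\<lambda>y. B * indicator (cball (0::'a) \<rho>) y :: real)"
      by (intro integrable_mult_right integrable_real_indicator) (use emeasure_lborel_cball_finite in auto)
    show "integrable (circ \<Otimes>\<^sub>M (lborel :: 'a measure)) (\<lambda>x. B * indicator (cball 0 \<rho>) (snd x) :: real)"
    proof (rule P.Fubini_integrable)
      show "(\<lambda>x. B * indicator (cball 0 \<rho>) (snd x) :: real) \<in> borel_measurable (circ \<Otimes>\<^sub>M (lborel :: 'a measure))"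
        by (rule measurable_compose[OF measurable_snd])
          (simp, intro borel_measurable_times borel_measurable_const borel_measurable_indicator, simp)
    qed (use i in auto)
    show "AE x in circ \<Otimes>\<^sub>M (lborel :: 'a measure). norm (case_prod k x) \<le> norm (B * indicator (cball 0 \<rho>) (snd x) :: real)"
      unfolding real_norm_def case_prod_beta' by (intro AE_I2 order_trans[OF b abs_ge_self])
  qed
  show "(LINT s|circ. LINT y|lborel. k s y) = (LINT y|lborel. LINT s|circ. k s y)"
    using P.Fubini_integral[OF int] by simp
  show "integrable circ (\<lambda>s. LINT y|lborel. k s y)"
    using P.integrable_fst[OF int] .
  show "integrable lborel (\<lambda>y. LINT s|circ. k s y)"
    using P.integrable_snd[OF int] .
qed

lemma add_in_cball_iff: "x + v \<in> cball x r \<longleftrightarrow> norm v \<le> r"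
  by (simp add: dist_norm)

lemma holomorphic_quadratic_remainder:
  fixes f :: "complex \<Rightarrow> complex"
  assumes f: "f holomorphic_on ball t \<rho>" and \<rho>: "\<rho> > 0"
  shows "\<exists>c\<ge>0. \<forall>w. norm w \<le> \<rho> / 2 \<longrightarrow> norm (f (t + w) - f t - w * deriv f t) \<le> c * (norm w)\<^sup>2"
proof -
  let ?S = "cball t (\<rho> / 2)"
  have S: "?S \<subseteq> ball t \<rho>" using \<rho> by auto
  have h2: "(deriv ^^ 2) f holomorphic_on ball t \<rho>"
    by (rule holomorphic_higher_deriv[OF f open_ball])
  have "compact ((deriv ^^ 2) f ` ?S)"
    by (intro compact_continuous_image holomorphic_on_imp_continuous_on holomorphic_on_subset[OF h2 S]) simp
  then have "bounded ((deriv ^^ 2) f ` ?S)" by (rule compact_imp_bounded)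
  then obtain c where c: "\<And>x. x \<in> ?S \<Longrightarrow> norm ((deriv ^^ 2) f x) \<le> c"
    unfolding bounded_iff by (meson imageI)
  have c0: "0 \<le> c" using order_trans[OF norm_ge_zero c[of t]] \<rho> by simp
  show ?thesis
  proof (intro exI[of _ c] conjI allI impI c0)
    fix w :: complex assume w: "norm w \<le> \<rho> / 2"
    have "norm ((deriv ^^ 0) f (t + w) - (\<Sum>i\<le>1. (deriv ^^ i) f t * ((t + w) - t) ^ i / fact i))
        \<le> c * norm ((t + w) - t) ^ Suc 1 / fact 1"
    proof (rule complex_Taylor[of ?S 1 "\<lambda>i. (deriv ^^ i) f"])
      fix i x assume x: "x \<in> ?S"
      have "((deriv ^^ i) f has_field_derivative deriv ((deriv ^^ i) f) x) (at x)"
        by (rule holomorphic_derivI[OF holomorphic_higher_deriv[OF f open_ball] open_ball]) (use x S in auto)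
      then show "((deriv ^^ i) f has_field_derivative (deriv ^^ Suc i) f x) (at x within ?S)"
        by (simp add: has_field_derivative_at_within)
    next
      fix x assume "x \<in> ?S"
      then show "norm ((deriv ^^ Suc 1) f x) \<le> c" using c by (simp add: numeral_2_eq_2)
    qed (use w \<rho> in \<open>auto simp: dist_norm\<close>)
    then show "norm (f (t + w) - f t - w * deriv f t) \<le> c * (norm w)\<^sup>2"
      by (simp add: power2_eq_square algebra_simps)
  qed
qed

lemma bump_shift_bound:
  assumes "0 \<le> \<delta>" "\<delta> \<le> 1" "\<bar>c\<bar> \<le> N" "norm v \<le> \<delta>"
  shows "\<bar>c * bump \<delta> (y - v)\<bar> \<le> N * indicator (cball 0 (2 * \<delta>)) y"
proof -
  have "\<bar>c * bump \<delta> (y - v)\<bar> \<le> N * indicator (cball 0 \<delta>) (y - v)"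
    by (rule bump_prod_bound[OF assms(1-3)])
  also have "indicator (cball 0 \<delta>) (y - v) \<le> (indicator (cball 0 (2 * \<delta>)) y :: real)"
    using norm_triangle_ineq[of "y - v" v] assms(4) by (auto simp: indicator_def)
  then have "N * indicator (cball 0 \<delta>) (y - v) \<le> N * (indicator (cball 0 (2 * \<delta>)) y :: real)"
    using assms(3) by (intro mult_left_mono) auto
  finally show ?thesis .
qed

lemma borel_measurable_fst_borel [measurable]:
  "(fst :: 'a::euclidean_space \<times> 'b::euclidean_space \<Rightarrow> 'a) \<in> borel_measurable borel"
  by (intro borel_measurable_continuous_onI continuous_intros)

lemma borel_measurable_snd_borel [measurable]:
  "(snd :: 'a::euclidean_space \<times> 'b::euclidean_space \<Rightarrow> 'b) \<in> borel_measurable borel"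
  by (intro borel_measurable_continuous_onI continuous_intros)

lemma integrable_bump_prod:
  fixes g :: "complex \<times> complex \<Rightarrow> real"
  assumes [measurable]: "g \<in> borel_measurable borel" and "\<And>y. \<bar>g y\<bar> \<le> N" "0 \<le> \<delta>" "\<delta> \<le> 1"
  shows "integrable lborel (\<lambda>y. g (x + y) * bump \<delta> y)"
  by (rule integrable_cball_bounded[where B = N and x = 0 and \<rho> = \<delta>], measurable)
    (rule bump_prod_bound[OF assms(3,4)], rule assms(2))

text \<open>A holomorphic disc differs from its tangent line by \<open>R\<close>, of size \<open>O(r\<^sup>2)\<close> on the circle of radius
  \<open>r\<close>.  Moving the displacement into the kernel turns the difference of the two means into an integral
  of the bounded function \<open>g\<close> against the increment of the kernel.  Its first-order part is linear in
  \<open>R\<close> and has mean \<open>0\<close> because \<open>R\<close> is holomorphic with \<open>R 0 = 0\<close>; the rest is \<open>O(r\<^sup>3)\<close>.\<close>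

lemma smooth_disc_submean:
  fixes g :: "complex \<times> complex \<Rightarrow> real" and \<phi> :: "complex \<Rightarrow> complex \<times> complex"
  assumes g [measurable]: "g \<in> borel_measurable borel" and gN: "\<And>y. \<bar>g y\<bar> \<le> N"
    and sub: "line_submean X g" and \<delta>: "0 < \<delta>" "\<delta> \<le> 1"
    and \<rho>: "\<rho> > 0" and \<phi>: "(\<lambda>t. fst (\<phi> t)) holomorphic_on ball t0 \<rho>" "(\<lambda>t. snd (\<phi> t)) holomorphic_on ball t0 \<rho>"
    and X: "cball (\<phi> t0) (2 * \<delta>) \<subseteq> X"
  shows "\<exists>C. \<exists>r0>0. \<forall>r. 0 < r \<and> r < r0 \<longrightarrow>
    smooth \<delta> g (\<phi> t0) \<le> (LINT s|circ. smooth \<delta> g (\<phi> (t0 + complex_of_real r * cis s))) + C * r ^ 3"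
proof -
  interpret prob_space circ by (rule prob_space_circ)
  have N0: "0 \<le> N" using gN[of 0] by linarith
  define x0 where "x0 = \<phi> t0"
  define d where "d = (deriv (\<lambda>t. fst (\<phi> t)) t0, deriv (\<lambda>t. snd (\<phi> t)) t0)"
  define R where "R = (\<lambda>w. \<phi> (t0 + w) - x0 - cmul w d)"
  obtain c1 where c1: "c1 \<ge> 0" "\<And>w. norm w \<le> \<rho> / 2 \<Longrightarrow> norm (fst (R w)) \<le> c1 * (norm w)\<^sup>2"
    using holomorphic_quadratic_remainder[OF \<phi>(1) \<rho>] by (auto simp: R_def x0_def d_def cmul_def)
  obtain c2 where c2: "c2 \<ge> 0" "\<And>w. norm w \<le> \<rho> / 2 \<Longrightarrow> norm (snd (R w)) \<le> c2 * (norm w)\<^sup>2"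
    using holomorphic_quadratic_remainder[OF \<phi>(2) \<rho>] by (auto simp: R_def x0_def d_def cmul_def)
  define c where "c = c1 + c2"
  have c0: "c \<ge> 0" using c1 c2 by (simp add: c_def)
  have Rb: "norm (R w) \<le> c * (norm w)\<^sup>2" if "norm w \<le> \<rho> / 2" for w
    using norm_Pair_le[of "fst (R w)" "snd (R w)"] c1(2)[OF that] c2(2)[OF that]
    by (simp add: c_def algebra_simps)
  have holR: "(\<lambda>w. fst (R w)) holomorphic_on ball 0 \<rho>" "(\<lambda>w. snd (R w)) holomorphic_on ball 0 \<rho>"
  proof -
    have im: "(\<lambda>w. t0 + w) ` ball 0 \<rho> \<subseteq> ball t0 \<rho>" by (auto simp: dist_norm)
    have tr: "(\<lambda>w. t0 + w) holomorphic_on ball 0 \<rho>" by (intro holomorphic_intros)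
    have "(\<lambda>w. fst (\<phi> (t0 + w))) holomorphic_on ball 0 \<rho>" "(\<lambda>w. snd (\<phi> (t0 + w))) holomorphic_on ball 0 \<rho>"
      using holomorphic_on_compose_gen[OF tr \<phi>(1) im] holomorphic_on_compose_gen[OF tr \<phi>(2) im]
      by (simp_all add: o_def)
    then show "(\<lambda>w. fst (R w)) holomorphic_on ball 0 \<rho>" "(\<lambda>w. snd (R w)) holomorphic_on ball 0 \<rho>"
      unfolding R_def cmul_def by (auto intro!: holomorphic_intros)
  qed
  have contR: "continuous_on (ball 0 \<rho>) R"
    using continuous_on_Pair[OF holR[THEN holomorphic_on_imp_continuous_on]] by simp
  define D where "D = 51 * c\<^sup>2 + 44 * norm d * c"
  define vol where "vol = measure lborel (cball (0 :: complex \<times> complex) (2 * \<delta>))"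
  \<comment> \<open>For \<open>r < r0\<close> the tangential displacement and \<open>R\<close> are at most \<open>\<delta> / 2\<close> each, so that all displaced
    kernels live in the ball of radius \<open>2 * \<delta>\<close>.\<close>
  define r0 where "r0 = min (\<rho> / 2) (min 1 (min (\<delta> / (2 * (norm d + 1))) (\<delta> / (2 * (c + 1)))))"
  show ?thesis
  proof (rule exI[of _ "N * D * vol"], rule exI[of _ r0], intro conjI allI impI)
    have "norm d + 1 > 0" "c + 1 > 0" using c0 by (auto intro: add_nonneg_pos)
    then show "r0 > 0" unfolding r0_def using \<rho> \<delta> by auto
    fix r assume r: "0 < r \<and> r < r0"
    then have r1: "0 < r" "r \<le> \<rho> / 2" "r \<le> 1" "r \<le> \<delta> / (2 * (norm d + 1))" "r \<le> \<delta> / (2 * (c + 1))"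
      unfolding r0_def by auto
    have rd: "r * norm d \<le> \<delta> / 2"
    proof -
      have "r * norm d \<le> r * (norm d + 1)" using r1 by simp
      also have "\<dots> \<le> \<delta> / (2 * (norm d + 1)) * (norm d + 1)" using r1 by (intro mult_right_mono) auto
      also have "\<dots> = \<delta> / 2" using \<open>norm d + 1 > 0\<close> by (simp add: field_simps)
      finally show ?thesis .
    qed
    have rc: "c * r\<^sup>2 \<le> \<delta> / 2"
    proof -
      have "c * r\<^sup>2 \<le> (c + 1) * r"
        using r1 c0 by (intro mult_mono) (auto simp: power2_eq_square mult_left_le)
      also have "\<dots> \<le> (c + 1) * (\<delta> / (2 * (c + 1)))" using r1 c0 by (intro mult_left_mono) auto
      also have "\<dots> = \<delta> / 2" using \<open>c + 1 > 0\<close> by (simp add: field_simps)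
      finally show ?thesis .
    qed
    define h where "h = (\<lambda>s. cmul (complex_of_real r * cis s) d)"
    define k where "k = (\<lambda>s. R (complex_of_real r * cis s))"
    have nh: "norm (h s) = r * norm d" for s unfolding h_def using r1 by (simp add: norm_mult)
    have nk: "norm (k s) \<le> c * r\<^sup>2" for s
      unfolding k_def using Rb[of "complex_of_real r * cis s"] r1 by (simp add: norm_mult)
    have nhk: "norm (h s + k s) \<le> \<delta>" "norm (h s) \<le> \<delta>" for s
      using norm_triangle_ineq[of "h s" "k s"] nh[of s] nk[of s] rd rc \<delta> by linarith+
    have \<phi>eq: "\<phi> (t0 + complex_of_real r * cis s) = x0 + (h s + k s)" for s
      unfolding h_def k_def R_def by simp
    have [measurable]: "h \<in> borel_measurable borel"
      unfolding h_def by (intro borel_measurable_continuous_onI continuous_intros)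
    have [measurable]: "k \<in> borel_measurable borel"
      unfolding k_def by (intro borel_measurable_continuous_onI continuous_on_compose2[OF contR])
        (use r1 \<rho> in \<open>auto intro!: continuous_intros simp: norm_mult\<close>)
    define k1 where "k1 = (\<lambda>s y. g (x0 + y) * bump \<delta> (y - (h s + k s)))"
    define k2 where "k2 = (\<lambda>s y. g (x0 + y) * bump \<delta> (y - h s))"
    define k3 where "k3 = (\<lambda>s y. g (x0 + h s + y) * bump \<delta> y)"
    have b1: "\<bar>k1 s y\<bar> \<le> N * indicator (cball 0 (2 * \<delta>)) y" for s y
      unfolding k1_def by (rule bump_shift_bound) (use gN nhk \<delta> in auto)
    have b2: "\<bar>k2 s y\<bar> \<le> N * indicator (cball 0 (2 * \<delta>)) y" for s y
      unfolding k2_def by (rule bump_shift_bound) (use gN nhk \<delta> in auto)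
    have b3: "\<bar>k3 s y\<bar> \<le> N * indicator (cball 0 \<delta>) y" for s y
      unfolding k3_def by (rule bump_prod_bound) (use gN \<delta> in auto)
    have m1: "(\<lambda>x. k1 (fst x) (snd x)) \<in> borel_measurable borel"
      unfolding k1_def by measurable
    have m2: "(\<lambda>x. k2 (fst x) (snd x)) \<in> borel_measurable borel"
      unfolding k2_def by measurable
    have m3: "(\<lambda>x. k3 (fst x) (snd x)) \<in> borel_measurable borel"
      unfolding k3_def by measurable
    note s1 = circ_lborel_swap[OF m1 b1] and s2 = circ_lborel_swap[OF m2 b2] and s3 = circ_lborel_swap[OF m3 b3]

    \<comment> \<open>Along the tangent line the mean value inequality holds for each translate of \<open>g\<close>.\<close>
    have "smooth \<delta> g x0 \<le> (LINT y|lborel. LINT s|circ. k3 s y)"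
      unfolding smooth_def
    proof (rule integral_mono[OF _ s3(3)])
      show "integrable lborel (\<lambda>y. g (x0 + y) * bump \<delta> y)"
        by (rule integrable_bump_prod[OF g gN]) (use \<delta> in auto)
      fix y :: "complex \<times> complex"
      have eq: "(LINT s|circ. k3 s y) = (LINT s|circ. g (x0 + h s + y)) * bump \<delta> y"
        unfolding k3_def by (rule integral_mult_left_zero)
      show "g (x0 + y) * bump \<delta> y \<le> (LINT s|circ. k3 s y)"
      proof (cases "norm y < \<delta>")
        case True
        have "g (x0 + y) \<le> (LINT s|circ. g ((x0 + y) + cmul (cis s) (cmul (complex_of_real r) d)))"
        proof (rule sub[unfolded line_submean_def, rule_format])
          fix w :: complex assume w: "w \<in> cball 0 1"
          have "norm (cmul w (cmul (complex_of_real r) d)) \<le> 1 * (r * norm d)"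
            unfolding norm_cmul using w r1 by (intro mult_mono) auto
          then have "norm (y + cmul w (cmul (complex_of_real r) d)) \<le> 2 * \<delta>"
            using norm_triangle_ineq[of y "cmul w (cmul (complex_of_real r) d)"] True rd \<delta> by linarith
          then have "x0 + (y + cmul w (cmul (complex_of_real r) d)) \<in> cball x0 (2 * \<delta>)"
            by (simp only: add_in_cball_iff)
          then show "x0 + y + cmul w (cmul (complex_of_real r) d) \<in> X"
            using X unfolding x0_def by (auto simp: add.assoc)
        qed
        then have "g (x0 + y) \<le> (LINT s|circ. g (x0 + h s + y))"
          unfolding h_def by (simp add: cmul_cmul mult.commute add_ac)
        then show ?thesis unfolding eq using bump_nonneg by (intro mult_right_mono)
      next
        case False
        then show ?thesis unfolding eq using \<delta> by (simp add: bump_eq_0)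
      qed
    qed
    also have "\<dots> = (LINT s|circ. smooth \<delta> g (x0 + h s))"
      using s3(1) unfolding smooth_def k3_def by (rule sym)
    also have "\<dots> = (LINT s|circ. LINT y|lborel. k2 s y)"
      unfolding k2_def smooth_shift[OF g] ..
    also have "\<dots> = (LINT y|lborel. LINT s|circ. k2 s y)" by (rule s2(1))
    finally have A: "smooth \<delta> g x0 \<le> (LINT y|lborel. LINT s|circ. k2 s y)" .

    \<comment> \<open>Passing from the tangent line to the disc only changes the kernel.\<close>
    have pt: "\<bar>(LINT s|circ. k1 s y) - (LINT s|circ. k2 s y)\<bar> \<le> (N * D * r ^ 3) * indicator (cball 0 (2 * \<delta>)) y" for y
    proof (cases "norm y \<le> 2 * \<delta>")
      case False
      then have "k1 s y = 0" "k2 s y = 0" for s using b1[of s y] b2[of s y] by auto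
      then show ?thesis using False by simp
    next
      case True
      define G where "G = 4 * max 0 (\<delta>\<^sup>2 - (norm y)\<^sup>2)"
      define F where "F = (\<lambda>w. cnj (fst y) * fst (R w) + cnj (snd y) * snd (R w))"
      have R0: "R 0 = 0" by (simp add: R_def x0_def cmul_def zero_prod_def)
      have innerF: "y \<bullet> k s = Re (F (0 + complex_of_real r * cis s))" for s
        unfolding F_def k_def by (simp add: inner_prod_def inner_complex_def)
      have holF: "F holomorphic_on ball 0 \<rho>"
        unfolding F_def by (intro holomorphic_intros holR)
      have sub_r: "cball 0 r \<subseteq> ball (0::complex) \<rho>" using r1 \<rho> by auto
      have contF: "continuous_on (cball 0 r) F"
        by (rule holomorphic_on_imp_continuous_on[OF holomorphic_on_subset[OF holF sub_r]])
      have iF: "integrable circ (\<lambda>s. F (0 + complex_of_real r * cis s))"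
        by (rule circ_integrable_circle[OF contF]) (use r1 in simp)
      have "(LINT s|circ. F (0 + complex_of_real r * cis s)) = F 0"
        by (rule mean_value_holomorphic[OF contF _ r1(1)])
          (rule holomorphic_on_subset[OF holF], use sub_r ball_subset_cball in blast)
      then have zero: "(LINT s|circ. y \<bullet> k s) = 0"
        unfolding innerF using integral_Re[OF iF] by (simp add: F_def R0)
      have ik: "integrable circ (\<lambda>s. y \<bullet> k s)"
        unfolding innerF using iF by (rule integrable_Re)
      have ib: "integrable circ (\<lambda>s. bump \<delta> (y - v s))" if "v \<in> borel_measurable borel" for v
      proof (rule circ_integrable_bounded[where B = 1])
        show "(\<lambda>s. bump \<delta> (y - v s)) \<in> borel_measurable borel" using that by measurable
        show "norm (bump \<delta> (y - v t)) \<le> 1" for t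
          using bump_nonneg[of \<delta> "y - v t"] bump_le_1[of \<delta> "y - v t"] \<delta> by simp
      qed
      have i1: "integrable circ (\<lambda>s. bump \<delta> (y - (h s + k s)))" and i2: "integrable circ (\<lambda>s. bump \<delta> (y - h s))"
        by (rule ib, measurable)+
      define E where "E = (LINT s|circ. bump \<delta> (y - (h s + k s)) - bump \<delta> (y - h s) - G * (y \<bullet> k s))"
      have "(LINT s|circ. k1 s y) - (LINT s|circ. k2 s y) =
          g (x0 + y) * ((LINT s|circ. bump \<delta> (y - (h s + k s))) - (LINT s|circ. bump \<delta> (y - h s)))"
        unfolding k1_def k2_def by (simp add: right_diff_distrib)
      also have "(LINT s|circ. bump \<delta> (y - (h s + k s))) - (LINT s|circ. bump \<delta> (y - h s)) = E"
        unfolding E_def using i1 i2 ik by (simp add: zero)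
      finally have eq: "(LINT s|circ. k1 s y) - (LINT s|circ. k2 s y) = g (x0 + y) * E" .
      have "\<bar>E\<bar> \<le> (LINT s|circ. \<bar>bump \<delta> (y - (h s + k s)) - bump \<delta> (y - h s) - G * (y \<bullet> k s)\<bar>)"
        unfolding E_def by (rule integral_abs_bound)
      also have "\<dots> \<le> (LINT s|circ. D * r ^ 3)"
      proof (rule integral_mono)
        show "integrable circ (\<lambda>s. \<bar>bump \<delta> (y - (h s + k s)) - bump \<delta> (y - h s) - G * (y \<bullet> k s)\<bar>)"
          using i1 i2 ik by auto
        fix s
        have kle: "norm (k s) \<le> c * r\<^sup>2" by (rule nk)
        have "\<bar>bump \<delta> (y - h s - k s) - bump \<delta> (y - h s) - 4 * max 0 (\<delta>\<^sup>2 - (norm y)\<^sup>2) * (y \<bullet> k s)\<bar>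
            \<le> 51 * (norm (k s))\<^sup>2 + 44 * norm (h s) * norm (k s)"
          by (rule bump_second_order) (use True \<delta> nhk(2)[of s] nk[of s] rc in auto)
        also have "\<dots> \<le> 51 * (c * r\<^sup>2)\<^sup>2 + 44 * (r * norm d) * (c * r\<^sup>2)"
          unfolding nh using kle r1 by (intro add_mono mult_left_mono power_mono) auto
        also have "\<dots> = (51 * c\<^sup>2 * r + 44 * norm d * c) * r ^ 3"
          by (simp add: power2_eq_square power3_eq_cube algebra_simps)
        also have "\<dots> \<le> D * r ^ 3"
          unfolding D_def using r1 mult_left_le[of r "51 * c\<^sup>2"] by (intro mult_right_mono add_right_mono) auto
        finally show "\<bar>bump \<delta> (y - (h s + k s)) - bump \<delta> (y - h s) - G * (y \<bullet> k s)\<bar> \<le> D * r ^ 3"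
          by (simp add: G_def diff_diff_eq)
      qed simp
      also have "\<dots> = D * r ^ 3" by (simp add: prob_space)
      finally have "\<bar>E\<bar> \<le> D * r ^ 3" .
      then have "\<bar>g (x0 + y) * E\<bar> \<le> N * (D * r ^ 3)"
        unfolding abs_mult using gN N0 by (intro mult_mono) auto
      then show ?thesis unfolding eq using True by (simp add: mult.assoc)
    qed
    have "\<bar>(LINT y|lborel. LINT s|circ. k1 s y) - (LINT y|lborel. LINT s|circ. k2 s y)\<bar>
        = \<bar>LINT y|lborel. ((LINT s|circ. k1 s y) - (LINT s|circ. k2 s y))\<bar>"
      using s1(3) s2(3) by simp
    also have "\<dots> \<le> (LINT y|lborel. \<bar>(LINT s|circ. k1 s y) - (LINT s|circ. k2 s y)\<bar>)"
      by (rule integral_abs_bound)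
    also have "\<dots> \<le> (LINT y|lborel. (N * D * r ^ 3) * indicator (cball 0 (2 * \<delta>)) (y :: complex \<times> complex))"
    proof (rule integral_mono[OF _ _ pt])
      show "integrable lborel (\<lambda>y. \<bar>(LINT s|circ. k1 s y) - (LINT s|circ. k2 s y)\<bar>)"
        using s1(3) s2(3) by simp
      show "integrable lborel (\<lambda>y. (N * D * r ^ 3) * indicator (cball 0 (2 * \<delta>)) (y :: complex \<times> complex) :: real)"
        by (intro integrable_mult_right integrable_real_indicator) (use emeasure_lborel_cball_finite in auto)
    qed
    also have "\<dots> = N * D * vol * r ^ 3" unfolding vol_def by simp
    finally have "(LINT y|lborel. LINT s|circ. k2 s y) \<le> (LINT y|lborel. LINT s|circ. k1 s y) + N * D * vol * r ^ 3"
      by linarith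
    also have "(LINT y|lborel. LINT s|circ. k1 s y) = (LINT s|circ. smooth \<delta> g (\<phi> (t0 + complex_of_real r * cis s)))"
      using s1(1) unfolding \<phi>eq smooth_shift[OF g] k1_def by (rule sym)
    finally show "smooth \<delta> g (\<phi> t0) \<le> (LINT s|circ. smooth \<delta> g (\<phi> (t0 + complex_of_real r * cis s))) + N * D * vol * r ^ 3"
      using A unfolding x0_def by linarith
  qed
qed

lemma continuous_on_smooth:
  fixes g :: "complex \<times> complex \<Rightarrow> real"
  assumes g [measurable]: "g \<in> borel_measurable borel" and gN: "\<And>y. \<bar>g y\<bar> \<le> N" and \<delta>: "0 < \<delta>" "\<delta> \<le> 1"
  shows "continuous_on A (smooth \<delta> g)"
proof -
  have N0: "0 \<le> N" using gN[of 0] by linarith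
  define vol where "vol = measure lborel (cball (0 :: complex \<times> complex) (2 * \<delta>))"
  have lip: "\<bar>smooth \<delta> g (x + h) - smooth \<delta> g x\<bar> \<le> 4 * N * vol * norm h" if h: "norm h \<le> \<delta>" for x h
  proof -
    have b: "\<bar>g (x + y) * bump \<delta> (y - v)\<bar> \<le> N * indicator (cball 0 (2 * \<delta>)) y" if "norm v \<le> \<delta>" for y v
      by (rule bump_shift_bound) (use that gN \<delta> in auto)
    have i: "integrable lborel (\<lambda>y. g (x + y) * bump \<delta> (y - v))" if "norm v \<le> \<delta>" for v
      by (rule integrable_cball_bounded[OF _ b[OF that]]) measurable
    have pt: "\<bar>g (x + y) * bump \<delta> (y - h) - g (x + y) * bump \<delta> (y - 0)\<bar> \<le> (4 * N * norm h) * indicator (cball 0 (2 * \<delta>)) y" for y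
    proof (cases "norm y \<le> 2 * \<delta>")
      case True
      have "\<bar>bump \<delta> (y - h) - bump \<delta> (y - 0)\<bar> \<le> 4 * norm ((y - h) - (y - 0))"
        by (rule bump_lipschitz) (use \<delta> in auto)
      then have "\<bar>g (x + y)\<bar> * \<bar>bump \<delta> (y - h) - bump \<delta> (y - 0)\<bar> \<le> N * (4 * norm h)"
        using gN N0 by (intro mult_mono) auto
      then show ?thesis using True by (simp add: abs_mult[symmetric] right_diff_distrib mult_ac)
    next
      case False
      then have z: "g (x + y) * bump \<delta> (y - h) = 0" "g (x + y) * bump \<delta> (y - 0) = 0"
        using b[OF h, of y] b[of 0 y] \<delta> by auto
      show ?thesis unfolding z using False by simp
    qed
    have "\<bar>smooth \<delta> g (x + h) - smooth \<delta> g (x + 0)\<bar> =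
        \<bar>LINT y|lborel. (g (x + y) * bump \<delta> (y - h) - g (x + y) * bump \<delta> (y - 0))\<bar>"
      unfolding smooth_shift[OF g] using i[OF h] i[of 0] \<delta> by simp
    also have "\<dots> \<le> (LINT y|lborel. \<bar>g (x + y) * bump \<delta> (y - h) - g (x + y) * bump \<delta> (y - 0)\<bar>)"
      by (rule integral_abs_bound)
    also have "\<dots> \<le> (LINT y|lborel. (4 * N * norm h) * indicator (cball 0 (2 * \<delta>)) (y :: complex \<times> complex))"
    proof (rule integral_mono[OF _ _ pt])
      show "integrable lborel (\<lambda>y. \<bar>g (x + y) * bump \<delta> (y - h) - g (x + y) * bump \<delta> (y - 0)\<bar>)"
        using i[OF h] i[of 0] \<delta> by simp
      show "integrable lborel (\<lambda>y. (4 * N * norm h) * indicator (cball 0 (2 * \<delta>)) (y :: complex \<times> complex) :: real)"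
        by (intro integrable_mult_right integrable_real_indicator) (use emeasure_lborel_cball_finite in auto)
    qed
    also have "\<dots> = 4 * N * vol * norm h" unfolding vol_def by simp
    finally show ?thesis by simp
  qed
  have "isCont (smooth \<delta> g) x" for x
    unfolding isCont_def
  proof (rule LIM_offset_zero_cancel, rule LIM_zero_cancel, rule tendsto_0_le[where K = 1])
    show "((\<lambda>h. 4 * N * vol * norm h) \<longlongrightarrow> 0) (at (0 :: complex \<times> complex))"
      by (auto intro!: tendsto_eq_intros)
    show "\<forall>\<^sub>F h in at 0. norm (smooth \<delta> g (x + h) - smooth \<delta> g x) \<le> norm (4 * N * vol * norm h) * 1"
      unfolding eventually_at
    proof (intro exI[of _ \<delta>] conjI ballI impI \<delta>(1))
      fix h :: "complex \<times> complex" assume "h \<noteq> 0 \<and> dist h 0 < \<delta>"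
      then have "norm h \<le> \<delta>" by simp
      from lip[OF this, of x] show "norm (smooth \<delta> g (x + h) - smooth \<delta> g x) \<le> norm (4 * N * vol * norm h) * 1"
        using abs_ge_self[of "4 * N * vol * norm h"] unfolding real_norm_def by linarith
    qed
  qed
  then show ?thesis by (simp add: continuous_at_imp_continuous_on)
qed

lemma bump_mass_pos:
  assumes "0 < \<delta>" "\<delta> \<le> 1"
  shows "0 < (LINT y|lborel. bump \<delta> (y :: complex \<times> complex))"
proof -
  define e where "e = (\<delta>\<^sup>2 - (\<delta> / 2)\<^sup>2)\<^sup>2"
  have e: "0 < e" unfolding e_def using assms by (simp add: power2_eq_square)
  have le: "e * indicator (ball 0 (\<delta> / 2)) y \<le> bump \<delta> (y :: complex \<times> complex)" for y
  proof (cases "norm y < \<delta> / 2")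
    case True
    then have "(norm y)\<^sup>2 \<le> (\<delta> / 2)\<^sup>2" by (intro power_mono) auto
    moreover have "0 \<le> \<delta>\<^sup>2 - (\<delta> / 2)\<^sup>2" using assms by (simp add: power2_eq_square)
    ultimately have "e \<le> bump \<delta> y" unfolding e_def bump_def by (intro power_mono) auto
    then show ?thesis using True by simp
  qed (simp add: bump_nonneg)
  have "0 < e * measure lborel (ball (0 :: complex \<times> complex) (\<delta> / 2))"
    using e assms by (intro mult_pos_pos content_ball_pos) auto
  also have "\<dots> = (LINT y|lborel. e * indicator (ball 0 (\<delta> / 2)) (y :: complex \<times> complex))"
    by simp
  also have "\<dots> \<le> (LINT y|lborel. bump \<delta> (y :: complex \<times> complex))"
  proof (rule integral_mono[OF _ _ le])
    show "integrable lborel (\<lambda>y. e * indicator (ball 0 (\<delta> / 2)) (y :: complex \<times> complex) :: real)"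
      by (intro integrable_mult_right integrable_real_indicator) (use emeasure_lborel_ball_finite in auto)
    show "integrable lborel (\<lambda>y. bump \<delta> (y :: complex \<times> complex))"
      using integrable_bump_prod[of "\<lambda>_. 1" 1 \<delta> 0] assms by simp
  qed
  finally show ?thesis .
qed

section \<open>The upper bound from an analytic disc\<close>

text \<open>On the ring \<open>\<eta> \<le> \<bar>B\<bar> \<le> b\<close> the smoothed function is compared with a multiple of the harmonic
  function \<open>ln \<bar>B\<bar>\<close>; the hypotheses give the comparison on the two boundary parts.\<close>

lemma smooth_disc_upper_bound:
  fixes g :: "complex \<times> complex \<Rightarrow> real" and \<phi> :: "complex \<Rightarrow> complex \<times> complex"
  assumes g [measurable]: "g \<in> borel_measurable borel" and gN: "\<And>y. - N \<le> g y" "\<And>y. g y \<le> 0"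
    and sub: "line_submean X g" and \<delta>: "0 < \<delta>" "\<delta> \<le> 1"
    and \<Omega>: "open \<Omega>" and \<phi>: "(\<lambda>t. fst (\<phi> t)) holomorphic_on \<Omega>" "(\<lambda>t. snd (\<phi> t)) holomorphic_on \<Omega>"
    and B: "B holomorphic_on \<Omega>" "compact {t \<in> \<Omega>. norm (B t) \<le> b}" and b: "0 < \<eta>" "\<eta> < b" "b < 1"
    and X: "\<And>t. t \<in> \<Omega> \<Longrightarrow> \<eta> \<le> norm (B t) \<Longrightarrow> norm (B t) \<le> b \<Longrightarrow> cball (\<phi> t) (2 * \<delta>) \<subseteq> X"
    and \<mu>: "0 \<le> \<mu>"
    and inner: "\<And>t. t \<in> \<Omega> \<Longrightarrow> norm (B t) = \<eta> \<Longrightarrow> AE y in lborel. norm y \<le> \<delta> \<longrightarrow> g (\<phi> t + y) \<le> \<mu> * ln \<eta>"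
    and t1: "t1 \<in> \<Omega>" "\<eta> \<le> norm (B t1)" "norm (B t1) \<le> b"
  shows "smooth \<delta> g (\<phi> t1) \<le> (LINT y|lborel. bump \<delta> (y :: complex \<times> complex)) * (\<mu> * (ln (norm (B t1)) - ln b))"
proof -
  have N: "\<bar>g y\<bar> \<le> N" for y using gN[of y] by simp
  define V where "V = (LINT y|lborel. bump \<delta> (y :: complex \<times> complex))"
  have V0: "0 \<le> V" unfolding V_def by (intro Bochner_Integration.integral_nonneg bump_nonneg)
  have lnb: "ln b < 0" using b by (simp add: ln_less_zero)
  have cB: "continuous_on \<Omega> B" by (rule holomorphic_on_imp_continuous_on[OF B(1)])
  have c\<phi>: "continuous_on \<Omega> \<phi>"
    using continuous_on_Pair[OF \<phi>[THEN holomorphic_on_imp_continuous_on]] by simp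
  have csm: "continuous_on \<Omega> (\<lambda>t. smooth \<delta> g (\<phi> t))"
    by (rule continuous_on_compose2[OF continuous_on_smooth[OF g N \<delta>, of UNIV] c\<phi>]) simp
  define K where "K = {t \<in> \<Omega>. norm (B t) \<le> b} \<inter> (\<lambda>t. norm (B t)) -` {\<eta>..}"
  define U where "U = \<Omega> \<inter> (\<lambda>t. norm (B t)) -` {\<eta><..<b}"
  have K: "compact K"
  proof -
    have "continuous_on {t \<in> \<Omega>. norm (B t) \<le> b} (\<lambda>t. norm (B t))"
      by (intro continuous_intros continuous_on_subset[OF cB]) auto
    then have "closed K" unfolding K_def
      by (rule continuous_closed_preimage) (use B(2) compact_imp_closed in auto)
    then show ?thesis
      using compact_Int_closed[OF B(2), of K] by (simp add: K_def Int_assoc[symmetric])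
  qed
  have KO: "K \<subseteq> \<Omega>" unfolding K_def by auto
  have U: "open U" unfolding U_def
    by (rule continuous_open_preimage) (auto intro!: continuous_intros cB \<Omega>)
  have UK: "U \<subseteq> K" unfolding U_def K_def by auto
  have nz: "B t \<noteq> 0" if "t \<in> K" for t using that b(1) unfolding K_def by auto
  define v where "v = (\<lambda>t. smooth \<delta> g (\<phi> t) - V * \<mu> * ln (norm (B t)))"
  have cv: "continuous_on K v"
    unfolding v_def using nz
    by (intro continuous_intros continuous_on_subset[OF csm KO] continuous_on_subset[OF cB KO]) auto
  have isb: "integrable lborel (\<lambda>y. g (x + y) * bump \<delta> y)" for x
    by (rule integrable_bump_prod[OF g N]) (use \<delta> in auto)
  have ib: "integrable lborel (\<lambda>y. bump \<delta> (y :: complex \<times> complex))"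
    using integrable_bump_prod[of "\<lambda>_. 1" 1 \<delta> 0] \<delta> by simp
  have "v t1 \<le> - (V * \<mu> * ln b)"
  proof (rule maximum_principle[OF K cv U UK])
    show "t1 \<in> K" using t1 unfolding K_def by auto
  next
    fix t assume t: "t \<in> K - U"
    then have tO: "t \<in> \<Omega>" and "norm (B t) = \<eta> \<or> norm (B t) = b"
      unfolding K_def U_def by (auto simp: not_less)
    then consider "norm (B t) = b" | "norm (B t) = \<eta>" by blast
    then show "v t \<le> - (V * \<mu> * ln b)"
    proof cases
      case 1
      have "smooth \<delta> g (\<phi> t) \<le> (LINT (y :: complex \<times> complex)|lborel. 0 :: real)" unfolding smooth_def
        by (rule integral_mono[OF isb]) (simp, intro mult_nonpos_nonneg gN(2) bump_nonneg)
      then show ?thesis unfolding v_def 1 by simp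
    next
      case 2
      have "smooth \<delta> g (\<phi> t) \<le> (LINT y|lborel. (\<mu> * ln \<eta>) * bump \<delta> (y :: complex \<times> complex))"
        unfolding smooth_def
      proof (rule integral_mono_AE[OF isb])
        show "integrable lborel (\<lambda>y. (\<mu> * ln \<eta>) * bump \<delta> (y :: complex \<times> complex))" using ib by simp
        show "AE y in lborel. g (\<phi> t + y) * bump \<delta> y \<le> \<mu> * ln \<eta> * bump \<delta> y"
          using inner[OF tO 2]
        proof eventually_elim
          case (elim y)
          show ?case
          proof (cases "norm y \<le> \<delta>")
            case True
            then show ?thesis using elim bump_nonneg by (intro mult_right_mono) auto
          next
            case False
            then show ?thesis using \<delta> by (simp add: bump_eq_0)
          qed
        qed
      qed
      also have "\<dots> = V * \<mu> * ln \<eta>" using ib by (simp add: V_def)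
      finally have "v t \<le> 0" unfolding v_def 2 by simp
      also have "0 \<le> - (V * \<mu> * ln b)" using V0 \<mu> lnb by (simp add: mult_nonneg_nonpos)
      finally show ?thesis .
    qed
  next
    fix t assume t: "t \<in> U"
    then obtain \<rho> where \<rho>: "\<rho> > 0" "cball t \<rho> \<subseteq> U" using U open_contains_cball by blast
    have \<rho>O: "cball t \<rho> \<subseteq> \<Omega>" using \<rho> UK KO by blast
    have bO: "ball t \<rho> \<subseteq> \<Omega>" using \<rho>O ball_subset_cball by blast
    have "cball (\<phi> t) (2 * \<delta>) \<subseteq> X" using t by (intro X) (auto simp: U_def)
    from smooth_disc_submean[OF g N sub \<delta> \<rho>(1) holomorphic_on_subset[OF \<phi>(1) bO] holomorphic_on_subset[OF \<phi>(2) bO] this]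
    obtain C r0 where r0: "r0 > 0" and sm: "\<And>r. 0 < r \<Longrightarrow> r < r0 \<Longrightarrow>
        smooth \<delta> g (\<phi> t) \<le> (LINT s|circ. smooth \<delta> g (\<phi> (t + complex_of_real r * cis s))) + C * r ^ 3" by blast
    show "\<exists>C. \<exists>r0>0. \<forall>r. 0 < r \<and> r < r0 \<longrightarrow> v t \<le> (LINT s|circ. v (t + complex_of_real r * cis s)) + C * r ^ 3"
    proof (rule exI[of _ C], rule exI[of _ "min r0 \<rho>"], intro conjI allI impI)
      fix r assume r: "0 < r \<and> r < min r0 \<rho>"
      have rO: "cball t r \<subseteq> K" using subset_cball[of r \<rho> t] r \<rho>(2) UK by fastforce
      have mv: "(LINT s|circ. ln (norm (B (t + complex_of_real r * cis s)))) = ln (norm (B t))"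
        by (rule mean_value_ln_norm[OF B(1) \<Omega>]) (use rO KO nz r in auto)
      have i1: "integrable circ (\<lambda>s. smooth \<delta> g (\<phi> (t + complex_of_real r * cis s)))"
        by (rule circ_integrable_circle[OF continuous_on_subset[OF csm]]) (use rO KO r in auto)
      have i2: "integrable circ (\<lambda>s. ln (norm (B (t + complex_of_real r * cis s))))"
      proof (rule circ_integrable_circle)
        show "continuous_on (cball t r) (\<lambda>z. ln (norm (B z)))"
          using nz rO KO by (intro continuous_intros continuous_on_subset[OF cB]) auto
      qed (use r in simp)
      have "(LINT s|circ. v (t + complex_of_real r * cis s)) =
          (LINT s|circ. smooth \<delta> g (\<phi> (t + complex_of_real r * cis s))) - V * \<mu> * ln (norm (B t))"
        unfolding v_def using i1 i2 by (simp add: mv)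
      then show "v t \<le> (LINT s|circ. v (t + complex_of_real r * cis s)) + C * r ^ 3"
        using sm[of r] r unfolding v_def by simp
    qed (use r0 \<rho> in simp)
  qed
  then show ?thesis unfolding v_def V_def[symmetric] by (simp add: algebra_simps)
qed

lemma cmul_bidisk: "norm w \<le> 1 \<Longrightarrow> x \<in> bidisk \<Longrightarrow> cmul w x \<in> bidisk"
  by (cases x) (auto simp: cmul_def norm_mult intro: le_less_trans[OF mult_left_le_one_le])

lemma line_submean_rotate:
  assumes g: "line_submean bidisk g"
  shows "line_submean bidisk (\<lambda>y. g (cmul (cis \<theta>) y))"
  unfolding line_submean_def
proof (intro allI impI)
  fix x d assume a: "\<forall>w\<in>cball 0 1. x + cmul w d \<in> bidisk"
  have eq: "cmul (cis \<theta>) (x + cmul w d) = cmul (cis \<theta>) x + cmul w (cmul (cis \<theta>) d)" for w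
    by (simp add: cmul_add cmul_cmul mult.commute)
  have "\<forall>w\<in>cball 0 1. cmul (cis \<theta>) x + cmul w (cmul (cis \<theta>) d) \<in> bidisk"
    unfolding eq[symmetric] using a by (intro ballI cmul_bidisk) auto
  then show "g (cmul (cis \<theta>) x) \<le> (LINT s|circ. g (cmul (cis \<theta>) (x + cmul (cis s) d)))"
    unfolding eq using g unfolding line_submean_def by blast
qed

text \<open>Cutting a negative plurisubharmonic function off at a finite level makes it bounded and keeps the
  mean value inequality.  It destroys the poles, so upper bounds survive only above the level \<open>- N\<close>,
  which has to be chosen below all bounds that the comparison uses.\<close>

lemma psh_truncation:
  assumes psh: "plurisubharmonic_on bidisk f" and neg: "\<And>y. y \<in> bidisk \<Longrightarrow> f y < 0" and N: "0 \<le> N"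
  obtains g :: "complex \<times> complex \<Rightarrow> real"
  where "g \<in> borel_measurable borel" "\<And>y. - N \<le> g y" "\<And>y. g y \<le> 0" "line_submean bidisk g"
    "\<And>y. y \<in> bidisk \<Longrightarrow> f y \<le> ereal (g y)"
    "\<And>y c. y \<in> bidisk \<Longrightarrow> f y \<le> ereal c \<Longrightarrow> - N \<le> c \<Longrightarrow> g y \<le> c"
proof -
  interpret prob_space circ by (rule prob_space_circ)
  define g where "g = (\<lambda>y. if y \<in> bidisk then real_of_ereal (max (f y) (ereal (- N))) else 0)"
  have g_in: "ereal (g y) = max (f y) (ereal (- N))" if "y \<in> bidisk" for y
    unfolding g_def using neg[OF that] that by (cases "f y") (simp_all add: max_def)
  have g_N: "- N \<le> g y" for y
  proof (cases "y \<in> bidisk")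
    case True
    have "ereal (- N) \<le> ereal (g y)" unfolding g_in[OF True] by simp
    then show ?thesis by simp
  qed (use N in \<open>simp add: g_def\<close>)
  have g_0: "g y \<le> 0" for y
  proof (cases "y \<in> bidisk")
    case True
    have "ereal (g y) \<le> 0" unfolding g_in[OF True] using neg[OF True] N by simp
    then show ?thesis by simp
  qed (simp add: g_def)
  have m: "g \<in> borel_measurable borel"
  proof (rule borel_measurableI_less)
    fix c :: real
    have "open {y. g y < c}" if c: "c \<le> 0"
    proof -
      have "openin (top_of_set bidisk) {y \<in> bidisk. f y < ereal c}"
        using psh unfolding plurisubharmonic_on_def upper_semicontinuous_on_def by blast
      then have o: "open {y \<in> bidisk. f y < ereal c}"
        by (simp add: openin_open_eq open_Times)
      have "{y. g y < c} = (if - N < c then {y \<in> bidisk. f y < ereal c} else {})"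
      proof (cases "- N < c")
        case True
        have "g y < c \<longleftrightarrow> f y < ereal c" if y: "y \<in> bidisk" for y
        proof -
          have "g y < c \<longleftrightarrow> ereal (g y) < ereal c" by simp
          also have "\<dots> \<longleftrightarrow> f y < ereal c" unfolding g_in[OF y] using True by simp
          finally show ?thesis .
        qed
        moreover have "\<not> g y < c" if "y \<notin> bidisk" for y using that c unfolding g_def by auto
        ultimately show ?thesis using True by auto
      next
        case False
        then show ?thesis using g_N by (auto simp: not_less intro: order_trans)
      qed
      then show ?thesis using o by simp
    qed
    moreover have "{y. g y < c} = UNIV" if "0 < c" using that g_0 by (auto intro: le_less_trans)
    ultimately show "{y \<in> space borel. g y < c} \<in> sets borel"
      by (cases "c \<le> 0") (auto simp: not_le)
  qed
  note [measurable] = m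
  have 1: "line_submean bidisk g"
    unfolding line_submean_def
  proof (intro allI impI)
    fix x d assume a: "\<forall>w\<in>cball 0 1. x + cmul w d \<in> bidisk"
    have xin: "x \<in> bidisk" using a[rule_format, of 0] by (simp add: cmul_def flip: zero_prod_def)
    have cin: "x + cmul (cis s) d \<in> bidisk" for s by (rule a[rule_format]) simp
    define u where "u = (\<lambda>w. f (fst x + w * fst d, snd x + w * snd d))"
    have uf: "u w = f (x + cmul w d)" for w
      unfolding u_def by (cases x) (simp add: cmul_def)
    have "subharmonic_on {w. (fst x + w * fst d, snd x + w * snd d) \<in> bidisk} u"
      using psh unfolding plurisubharmonic_on_def u_def by blast
    moreover have "{w. (fst x + w * fst d, snd x + w * snd d) \<in> bidisk} = {w. x + cmul w d \<in> bidisk}"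
      by (cases x) (simp add: cmul_def)
    ultimately have "subharmonic_on {w. x + cmul w d \<in> bidisk} u" by simp
    moreover have "cball 0 1 \<subseteq> {w. x + cmul w d \<in> bidisk}" using a by blast
    ultimately have "u 0 \<le> circle_mean u 0 1"
      unfolding subharmonic_on_def using zero_less_one by blast
    moreover have "circle_mean u 0 1 = - enn2ereal (\<integral>\<^sup>+ s. e2ennreal (- f (x + cmul (cis s) d)) \<partial>circ)"
    proof -
      have "e2ennreal (f (x + cmul (cis s) d)) = 0" for s
        using neg[OF cin[of s]] by (intro e2ennreal_neg) simp
      then show ?thesis by (simp add: circle_mean_def uf zero_ennreal.rep_eq)
    qed
    moreover have "u 0 = f x" by (simp add: u_def)
    ultimately have le: "enn2ereal (\<integral>\<^sup>+ s. e2ennreal (- f (x + cmul (cis s) d)) \<partial>circ) \<le> - f x"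
      by (metis ereal_uminus_le_reorder ereal_uminus_uminus)
    have gm: "ennreal (- g y) = min (e2ennreal (- f y)) (ennreal N)" if y: "y \<in> bidisk" for y
    proof -
      have "ereal (- g y) = min (- f y) (ereal N)"
        using g_in[OF y] by (cases "f y") (auto simp: max_def min_def split: if_splits)
      moreover have "e2ennreal (min A A') = min (e2ennreal A) (e2ennreal A')" for A A'
        by (rule min_of_mono[symmetric]) (simp add: mono_def e2ennreal_mono)
      ultimately show ?thesis by (metis e2ennreal_ereal)
    qed
    have ig: "integrable circ (\<lambda>s. - g (x + cmul (cis s) d))"
    proof (rule circ_integrable_bounded[where B = N])
      have [measurable]: "(\<lambda>s. x + cmul (cis s) d) \<in> borel_measurable borel"
        by (intro borel_measurable_continuous_onI continuous_intros)
      show "(\<lambda>s. - g (x + cmul (cis s) d)) \<in> borel_measurable borel" by measurable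
      show "norm (- g (x + cmul (cis s) d)) \<le> N" for s
        using g_N[of "x + cmul (cis s) d"] g_0[of "x + cmul (cis s) d"] by simp
    qed
    have "ennreal (LINT s|circ. - g (x + cmul (cis s) d)) = (\<integral>\<^sup>+ s. ennreal (- g (x + cmul (cis s) d)) \<partial>circ)"
      by (rule nn_integral_eq_integral[OF ig, symmetric]) (use g_0 in auto)
    also have "\<dots> \<le> ennreal (- g x)"
      unfolding gm[OF xin]
    proof (rule min.boundedI)
      have "(\<integral>\<^sup>+ s. ennreal (- g (x + cmul (cis s) d)) \<partial>circ) \<le> (\<integral>\<^sup>+ s. e2ennreal (- f (x + cmul (cis s) d)) \<partial>circ)"
        unfolding gm[OF cin] by (intro nn_integral_mono) simp
      also have "\<dots> \<le> e2ennreal (- f x)"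
        using e2ennreal_mono[OF le] by simp
      finally show "(\<integral>\<^sup>+ s. ennreal (- g (x + cmul (cis s) d)) \<partial>circ) \<le> e2ennreal (- f x)" .
      have "(\<integral>\<^sup>+ s. ennreal (- g (x + cmul (cis s) d)) \<partial>circ) \<le> (\<integral>\<^sup>+ s. ennreal N \<partial>circ)"
        unfolding gm[OF cin] by (intro nn_integral_mono) simp
      then show "(\<integral>\<^sup>+ s. ennreal (- g (x + cmul (cis s) d)) \<partial>circ) \<le> ennreal N"
        by (simp add: emeasure_space_1)
    qed
    finally have "(LINT s|circ. - g (x + cmul (cis s) d)) \<le> - g x"
      using g_0 by (subst (asm) ennreal_le_iff) auto
    then show "g x \<le> (LINT s|circ. g (x + cmul (cis s) d))" by simp
  qed
  have 2: "f y \<le> ereal (g y)" if "y \<in> bidisk" for y using g_in[OF that] by simp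
  have 3: "g y \<le> c" if "y \<in> bidisk" "f y \<le> ereal c" "- N \<le> c" for y c
  proof -
    have "ereal (g y) \<le> ereal c" unfolding g_in[OF that(1)] using that by simp
    then show ?thesis by simp
  qed
  show ?thesis by (rule that[OF m g_N g_0 1 2 3])
qed

lemma log_pole_bound:
  assumes "has_log_pole \<Omega> f P"
  obtains C \<rho> where "\<rho> > 0"
    "\<And>y. y \<in> \<Omega> \<Longrightarrow> y \<noteq> P \<Longrightarrow> norm (y - P) < \<rho> \<Longrightarrow> f y \<le> ereal (ln (norm (y - P)) + C)"
proof -
  obtain C \<rho> where \<rho>: "\<rho> > 0" and C: "\<And>y. y \<in> \<Omega> \<Longrightarrow> y \<noteq> P \<Longrightarrow> dist y P < \<rho> \<Longrightarrow>
      f y - ereal (ln (norm (y - P))) \<le> ereal C"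
    using assms unfolding has_log_pole_def eventually_at by blast
  show ?thesis
  proof (rule that[OF \<rho>, of C])
    fix y assume "y \<in> \<Omega>" "y \<noteq> P" "norm (y - P) < \<rho>"
    then have "f y - ereal (ln (norm (y - P))) \<le> ereal C" by (intro C) (auto simp: dist_norm)
    then show "f y \<le> ereal (ln (norm (y - P)) + C)" by (cases "f y") auto
  qed
qed

text \<open>The comparison takes place on a ring \<open>\<eta> \<le> \<bar>B\<bar> \<le> exp (- \<tau>)\<close> and against \<open>(1 - \<tau>) * ln \<bar>B\<bar>\<close>: the factor
  \<open>1 - \<tau>\<close> absorbs the constants of the poles on the inner boundary once \<open>\<eta>\<close> is small.  To return from the
  smoothed function to \<open>f\<close> at \<open>\<phi> t1\<close>, the kernel variable is rotated by all angles: each of its orbits is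
  a circle in a complex line, where the mean value inequality applies.  A rotation of the kernel
  variable amounts to rotating the function and the disc, and the bidisk is invariant, so the
  comparison holds for every angle.\<close>

lemma psh_disc_upper_bound:
  fixes \<phi> :: "complex \<Rightarrow> complex \<times> complex"
  assumes psh: "plurisubharmonic_on bidisk f" and neg: "\<And>y. y \<in> bidisk \<Longrightarrow> f y < 0"
    and poles: "has_log_pole bidisk f P" "has_log_pole bidisk f Q"
    and \<Omega>: "open \<Omega>" and \<phi>: "(\<lambda>t. fst (\<phi> t)) holomorphic_on \<Omega>" "(\<lambda>t. snd (\<phi> t)) holomorphic_on \<Omega>"
    and \<phi>in: "\<And>t. t \<in> \<Omega> \<Longrightarrow> \<phi> t \<in> bidisk"
    and B: "B holomorphic_on \<Omega>" "\<And>b. b < 1 \<Longrightarrow> compact {t \<in> \<Omega>. norm (B t) \<le> b}"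
    and \<eta>0: "\<eta>0 > 0" "\<And>t. t \<in> \<Omega> \<Longrightarrow> norm (B t) < \<eta>0 \<Longrightarrow>
       norm (\<phi> t - P) \<le> L * norm (B t) \<or> norm (\<phi> t - Q) \<le> L * norm (B t)"
    and t1: "t1 \<in> \<Omega>" "B t1 \<noteq> 0" "norm (B t1) < 1"
  shows "f (\<phi> t1) \<le> ereal (ln (norm (B t1)))"
proof -
  define l where "l = ln (norm (B t1))"
  have l: "l < 0" unfolding l_def using t1 by simp
  obtain CP \<rho>P where P: "\<rho>P > 0" "\<And>y. y \<in> bidisk \<Longrightarrow> y \<noteq> P \<Longrightarrow> norm (y - P) < \<rho>P \<Longrightarrow> f y \<le> ereal (ln (norm (y - P)) + CP)"
    using log_pole_bound[OF poles(1)] by blast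
  obtain CQ \<rho>Q where Q: "\<rho>Q > 0" "\<And>y. y \<in> bidisk \<Longrightarrow> y \<noteq> Q \<Longrightarrow> norm (y - Q) < \<rho>Q \<Longrightarrow> f y \<le> ereal (ln (norm (y - Q)) + CQ)"
    using log_pole_bound[OF poles(2)] by blast
  define C where "C = max CP CQ"
  define \<rho> where "\<rho> = min \<rho>P \<rho>Q"
  have \<rho>: "\<rho> > 0" unfolding \<rho>_def using P Q by simp
  define L' where "L' = max L 0 + 1"
  have L': "L' > 0" "L + 1 \<le> L'" unfolding L'_def by auto
  have key: "f (\<phi> t1) \<le> ereal ((1 - \<tau>) * (l + \<tau>))" if \<tau>: "0 < \<tau>" "\<tau> < 1" "\<tau> < - l" for \<tau>
  proof -
    define b where "b = exp (- \<tau>)"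
    have b: "norm (B t1) < b" "b < 1" "ln b = - \<tau>"
    proof -
      have "exp l < exp (- \<tau>)" using \<tau> by simp
      then show "norm (B t1) < b" unfolding b_def l_def using t1 by simp
    qed (use \<tau> in \<open>auto simp: b_def\<close>)
    \<comment> \<open>The last entry makes \<open>\<tau> * ln \<eta>\<close> smaller than the pole constants, see \<open>pole_const\<close>.\<close>
    define \<eta> where "\<eta> = min (min (\<eta>0 / 2) (norm (B t1))) (min (\<rho> / (2 * L')) (exp (- (\<bar>C\<bar> + \<bar>ln L'\<bar>) / \<tau>)))"
    have \<eta>: "0 < \<eta>" "\<eta> < \<eta>0" "\<eta> \<le> norm (B t1)" "\<eta> \<le> \<rho> / (2 * L')" "\<eta> \<le> exp (- (\<bar>C\<bar> + \<bar>ln L'\<bar>) / \<tau>)"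
      unfolding \<eta>_def using \<eta>0(1) t1(2) \<rho> L' by (auto simp: min_less_iff_disj)
    have \<eta>1: "\<eta> < b" "\<eta> < 1" using \<eta>(3) b by auto
    have ln\<eta>: "ln \<eta> < 0" using \<eta>(1) \<eta>1 by simp
    have "ln \<eta> \<le> ln (exp (- (\<bar>C\<bar> + \<bar>ln L'\<bar>) / \<tau>))" using \<eta> by (subst ln_le_cancel_iff) auto
    then have "\<tau> * ln \<eta> \<le> - (\<bar>C\<bar> + \<bar>ln L'\<bar>)" using \<tau> by (simp add: field_simps)
    then have pole_const: "ln (L' * \<eta>) + C \<le> (1 - \<tau>) * ln \<eta>"
      using L' \<eta>(1) by (simp add: ln_mult algebra_simps)
    have L\<eta>: "L' * \<eta> < \<rho>"
    proof -
      have "L' * \<eta> \<le> L' * (\<rho> / (2 * L'))" using \<eta>(4) L' by (intro mult_left_mono) auto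
      also have "\<dots> < \<rho>" using L' \<rho> by (simp add: field_simps)
      finally show ?thesis .
    qed
    obtain g :: "complex \<times> complex \<Rightarrow> real"
      where g: "g \<in> borel_measurable borel" "\<And>y. - (- ln \<eta>) \<le> g y" "\<And>y. g y \<le> 0" "line_submean bidisk g"
        "\<And>y. y \<in> bidisk \<Longrightarrow> f y \<le> ereal (g y)"
        "\<And>y c. y \<in> bidisk \<Longrightarrow> f y \<le> ereal c \<Longrightarrow> - (- ln \<eta>) \<le> c \<Longrightarrow> g y \<le> c"
      by (rule psh_truncation[OF psh neg, of "- ln \<eta>"]) (use ln\<eta> in auto)
    note [measurable] = g(1)
    have gN: "\<bar>g y\<bar> \<le> - ln \<eta>" for y using g(2)[of y] g(3)[of y] by simp
    have c\<phi>: "continuous_on \<Omega> \<phi>"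
      using continuous_on_Pair[OF \<phi>[THEN holomorphic_on_imp_continuous_on]] by simp
    have "compact (\<phi> ` {t \<in> \<Omega>. norm (B t) \<le> b})"
      by (intro compact_continuous_image continuous_on_subset[OF c\<phi>] B(2) b) auto
    moreover have "open bidisk" by (intro open_Times) auto
    moreover have "\<phi> ` {t \<in> \<Omega>. norm (B t) \<le> b} \<subseteq> bidisk" using \<phi>in by (intro image_subsetI) blast
    ultimately obtain \<delta>' where \<delta>': "\<delta>' > 0" "(\<Union>x\<in>\<phi> ` {t \<in> \<Omega>. norm (B t) \<le> b}. cball x \<delta>') \<subseteq> bidisk"
      using compact_subset_open_imp_cball_epsilon_subset by blast
    define \<delta> where "\<delta> = min (\<delta>' / 2) (min \<eta> 1)"
    have \<delta>: "0 < \<delta>" "\<delta> \<le> 1" "\<delta> \<le> \<eta>" "2 * \<delta> \<le> \<delta>'" unfolding \<delta>_def using \<delta>' \<eta> by auto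
    have cb: "cball (\<phi> t) (2 * \<delta>) \<subseteq> bidisk" if "t \<in> \<Omega>" "norm (B t) \<le> b" for t
    proof -
      have "cball (\<phi> t) (2 * \<delta>) \<subseteq> cball (\<phi> t) \<delta>'" using \<delta> by (intro subset_cball)
      also have "\<dots> \<subseteq> bidisk" using \<delta>'(2) that by blast
      finally show ?thesis .
    qed
    define V where "V = (LINT y|lborel. bump \<delta> (y :: complex \<times> complex))"
    have V: "V > 0" unfolding V_def by (rule bump_mass_pos) (use \<delta> in auto)

    \<comment> \<open>The bound for the kernel variable rotated by \<open>\<theta>\<close>.\<close>
    have rot: "(LINT y|lborel. g (\<phi> t1 + cmul (cis \<theta>) y) * bump \<delta> y) \<le> V * ((1 - \<tau>) * (l + \<tau>))" for \<theta>
    proof -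
      define g' where "g' = (\<lambda>y. g (cmul (cis \<theta>) y))"
      define \<phi>' where "\<phi>' = (\<lambda>t. cmul (cis (- \<theta>)) (\<phi> t))"
      have unrot: "cmul (cis \<theta>) (cmul (cis (- \<theta>)) x) = x" for x
        by (simp add: cmul_cmul cis_mult)
      have rot_add: "cmul (cis \<theta>) (\<phi>' t + y) = \<phi> t + cmul (cis \<theta>) y" for t y
        by (simp add: cmul_add \<phi>'_def unrot)
      have [measurable]: "(\<lambda>y. cmul (cis \<theta>) y) \<in> borel_measurable borel"
        by (intro borel_measurable_continuous_onI continuous_intros)
      have "smooth \<delta> g' (\<phi>' t1) \<le> V * ((1 - \<tau>) * (ln (norm (B t1)) - ln b))"
        unfolding V_def
      proof (rule smooth_disc_upper_bound[where X = bidisk and \<Omega> = \<Omega> and \<eta> = \<eta> and N = "- ln \<eta>"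
            and \<phi> = \<phi>' and B = B and b = b and \<mu> = "1 - \<tau>" and ?t1.0 = t1])
        show "g' \<in> borel_measurable borel" unfolding g'_def by measurable
        show "line_submean bidisk g'" unfolding g'_def by (rule line_submean_rotate[OF g(4)])
        show "(\<lambda>t. fst (\<phi>' t)) holomorphic_on \<Omega>" "(\<lambda>t. snd (\<phi>' t)) holomorphic_on \<Omega>"
          unfolding \<phi>'_def cmul_def using \<phi> by (auto intro!: holomorphic_intros)
        show "compact {t \<in> \<Omega>. cmod (B t) \<le> b}" by (rule B(2)[OF b(2)])
      next
        fix t assume t: "t \<in> \<Omega>" "\<eta> \<le> norm (B t)" "norm (B t) \<le> b"
        show "cball (\<phi>' t) (2 * \<delta>) \<subseteq> bidisk"
        proof
          fix y assume "y \<in> cball (\<phi>' t) (2 * \<delta>)"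
          then have "norm (y - \<phi>' t) \<le> 2 * \<delta>" by (simp add: dist_norm norm_minus_commute)
          then have "norm (cmul (cis \<theta>) (y - \<phi>' t)) \<le> 2 * \<delta>" by simp
          then have "\<phi> t + cmul (cis \<theta>) (y - \<phi>' t) \<in> cball (\<phi> t) (2 * \<delta>)"
            by (simp only: add_in_cball_iff)
          then have "cmul (cis (- \<theta>)) (\<phi> t + cmul (cis \<theta>) (y - \<phi>' t)) \<in> bidisk"
            using cb[OF t(1,3)] by (intro cmul_bidisk) auto
          moreover have "cmul (cis (- \<theta>)) (\<phi> t + cmul (cis \<theta>) (y - \<phi>' t)) = y"
            by (simp add: cmul_add cmul_cmul cis_mult flip: \<phi>'_def) (simp add: \<phi>'_def)
          ultimately show "y \<in> bidisk" by simp
        qed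
      next
        fix t assume t: "t \<in> \<Omega>" "norm (B t) = \<eta>"
        have "AE y in lborel. y \<noteq> cmul (cis (- \<theta>)) (P - \<phi> t) \<and> y \<noteq> cmul (cis (- \<theta>)) (Q - \<phi> t)"
          by (intro AE_conjI AE_lborel_singleton)
        then show "AE y in lborel. norm y \<le> \<delta> \<longrightarrow> g' (\<phi>' t + y) \<le> (1 - \<tau>) * ln \<eta>"
        proof eventually_elim
          case (elim y)
          show ?case
          proof (rule impI)
            assume y: "norm y \<le> \<delta>"
            define y' where "y' = \<phi> t + cmul (cis \<theta>) y"
            have ny: "norm (y' - \<phi> t) \<le> \<eta>" unfolding y'_def using y \<delta> by simp
            have "y' \<in> cball (\<phi> t) (2 * \<delta>)"
              unfolding y'_def add_in_cball_iff using y \<delta> by simp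
            moreover have "norm (B t) \<le> b" using t(2) \<eta>1(1) by simp
            ultimately have yb: "y' \<in> bidisk" using cb[OF t(1)] by blast
            have ne: "y' \<noteq> P" "y' \<noteq> Q"
              using elim unfolding y'_def by (auto simp: cmul_cmul cis_mult)
            have near: "f y' \<le> ereal ((1 - \<tau>) * ln \<eta>)"
              if A: "norm (\<phi> t - A) \<le> L * \<eta>" "y' \<noteq> A"
                and fA: "norm (y' - A) < \<rho> \<Longrightarrow> f y' \<le> ereal (ln (norm (y' - A)) + C')" "C' \<le> C" for A C'
            proof -
              have "norm (y' - A) \<le> norm (y' - \<phi> t) + norm (\<phi> t - A)"
                using norm_triangle_ineq[of "y' - \<phi> t" "\<phi> t - A"] by simp
              also have "\<dots> \<le> (L + 1) * \<eta>" using ny A(1) by (simp add: algebra_simps)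
              also have "\<dots> \<le> L' * \<eta>" using L' \<eta>(1) by (intro mult_right_mono) auto
              finally have le: "norm (y' - A) \<le> L' * \<eta>" .
              have "f y' \<le> ereal (ln (norm (y' - A)) + C')" by (rule fA) (use le L\<eta> in simp)
              also have "ln (norm (y' - A)) \<le> ln (L' * \<eta>)" using le A(2) L' \<eta> by (subst ln_le_cancel_iff) auto
              then have "ereal (ln (norm (y' - A)) + C') \<le> ereal ((1 - \<tau>) * ln \<eta>)"
                using pole_const fA(2) by simp
              finally show ?thesis .
            qed
            have "norm (\<phi> t - P) \<le> L * norm (B t) \<or> norm (\<phi> t - Q) \<le> L * norm (B t)"
              by (rule \<eta>0(2)[OF t(1)]) (use t(2) \<eta>(2) in simp)
            then have "f y' \<le> ereal ((1 - \<tau>) * ln \<eta>)"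
            proof
              assume "norm (\<phi> t - P) \<le> L * norm (B t)"
              then show ?thesis
                by (intro near[of P CP] P(2) yb ne) (auto simp: t C_def \<rho>_def)
            next
              assume "norm (\<phi> t - Q) \<le> L * norm (B t)"
              then show ?thesis
                by (intro near[of Q CQ] Q(2) yb ne) (auto simp: t C_def \<rho>_def)
            qed
            then have "g y' \<le> (1 - \<tau>) * ln \<eta>"
              using \<tau> ln\<eta> by (intro g(6)[OF yb]) (auto simp: algebra_simps mult_le_0_iff)
            then show "g' (\<phi>' t + y) \<le> (1 - \<tau>) * ln \<eta>"
              unfolding g'_def rot_add y'_def .
          qed
        qed
      qed (use g(2,3) \<delta> \<Omega> B \<eta> \<eta>1 b \<tau> t1 in \<open>auto simp: g'_def\<close>)
      then show ?thesis unfolding smooth_def g'_def rot_add b(3) l_def by simp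
    qed

    \<comment> \<open>Averaging over \<open>\<theta>\<close> recovers the value at \<open>\<phi> t1\<close>.\<close>
    define k where "k = (\<lambda>\<theta> y. g (\<phi> t1 + cmul (cis \<theta>) y) * bump \<delta> y)"
    have [measurable]: "cis \<in> borel_measurable borel"
      by (intro borel_measurable_continuous_onI continuous_intros)
    have mk: "(\<lambda>x. k (fst x) (snd x)) \<in> borel_measurable borel"
      unfolding k_def by measurable
    have bk: "\<bar>k \<theta> y\<bar> \<le> (- ln \<eta>) * indicator (cball 0 \<delta>) y" for \<theta> y
      unfolding k_def by (rule bump_prod_bound) (use gN \<delta> in auto)
    note sw = circ_lborel_swap[OF mk bk]
    interpret prob_space circ by (rule prob_space_circ)
    have "V * g (\<phi> t1) = (LINT y|lborel. g (\<phi> t1) * bump \<delta> (y :: complex \<times> complex))"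
      unfolding V_def by simp
    also have "\<dots> \<le> (LINT y|lborel. LINT \<theta>|circ. k \<theta> y)"
    proof (rule integral_mono[OF _ sw(3)])
      show "integrable lborel (\<lambda>y. g (\<phi> t1) * bump \<delta> (y :: complex \<times> complex))"
        using integrable_bump_prod[of "\<lambda>_. g (\<phi> t1)" "- ln \<eta>" \<delta> 0] gN \<delta> by simp
      fix y :: "complex \<times> complex"
      have eq: "(LINT \<theta>|circ. k \<theta> y) = (LINT \<theta>|circ. g (\<phi> t1 + cmul (cis \<theta>) y)) * bump \<delta> y"
        unfolding k_def by (rule integral_mult_left_zero)
      show "g (\<phi> t1) * bump \<delta> y \<le> (LINT \<theta>|circ. k \<theta> y)"
      proof (cases "norm y < \<delta>")
        case True
        have "g (\<phi> t1) \<le> (LINT \<theta>|circ. g (\<phi> t1 + cmul (cis \<theta>) y))"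
        proof (rule g(4)[unfolded line_submean_def, rule_format])
          fix w :: complex assume "w \<in> cball 0 1"
          then have "norm (cmul w y) \<le> 2 * \<delta>"
            using mult_mono[of "norm w" 1 "norm y" "2 * \<delta>"] True \<delta> by auto
          then have "\<phi> t1 + cmul w y \<in> cball (\<phi> t1) (2 * \<delta>)"
            by (simp only: add_in_cball_iff)
          then show "\<phi> t1 + cmul w y \<in> bidisk" using cb[OF t1(1)] b by auto
        qed
        then show ?thesis unfolding eq using bump_nonneg by (intro mult_right_mono)
      next
        case False
        then show ?thesis unfolding eq using \<delta> by (simp add: bump_eq_0)
      qed
    qed
    also have "\<dots> = (LINT \<theta>|circ. LINT y|lborel. k \<theta> y)" by (rule sw(1)[symmetric])
    also have "\<dots> \<le> (LINT \<theta>|circ. V * ((1 - \<tau>) * (l + \<tau>)))"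
      by (rule integral_mono[OF sw(2)]) (use rot in \<open>auto simp: k_def\<close>)
    also have "\<dots> = V * ((1 - \<tau>) * (l + \<tau>))" by (simp add: prob_space)
    finally have "g (\<phi> t1) \<le> (1 - \<tau>) * (l + \<tau>)" using V by simp
    then show ?thesis using g(5)[OF \<phi>in[OF t1(1)]] by (meson ereal_less_eq(3) order_trans)
  qed
  show ?thesis
  proof (cases "f (\<phi> t1)")
    case (real v)
    have "v \<le> l"
    proof (rule field_le_epsilon)
      fix e :: real assume e: "e > 0"
      define \<tau> where "\<tau> = min (min (1 / 2) (- l / 2)) (e / (1 - l))"
      have \<tau>: "0 < \<tau>" "\<tau> < 1" "\<tau> < - l" "\<tau> \<le> e / (1 - l)" unfolding \<tau>_def using e l by auto
      have "v \<le> (1 - \<tau>) * (l + \<tau>)" using key[OF \<tau>(1-3)] real by simp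
      also have "\<dots> \<le> l + \<tau> * (1 - l)" by (simp add: algebra_simps)
      also have "\<tau> * (1 - l) \<le> e / (1 - l) * (1 - l)" using \<tau> l by (intro mult_right_mono) auto
      also have "e / (1 - l) * (1 - l) = e" using l by simp
      finally show "v \<le> l + e" by simp
    qed
    then show ?thesis using real by (simp add: l_def)
  next
    case PInf
    then show ?thesis using neg[OF \<phi>in[OF t1(1)]] by simp
  qed simp
qed

section \<open>Lower bound from a holomorphic function\<close>

lemma upper_semicontinuous_on_log_abs:
  assumes F: "continuous_on U F"
  shows "upper_semicontinuous_on U (\<lambda>x. log_abs (F x))"
  unfolding upper_semicontinuous_on_def
proof
  fix c :: ereal
  show "openin (top_of_set U) {x \<in> U. log_abs (F x) < c}"
  proof (cases c)
    case (real c')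
    have "log_abs w < ereal c' \<longleftrightarrow> norm w < exp c'" for w
    proof (cases "w = 0")
      case False
      then have "ln (norm w) < c' \<longleftrightarrow> norm w < exp c'"
        by (metis exp_less_cancel_iff exp_ln zero_less_norm_iff)
      then show ?thesis using False by (simp add: log_abs_def)
    qed (simp add: log_abs_def)
    then have "{x \<in> U. log_abs (F x) < c} = U \<inter> (\<lambda>x. norm (F x)) -` {..<exp c'}"
      using real by auto
    also have "openin (top_of_set U) \<dots>"
      by (rule continuous_openin_preimage_gen) (auto intro!: continuous_intros F)
    finally show ?thesis .
  next
    case PInf
    then have "{x \<in> U. log_abs (F x) < c} = U" by (auto simp: log_abs_def)
    then show ?thesis by simp
  qed simp
qed

lemma plurisubharmonic_on_log_abs:
  assumes \<Omega>: "open \<Omega>" and F: "continuous_on \<Omega> F" "\<And>x. x \<in> \<Omega> \<Longrightarrow> norm (F x) \<le> 1"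
    and hol: "\<And>a1 a2 b1 b2. (\<lambda>w. F (a1 + w * b1, a2 + w * b2)) holomorphic_on {w. (a1 + w * b1, a2 + w * b2) \<in> \<Omega>}"
  shows "plurisubharmonic_on \<Omega> (\<lambda>x. log_abs (F x))"
  unfolding plurisubharmonic_on_def
proof (intro conjI allI ballI)
  show "upper_semicontinuous_on \<Omega> (\<lambda>x. log_abs (F x))" by (rule upper_semicontinuous_on_log_abs[OF F(1)])
  show "log_abs (F x) < \<infinity>" for x by (simp add: log_abs_def)
  fix a1 a2 b1 b2
  define U where "U = {w. (a1 + w * b1, a2 + w * b2) \<in> \<Omega>}"
  have U: "open U"
  proof -
    have "U = (\<lambda>w. (a1 + w * b1, a2 + w * b2)) -` \<Omega>" by (auto simp: U_def)
    then show ?thesis using \<Omega> by (auto intro!: open_vimage continuous_intros)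
  qed
  show "subharmonic_on {w. (a1 + w * b1, a2 + w * b2) \<in> \<Omega>} (\<lambda>w. log_abs (F (a1 + w * b1, a2 + w * b2)))"
    unfolding subharmonic_on_def U_def[symmetric]
  proof (intro conjI allI ballI impI)
    show "upper_semicontinuous_on U (\<lambda>w. log_abs (F (a1 + w * b1, a2 + w * b2)))"
      by (rule upper_semicontinuous_on_log_abs) (use hol in \<open>simp add: U_def holomorphic_on_imp_continuous_on\<close>)
    show "log_abs (F (a1 + w * b1, a2 + w * b2)) < \<infinity>" for w by (simp add: log_abs_def)
    show "log_abs (F (a1 + a * b1, a2 + a * b2)) \<le> circle_mean (\<lambda>w. log_abs (F (a1 + w * b1, a2 + w * b2))) a r"
      if "0 < r" "cball a r \<subseteq> U" for a r
      by (rule log_abs_submean[OF _ U that(2,1)]) (use hol F(2) in \<open>auto simp: U_def\<close>)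
  qed
qed

lemma has_log_pole_log_abs:
  assumes F: "F differentiable (at P)" "F P = 0"
  shows "has_log_pole \<Omega> (\<lambda>x. log_abs (F x)) P"
proof -
  obtain D where "(F has_derivative D) (at P)" using F(1) unfolding differentiable_def by blast
  then obtain d where D: "bounded_linear D" and d: "d > 0"
    "\<And>y. norm (y - P) < d \<Longrightarrow> norm (F y - F P - D (y - P)) \<le> 1 * norm (y - P)"
    unfolding has_derivative_at_alt using zero_less_one by blast
  obtain K where K: "K > 0" "\<And>h. norm (D h) \<le> norm h * K"
    using bounded_linear.pos_bounded[OF D] by blast
  have b: "log_abs (F y) - ereal (ln (norm (y - P))) \<le> ereal (ln (1 + K))" if y: "y \<noteq> P" "dist y P < d" for y
  proof (cases "F y = 0")
    case False
    have "norm (F y) \<le> norm (F y - F P - D (y - P)) + norm (D (y - P))"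
      using norm_triangle_ineq[of "F y - F P - D (y - P)" "D (y - P)"] F(2) by simp
    also have "\<dots> \<le> (1 + K) * norm (y - P)"
      using d(2)[of y] K(2)[of "y - P"] y by (simp add: dist_norm algebra_simps)
    finally have "ln (norm (F y)) \<le> ln ((1 + K) * norm (y - P))"
      using False y K by (subst ln_le_cancel_iff) auto
    also have "\<dots> = ln (1 + K) + ln (norm (y - P))" using K y by (subst ln_mult) auto
    finally show ?thesis using False by (simp add: log_abs_def)
  qed (simp add: log_abs_def)
  show ?thesis
    unfolding has_log_pole_def eventually_at using d(1) b by blast
qed

section \<open>The rational inner function and its extremal discs\<close>

lemma Re_cayley_pos:
  assumes "norm y < 1"
  shows "0 < Re ((1 + y) / (1 - y))"
proof -
  have "(Re y)\<^sup>2 + (Im y)\<^sup>2 < 1"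
    using power_strict_mono[OF assms norm_ge_zero, of 2] by (simp add: cmod_power2)
  moreover have "y \<noteq> 1" using assms by auto
  then have "0 < (1 - Re y)\<^sup>2 + (Im y)\<^sup>2" 
    by (auto simp: complex_eq_iff sum_power2_gt_zero_iff)
  ultimately show ?thesis
    by (simp add: Re_divide power2_eq_square algebra_simps)
qed

lemma norm_cayley_inv_less_1:
  assumes "0 < Re H"
  shows "norm ((H - 1) / (H + 1)) < 1"
proof -
  have "(norm (H - 1))\<^sup>2 < (norm (H + 1))\<^sup>2"
    using assms unfolding cmod_power2 by (simp add: power2_eq_square algebra_simps)
  then have "norm (H - 1) < norm (H + 1)" by (rule power2_less_imp_less) simp
  moreover from this have "H + 1 \<noteq> 0" by auto
  ultimately show ?thesis by (simp add: norm_divide)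
qed

lemma cayley_inv_cayley:
  fixes y :: complex
  assumes "y \<noteq> 1"
  shows "((1 + y) / (1 - y) - 1) / ((1 + y) / (1 - y) + 1) = y"
proof -
  have "1 - y \<noteq> 0" using assms by simp
  then have "(1 + y) / (1 - y) - 1 = 2 * y / (1 - y)" "(1 + y) / (1 - y) + 1 = 2 / (1 - y)"
    by (simp_all add: field_simps)
  then show ?thesis using \<open>1 - y \<noteq> 0\<close> by simp
qed

lemma cayley_inv_diff:
  assumes "0 < Re H" "0 < Re H'"
  shows "norm ((H - 1) / (H + 1) - (H' - 1) / (H' + 1)) \<le> 2 * norm (H - H')"
proof -
  have n: "1 \<le> norm (G + 1)" if "0 < Re G" for G :: complex
    using complex_Re_le_cmod[of "G + 1"] that by simp
  have nz: "H + 1 \<noteq> 0" "H' + 1 \<noteq> 0" using n[OF assms(1)] n[OF assms(2)] by auto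
  have "(H - 1) / (H + 1) - (H' - 1) / (H' + 1) = 2 * (H - H') / ((H + 1) * (H' + 1))"
    using nz by (simp add: field_simps)
  then have "norm ((H - 1) / (H + 1) - (H' - 1) / (H' + 1)) = 2 * norm (H - H') / (norm (H + 1) * norm (H' + 1))"
    by (simp only: norm_divide norm_mult norm_numeral)
  also have "\<dots> \<le> 2 * norm (H - H') / 1"
    using mult_mono[OF n[OF assms(1)] n[OF assms(2)]] by (intro divide_left_mono) auto
  finally show ?thesis by simp
qed

text \<open>Numerator and denominator of a rational inner function of the bidisk that vanishes at \<open>(p, 0)\<close> and
  \<open>(0, q)\<close>.\<close>

definition inner_num :: "real \<Rightarrow> real \<Rightarrow> complex \<Rightarrow> complex \<Rightarrow> complex" where
  "inner_num p q y1 y2 = p*q*y1*y2 - p*y1*y2 - q*y1*y2 - p*q + p*y2 + q*y1"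

definition inner_den :: "real \<Rightarrow> real \<Rightarrow> complex \<Rightarrow> complex \<Rightarrow> complex" where
  "inner_den p q y1 y2 = p*q*y1*y2 - p*q - p*y1 - q*y2 + p + q"

text \<open>The inner function in half-plane coordinates, scaled to have the value \<open>1\<close> at the two poles
  \<open>((1 + p) / (1 - p), 1)\<close> and \<open>(1, (1 + q) / (1 - q))\<close>.\<close>

definition inner_cayley :: "real \<Rightarrow> real \<Rightarrow> complex \<Rightarrow> complex \<Rightarrow> complex" where
  "inner_cayley p q h1 h2 =
    (complex_of_real (p * (1 - q)) * h2 + complex_of_real (q * (1 - p)) * h1) / complex_of_real (p + q)"

lemma inner_quotient_cayley:
  fixes y1 y2 :: complex
  assumes pq: "p + q \<noteq> 0" and y: "y1 \<noteq> 1" "y2 \<noteq> 1"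
  defines "W \<equiv> inner_cayley p q ((1 + y1) / (1 - y1)) ((1 + y2) / (1 - y2))"
  shows "inner_num p q y1 y2 / inner_den p q y1 y2 = (W - 1) / (W + 1)"
    "W + 1 \<noteq> 0 \<Longrightarrow> inner_den p q y1 y2 \<noteq> 0"
proof -
  define k where "k = (1 - y1) * (1 - y2) * complex_of_real (p + q) / 2"
  have nz: "1 - y1 \<noteq> 0" "1 - y2 \<noteq> 0" "complex_of_real (p + q) \<noteq> 0"
    using pq y by (simp_all del: of_real_add)
  have k: "k \<noteq> 0" unfolding k_def using nz by simp
  have clear: "u * v * S / 2 * ((a * (c / v) + b * (d / u)) / S) = (a * (c * u) + b * (d * v)) / 2"
    if "u \<noteq> 0" "v \<noteq> 0" "S \<noteq> 0" for a b c d u v S :: complex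
    using that by (simp add: field_simps)
  have kW: "k * W = (complex_of_real (p * (1 - q)) * ((1 + y2) * (1 - y1)) + complex_of_real (q * (1 - p)) * ((1 + y1) * (1 - y2))) / 2"
    unfolding k_def W_def inner_cayley_def by (rule clear[OF nz])
  have num: "inner_num p q y1 y2 = k * W - k" and den: "inner_den p q y1 y2 = k * W + k"
    unfolding kW unfolding k_def inner_num_def inner_den_def by (simp_all add: field_simps)
  have num': "inner_num p q y1 y2 = k * (W - 1)" and den': "inner_den p q y1 y2 = k * (W + 1)"
    unfolding num den by (simp_all add: algebra_simps)
  show "inner_num p q y1 y2 / inner_den p q y1 y2 = (W - 1) / (W + 1)"
    unfolding num' den' by (rule mult_divide_mult_cancel_left[OF k])
  show "W + 1 \<noteq> 0 \<Longrightarrow> inner_den p q y1 y2 \<noteq> 0"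
    unfolding den' using k by simp
qed

text \<open>The coefficients of \<open>h1\<close> and \<open>h2\<close> in \<open>inner_cayley\<close> are positive because \<open>p\<close> and \<open>q\<close> have the same sign,
  so that \<open>Re W > 0\<close>.\<close>

lemma inner_bound:
  fixes y1 y2 :: complex
  assumes "0 < p * q" "p < 1" "q < 1" "norm y1 < 1" "norm y2 < 1"
  shows "inner_den p q y1 y2 \<noteq> 0" "norm (inner_num p q y1 y2 / inner_den p q y1 y2) < 1"
proof -
  have pq: "p + q \<noteq> 0" "0 < p / (p + q)" "0 < q / (p + q)"
    using assms(1) by (auto simp: zero_less_mult_iff divide_neg_neg)
  define W where "W = inner_cayley p q ((1 + y1) / (1 - y1)) ((1 + y2) / (1 - y2))"
  have "W = complex_of_real (p / (p + q) * (1 - q)) * ((1 + y2) / (1 - y2)) + complex_of_real (q / (p + q) * (1 - p)) * ((1 + y1) / (1 - y1))"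
    unfolding W_def inner_cayley_def by (simp add: add_divide_distrib)
  moreover have "Re (complex_of_real a * z) = a * Re z" for a z by simp
  ultimately have "Re W = p / (p + q) * (1 - q) * Re ((1 + y2) / (1 - y2)) + q / (p + q) * (1 - p) * Re ((1 + y1) / (1 - y1))"
    by (simp only: plus_complex.sel)
  moreover have "0 < p / (p + q) * (1 - q) * Re ((1 + y2) / (1 - y2))" "0 < q / (p + q) * (1 - p) * Re ((1 + y1) / (1 - y1))"
    by (intro mult_pos_pos pq(2,3) Re_cayley_pos; use assms in simp)+
  ultimately have "0 < Re W" by simp
  then have W: "norm ((W - 1) / (W + 1)) < 1" "W + 1 \<noteq> 0"
    using norm_cayley_inv_less_1 by (auto simp: complex_eq_iff)
  have y: "y1 \<noteq> 1" "y2 \<noteq> 1" using assms by auto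
  note quot = inner_quotient_cayley[OF pq(1) y, folded W_def]
  show "inner_den p q y1 y2 \<noteq> 0" by (rule quot(2)[OF W(2)])
  show "norm (inner_num p q y1 y2 / inner_den p q y1 y2) < 1" unfolding quot(1) by (rule W(1))
qed

text \<open>The parameter \<open>s\<close> of the disc runs over the right half-plane, and \<open>H1, H2\<close> are its half-plane
  coordinates.  The four coefficients are determined by the requirement that the disc meets the first
  pole at \<open>s = 1\<close> and the second one at \<open>s = \<sigma>\<close> (\<open>l_sum\<close>, \<open>k_sum\<close>); \<open>m\<close> is the point of the unit disc that
  corresponds to \<open>\<sigma>\<close>, and \<open>\<bar>p\<bar>, \<bar>q\<bar> < m\<close> makes the coefficients positive.\<close>

locale extremal_disc =
  fixes p q m e :: real
  assumes p: "\<bar>p\<bar> < m" and q: "\<bar>q\<bar> < m" and m1: "m < 1" and pq: "0 < p * q" and e: "e = 1 \<or> e = - 1"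
begin

definition l1 where "l1 = (m - p) * (1 - m) / (2 * m * (1 - p))"
definition l2 where "l2 = (m + p) * (1 + m) / (2 * m * (1 - p))"
definition k1 where "k1 = (m + q) * (1 - m) / (2 * m * (1 - q))"
definition k2 where "k2 = (m - q) * (1 + m) / (2 * m * (1 - q))"
definition \<sigma> where "\<sigma> = (1 + m) / (1 - m)"
definition H1 :: "complex \<Rightarrow> complex" where "H1 s = complex_of_real l1 * s + complex_of_real l2 / s"
definition H2 :: "complex \<Rightarrow> complex" where "H2 s = complex_of_real k1 * s + complex_of_real k2 / s"
definition disc :: "complex \<Rightarrow> complex \<times> complex" where
  "disc s = (complex_of_real e * ((H1 s - 1) / (H1 s + 1)), complex_of_real e * ((H2 s - 1) / (H2 s + 1)))"
definition blaschke :: "complex \<Rightarrow> complex" where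
  "blaschke s = (s - 1) * (s - complex_of_real \<sigma>) / ((s + 1) * (s + complex_of_real \<sigma>))"
definition extremal :: "complex \<times> complex \<Rightarrow> complex" where
  "extremal x = inner_num p q (complex_of_real e * fst x) (complex_of_real e * snd x) /
    inner_den p q (complex_of_real e * fst x) (complex_of_real e * snd x)"

lemma m0: "0 < m" using p by simp
lemma p1: "p < 1" "- 1 < p" "q < 1" "- 1 < q" using p q m1 by auto
lemma coeff_pos: "0 < l1" "0 < l2" "0 < k1" "0 < k2"
  unfolding l1_def l2_def k1_def k2_def using p q m0 m1 p1 by (auto intro!: divide_pos_pos mult_pos_pos)
lemma \<sigma>1: "1 < \<sigma>" unfolding \<sigma>_def using m0 m1 by simp
lemma ee: "complex_of_real e * complex_of_real e = 1" "\<bar>e\<bar> = 1" using e by auto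
lemma ee': "complex_of_real e * (complex_of_real e * z) = z"
  using ee(1) by (simp add: mult.assoc[symmetric])
lemma pq_sum: "p + q \<noteq> 0" using pq by (auto simp: zero_less_mult_iff)

lemma l_sum: "l1 + l2 = (1 + p) / (1 - p)" "l1 * \<sigma> + l2 / \<sigma> = 1"
  and k_sum: "k1 + k2 = 1" "k1 * \<sigma> + k2 / \<sigma> = (1 + q) / (1 - q)"
proof -
  have nz: "m \<noteq> 0" "1 - p \<noteq> 0" "1 - q \<noteq> 0" "1 - m \<noteq> 0" "1 + m \<noteq> 0" using m0 m1 p1 by auto
  show "l1 + l2 = (1 + p) / (1 - p)" "k1 + k2 = 1"
    unfolding l1_def l2_def k1_def k2_def using nz by (simp_all add: divide_simps) (simp_all add: algebra_simps)
  have s: "l1 * \<sigma> = (m - p) * (1 + m) / (2 * m * (1 - p))" "l2 / \<sigma> = (m + p) * (1 - m) / (2 * m * (1 - p))"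
    "k1 * \<sigma> = (m + q) * (1 + m) / (2 * m * (1 - q))" "k2 / \<sigma> = (m - q) * (1 - m) / (2 * m * (1 - q))"
    unfolding l1_def l2_def k1_def k2_def \<sigma>_def using nz by simp_all
  show "l1 * \<sigma> + l2 / \<sigma> = 1" "k1 * \<sigma> + k2 / \<sigma> = (1 + q) / (1 - q)"
    unfolding s using nz by (simp_all add: divide_simps) (simp_all add: algebra_simps)
qed

lemma Re_lin:
  assumes "s \<noteq> 0"
  shows "Re (complex_of_real a * s + complex_of_real b / s) = Re s * (a + b / (norm s)\<^sup>2)"
proof -
  have "0 < (Re s)\<^sup>2 + (Im s)\<^sup>2" using assms by (simp add: sum_power2_gt_zero_iff complex_eq_iff)
  then show ?thesis
    unfolding cmod_power2 by (simp add: Re_divide field_simps)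
qed

lemma Re_lin_pos_iff:
  assumes "s \<noteq> 0" "0 < a" "0 < b"
  shows "0 < Re (complex_of_real a * s + complex_of_real b / s) \<longleftrightarrow> 0 < Re s"
proof -
  have "0 < a + b / (norm s)\<^sup>2" using assms by (simp add: add_pos_pos)
  then show ?thesis unfolding Re_lin[OF assms(1)] by (simp add: zero_less_mult_iff)
qed

lemma Re_H: "0 < Re s \<Longrightarrow> 0 < Re (H1 s)" "0 < Re s \<Longrightarrow> 0 < Re (H2 s)"
proof -
  assume s: "0 < Re s"
  then have "s \<noteq> 0" by auto
  then show "0 < Re (H1 s)" "0 < Re (H2 s)"
    unfolding H1_def H2_def
    using s Re_lin_pos_iff[OF \<open>s \<noteq> 0\<close> coeff_pos(1,2)] Re_lin_pos_iff[OF \<open>s \<noteq> 0\<close> coeff_pos(3,4)] by blast+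
qed

lemma norm_e_mult: "norm (complex_of_real e * w) = norm w"
  using ee(2) by (simp add: norm_mult)

lemma disc_in: "0 < Re s \<Longrightarrow> disc s \<in> bidisk"
  using norm_cayley_inv_less_1[OF Re_H(1)] norm_cayley_inv_less_1[OF Re_H(2)]
  by (simp only: disc_def mem_Times_iff fst_conv snd_conv mem_ball_0 norm_e_mult)

lemma H_nz: "0 < Re s \<Longrightarrow> H1 s + 1 \<noteq> 0" "0 < Re s \<Longrightarrow> H2 s + 1 \<noteq> 0" "0 < Re s \<Longrightarrow> s \<noteq> 0"
  using Re_H[of s] by (auto simp: complex_eq_iff simp del: Re_divide)

lemma disc_holomorphic:
  "(\<lambda>s. fst (disc s)) holomorphic_on {s. 0 < Re s}" "(\<lambda>s. snd (disc s)) holomorphic_on {s. 0 < Re s}"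
proof -
  have h: "H1 holomorphic_on {s. 0 < Re s}" "H2 holomorphic_on {s. 0 < Re s}"
    unfolding H1_def H2_def by (auto intro!: holomorphic_intros)
  show "(\<lambda>s. fst (disc s)) holomorphic_on {s. 0 < Re s}" "(\<lambda>s. snd (disc s)) holomorphic_on {s. 0 < Re s}"
    unfolding disc_def using H_nz by (auto intro!: holomorphic_intros h)
qed

lemma blaschke_den_nz: "0 \<le> Re s \<Longrightarrow> (s + 1) * (s + \<sigma>) \<noteq> 0"
proof -
  assume "0 \<le> Re s"
  then have "s + 1 \<noteq> 0" "s + \<sigma> \<noteq> 0" using \<sigma>1 by (auto simp: complex_eq_iff)
  then show ?thesis by simp
qed

lemma blaschke_holomorphic: "blaschke holomorphic_on {s. 0 < Re s}"
  unfolding blaschke_def using blaschke_den_nz by (intro holomorphic_intros) (auto simp: less_imp_le)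

text \<open>On the disc, \<open>W\<close> equals \<open>(1 - m) / 2 * s + (1 + m) / 2 / s\<close>.  As \<open>W = 1\<close> at both poles, \<open>W - 1\<close> has
  the zeros \<open>1\<close> and \<open>\<sigma>\<close>, and \<open>W + 1\<close> has the zeros \<open>- 1\<close> and \<open>- \<sigma>\<close>.\<close>

lemma extremal_disc_eq:
  assumes s: "0 < Re s"
  shows "extremal (disc s) = blaschke s"
proof -
  note nz = H_nz[OF s]
  define y1 y2 where "y1 = (H1 s - 1) / (H1 s + 1)" and "y2 = (H2 s - 1) / (H2 s + 1)"
  have y: "y1 \<noteq> 1" "y2 \<noteq> 1" using norm_cayley_inv_less_1[OF Re_H(1)[OF s]] norm_cayley_inv_less_1[OF Re_H(2)[OF s]]
    unfolding y1_def y2_def by auto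
  have c: "(1 + y1) / (1 - y1) = H1 s" "(1 + y2) / (1 - y2) = H2 s"
    unfolding y1_def y2_def using nz by (simp_all add: divide_simps)
  have W: "inner_cayley p q (H1 s) (H2 s) = complex_of_real ((1 - m) / 2) * s + complex_of_real ((1 + m) / 2) / s"
  proof -
    have "p * (1 - q) * k1 + q * (1 - p) * l1 = (1 - m) / 2 * (p + q)"
      "p * (1 - q) * k2 + q * (1 - p) * l2 = (1 + m) / 2 * (p + q)"
      unfolding k1_def k2_def l1_def l2_def using m0 p1 by (simp_all add: divide_simps) (simp_all add: algebra_simps)
    then have "complex_of_real (p * (1 - q) * k1 + q * (1 - p) * l1) = complex_of_real ((1 - m) / 2 * (p + q))"
      "complex_of_real (p * (1 - q) * k2 + q * (1 - p) * l2) = complex_of_real ((1 + m) / 2 * (p + q))" by (simp_all only:)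
    moreover have "complex_of_real (p * (1 - q)) * H2 s + complex_of_real (q * (1 - p)) * H1 s =
      complex_of_real (p * (1 - q) * k1 + q * (1 - p) * l1) * s + complex_of_real (p * (1 - q) * k2 + q * (1 - p) * l2) / s"
    proof -
      have lin: "c * (a * s + b / s) + c' * (a' * s + b' / s) = (c * a + c' * a') * s + (c * b + c' * b') / s" for a b a' b' c c' :: complex
        by (simp add: add_divide_distrib algebra_simps)
      show ?thesis
        unfolding H1_def H2_def of_real_add of_real_mult[of "p * (1 - q)"] of_real_mult[of "q * (1 - p)"] by (rule lin)
    qed
    moreover have "a * S * s + b * S / s = (a * s + b / s) * S" for a b S :: complex
      by (simp add: algebra_simps)
    ultimately have "complex_of_real (p * (1 - q)) * H2 s + complex_of_real (q * (1 - p)) * H1 s =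
        (complex_of_real ((1 - m) / 2) * s + complex_of_real ((1 + m) / 2) / s) * complex_of_real (p + q)"
      by (simp only: of_real_mult[of _ "p + q"])
    moreover have "complex_of_real (p + q) \<noteq> 0" using pq_sum by (simp del: of_real_add)
    ultimately show ?thesis unfolding inner_cayley_def by simp
  qed
  define w where "w = complex_of_real ((1 - m) / 2) * s + complex_of_real ((1 + m) / 2) / s"
  have "extremal (disc s) = (w - 1) / (w + 1)"
    unfolding extremal_def disc_def fst_conv snd_conv ee' y1_def[symmetric] y2_def[symmetric]
    unfolding inner_quotient_cayley(1)[OF pq_sum y] c W w_def[symmetric] ..
  also have "\<dots> = blaschke s"
  proof -
    have nz': "complex_of_real (1 - m) \<noteq> 0" using m1 by (simp del: of_real_diff)
    define k where "k = complex_of_real (1 - m) / (2 * s)"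
    have k: "k \<noteq> 0" unfolding k_def using nz(3) nz' by simp
    have \<sigma>m: "complex_of_real \<sigma> * complex_of_real (1 - m) = complex_of_real (1 + m)"
      unfolding \<sigma>_def of_real_mult[symmetric] using m1 by simp
    have gen: "a / 2 * s + b / 2 / s - c = a / (2 * s) * ((s - 1) * (s - \<Sigma>))"
      "a / 2 * s + b / 2 / s + c = a / (2 * s) * ((s + 1) * (s + \<Sigma>))"
      if "\<Sigma> * a = b" "a + b = 2 * c" for a b c \<Sigma> :: complex
    proof -
      have b: "b = \<Sigma> * a" and c: "c = (a + \<Sigma> * a) / 2" using that by auto
      show "a / 2 * s + b / 2 / s - c = a / (2 * s) * ((s - 1) * (s - \<Sigma>))"
        "a / 2 * s + b / 2 / s + c = a / (2 * s) * ((s + 1) * (s + \<Sigma>))"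
        unfolding b c using nz(3) by (simp_all add: field_simps)
    qed
    have "w - 1 = k * ((s - 1) * (s - \<sigma>))" "w + 1 = k * ((s + 1) * (s + \<sigma>))"
      unfolding w_def k_def using gen[OF \<sigma>m, of 1] by simp_all
    then show ?thesis unfolding blaschke_def using k by simp
  qed
  finally show ?thesis .
qed

text \<open>Each factor has modulus 1 on the imaginary axis, and \<open>blaschke s\<close> tends to 1 at infinity.\<close>

lemma blaschke_sublevel_compact:
  assumes b: "b < 1"
  shows "compact {s \<in> {s. 0 < Re s}. norm (blaschke s) \<le> b}"
proof -
  have nd: "norm (blaschke s) \<le> b \<longleftrightarrow> norm ((s - 1) * (s - \<sigma>)) \<le> b * norm ((s + 1) * (s + \<sigma>))" if "0 \<le> Re s" for s
  proof -
    have "0 < norm ((s + 1) * (s + \<sigma>))" using blaschke_den_nz[OF that] by (simp only: zero_less_norm_iff not_False_eq_True)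
    then show ?thesis unfolding blaschke_def norm_divide by (rule pos_divide_le_eq)
  qed
  have axis: "0 < Re s" if "0 \<le> Re s" "norm (blaschke s) \<le> b" for s
  proof (rule ccontr)
    assume "\<not> 0 < Re s"
    then have "Re s = 0" using that by simp
    then have "norm (s - 1) = norm (s + 1)" "norm (s - \<sigma>) = norm (s + \<sigma>)" by (simp_all add: cmod_def)
    then have "norm (blaschke s) = 1"
      unfolding blaschke_def norm_divide norm_mult using blaschke_den_nz[OF that(1)] by simp
    then show False using that b by simp
  qed
  then have eq: "{s \<in> {s. 0 < Re s}. norm (blaschke s) \<le> b} =
      {s. 0 \<le> Re s} \<inter> {s :: complex. norm ((s - 1) * (s - \<sigma>)) \<le> b * norm ((s + 1) * (s + \<sigma>))}"
    using nd by (auto simp: less_imp_le)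
  have "closed {s. 0 \<le> Re s}" "closed {s :: complex. norm ((s - 1) * (s - \<sigma>)) \<le> b * norm ((s + 1) * (s + \<sigma>))}"
    by (intro closed_Collect_le continuous_intros)+
  then have cl: "closed {s \<in> {s. 0 < Re s}. norm (blaschke s) \<le> b}" unfolding eq by (rule closed_Int)
  have bd: "norm s \<le> 2 * (1 + \<sigma>) / (1 - b)" if s: "0 < Re s" "norm (blaschke s) \<le> b" for s
  proof -
    define x where "x = norm s"
    have x: "x > 0" unfolding x_def using s by auto
    have b0: "0 \<le> b" using s(2) norm_ge_zero order_trans by blast
    have "\<bar>x - 1\<bar> \<le> norm (s - 1)" using norm_triangle_ineq3[of s 1] by (simp add: x_def)
    moreover have "\<bar>x - \<sigma>\<bar> \<le> norm (s - \<sigma>)"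
      using norm_triangle_ineq3[of s "complex_of_real \<sigma>"] \<sigma>1 by (simp add: x_def)
    ultimately have "(x - 1) * (x - \<sigma>) \<le> norm ((s - 1) * (s - \<sigma>))"
      unfolding norm_mult using mult_mono[of "\<bar>x - 1\<bar>" _ "\<bar>x - \<sigma>\<bar>"] abs_ge_self[of "(x - 1) * (x - \<sigma>)"]
      by (fastforce simp: abs_mult intro: order_trans)
    also have "\<dots> \<le> b * norm ((s + 1) * (s + \<sigma>))" using nd s by (simp add: less_imp_le)
    also have "\<dots> \<le> b * ((x + 1) * (x + \<sigma>))"
    proof -
      have "norm (s + 1) \<le> x + 1" "norm (s + \<sigma>) \<le> x + \<sigma>"
        unfolding x_def using norm_triangle_ineq[of s 1] norm_triangle_ineq[of s "complex_of_real \<sigma>"] \<sigma>1 by auto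
      then show ?thesis unfolding norm_mult using b0 x by (intro mult_left_mono mult_mono) auto
    qed
    finally have "(1 - b) * x * x \<le> (1 + b) * (1 + \<sigma>) * x - (1 - b) * \<sigma>"
      by (simp add: algebra_simps)
    also have "\<dots> \<le> (1 + b) * (1 + \<sigma>) * x" using b \<sigma>1 by simp
    finally have "(1 - b) * x \<le> (1 + b) * (1 + \<sigma>)" using x by simp
    also have "\<dots> \<le> 2 * (1 + \<sigma>)" using b \<sigma>1 by (intro mult_right_mono) auto
    finally show ?thesis unfolding x_def[symmetric] using b by (simp add: pos_le_divide_eq mult.commute)
  qed
  then have "bounded {s \<in> {s. 0 < Re s}. norm (blaschke s) \<le> b}"
    unfolding bounded_iff by blast
  with cl show ?thesis by (simp add: compact_eq_bounded_closed)
qed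

lemma H_diff:
  assumes s: "0 < Re s" and t: "t > 0" and ab: "0 < a" "0 < b"
  shows "norm ((complex_of_real a * s + complex_of_real b / s) - (complex_of_real a * complex_of_real t + complex_of_real b / complex_of_real t))
    \<le> norm (s - complex_of_real t) * (a + b / (norm s * t))"
proof -
  have nz: "s \<noteq> 0" "complex_of_real t \<noteq> 0" using s t by auto
  have "(complex_of_real a * s + complex_of_real b / s) - (complex_of_real a * complex_of_real t + complex_of_real b / complex_of_real t)
     = (s - complex_of_real t) * (complex_of_real a - complex_of_real b / (s * complex_of_real t))"
    using nz by (simp add: field_simps)
  moreover have "norm (complex_of_real a - complex_of_real b / (s * complex_of_real t)) \<le> a + b / (norm s * t)"
    using norm_triangle_ineq4[of "complex_of_real a" "complex_of_real b / (s * complex_of_real t)"] ab t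
    by (simp add: norm_divide norm_mult)
  ultimately show ?thesis by (simp only: norm_mult) (intro mult_left_mono, auto)
qed

lemma disc_lipschitz:
  assumes s: "0 < Re s" and t: "1 \<le> t"
  shows "norm (disc s - disc (complex_of_real t)) \<le> 2 * (l1 + l2 + k1 + k2) * (1 + 1 / norm s) * norm (s - complex_of_real t)"
proof -
  have t': "0 < Re (complex_of_real t)" "0 < t" using t by auto
  have sn: "0 < norm s" using s by auto
  have le: "a + b / (norm s * t) \<le> (a + b) * (1 + 1 / norm s)" if "0 < a" "0 < b" for a b
  proof -
    have "b / (norm s * t) \<le> b / norm s" using t that sn by (intro divide_left_mono) (auto simp: mult_le_cancel_left1)
    moreover have "0 \<le> a / norm s" using that sn by simp
    moreover have "(a + b) * (1 + 1 / norm s) = a + b + a / norm s + b / norm s"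
      by (simp add: algebra_simps add_divide_distrib)
    ultimately show ?thesis using that by linarith
  qed
  have 1: "norm (H1 s - H1 t) \<le> norm (s - t) * ((l1 + l2) * (1 + 1 / norm s))"
    unfolding H1_def using H_diff[OF s t'(2) coeff_pos(1,2)] le[OF coeff_pos(1,2)]
    by (meson mult_left_mono norm_ge_zero order_trans)
  have 2: "norm (H2 s - H2 t) \<le> norm (s - t) * ((k1 + k2) * (1 + 1 / norm s))"
    unfolding H2_def using H_diff[OF s t'(2) coeff_pos(3,4)] le[OF coeff_pos(3,4)]
    by (meson mult_left_mono norm_ge_zero order_trans)
  have "norm (disc s - disc (complex_of_real t)) \<le> norm (fst (disc s - disc (complex_of_real t))) + norm (snd (disc s - disc (complex_of_real t)))"
    using norm_Pair_le[of "fst (disc s - disc (complex_of_real t))" "snd (disc s - disc (complex_of_real t))"]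
    by (simp only: prod.collapse)
  also have "\<dots> = norm ((H1 s - 1) / (H1 s + 1) - (H1 t - 1) / (H1 t + 1)) + norm ((H2 s - 1) / (H2 s + 1) - (H2 t - 1) / (H2 t + 1))"
    by (simp only: disc_def fst_diff snd_diff fst_conv snd_conv right_diff_distrib[symmetric] norm_e_mult)
  also have "\<dots> \<le> 2 * norm (H1 s - H1 t) + 2 * norm (H2 s - H2 t)"
    using cayley_inv_diff[OF Re_H(1)[OF s] Re_H(1)[OF t'(1)]] cayley_inv_diff[OF Re_H(2)[OF s] Re_H(2)[OF t'(1)]] by (rule add_mono)
  also have "\<dots> \<le> 2 * (norm (s - t) * ((l1 + l2) * (1 + 1 / norm s))) + 2 * (norm (s - t) * ((k1 + k2) * (1 + 1 / norm s)))"
    using 1 2 by linarith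
  also have "\<dots> = 2 * (l1 + l2 + k1 + k2) * (1 + 1 / norm s) * norm (s - complex_of_real t)"
    by (simp add: algebra_simps)
  finally show ?thesis .
qed

lemma disc_poles: "disc 1 = (complex_of_real (e * p), 0)" "disc (complex_of_real \<sigma>) = (0, complex_of_real (e * q))"
proof -
  have "H1 1 = complex_of_real (l1 + l2)" "H2 1 = complex_of_real (k1 + k2)"
    "H1 \<sigma> = complex_of_real (l1 * \<sigma> + l2 / \<sigma>)" "H2 \<sigma> = complex_of_real (k1 * \<sigma> + k2 / \<sigma>)"
    unfolding H1_def H2_def by simp_all
  then have H: "H1 1 = (1 + complex_of_real p) / (1 - complex_of_real p)" "H2 1 = 1" "H1 \<sigma> = 1" "H2 \<sigma> = (1 + complex_of_real q) / (1 - complex_of_real q)"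
    unfolding l_sum k_sum by simp_all
  have ne: "complex_of_real p \<noteq> 1" "complex_of_real q \<noteq> 1" using p1 by auto
  show "disc 1 = (complex_of_real (e * p), 0)" "disc (complex_of_real \<sigma>) = (0, complex_of_real (e * q))"
    unfolding disc_def H cayley_inv_cayley[OF ne(1)] cayley_inv_cayley[OF ne(2)] by simp_all
qed

text \<open>On \<open>\<bar>blaschke s\<bar> \<le> 1 / 2\<close> the parameter \<open>s\<close> stays in a compact part of the half-plane, and its distance from
  one of the two zeros is at least \<open>(\<sigma> - 1) / 2\<close>.  Hence its distance from the other zero is at most a
  multiple of \<open>\<bar>blaschke s\<bar>\<close>.\<close>

lemma disc_near_poles:
  "\<exists>L. \<forall>s. 0 < Re s \<and> norm (blaschke s) \<le> 1 / 2 \<longrightarrow>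
     norm (disc s - disc 1) \<le> L * norm (blaschke s) \<or> norm (disc s - disc \<sigma>) \<le> L * norm (blaschke s)"
proof -
  define K where "K = {s \<in> {s. 0 < Re s}. norm (blaschke s) \<le> 1 / 2}"
  have K: "compact K" unfolding K_def by (rule blaschke_sublevel_compact) simp
  have bounded: "\<exists>M. \<forall>s\<in>K. f s \<le> M" if cont: "continuous_on K f" for f :: "complex \<Rightarrow> real"
  proof -
    obtain M where "\<forall>x\<in>f ` K. norm x \<le> M"
      using compact_imp_bounded[OF compact_continuous_image[OF cont K]] unfolding bounded_iff by blast
    then show ?thesis by (intro exI[of _ M]) (auto intro: abs_le_D1)
  qed
  have c1: "continuous_on K (\<lambda>s. norm ((s + 1) * (s + \<sigma>)))" and c2: "continuous_on K (\<lambda>s. 1 + 1 / norm s)"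
    by (auto intro!: continuous_intros simp: K_def)
  obtain M1 where M1: "\<And>s. s \<in> K \<Longrightarrow> norm ((s + 1) * (s + \<sigma>)) \<le> M1" using bounded[OF c1] by blast
  obtain M2 where M2: "\<And>s. s \<in> K \<Longrightarrow> 1 + 1 / norm s \<le> M2" using bounded[OF c2] by blast
  note M = M1 M2
  define c where "c = 2 * (l1 + l2 + k1 + k2)"
  have c: "c > 0" unfolding c_def using coeff_pos by simp
  define h where "h = (\<sigma> - 1) / 2"
  have h: "h > 0" unfolding h_def using \<sigma>1 by simp
  show ?thesis
  proof (intro exI[of _ "c * M2 * (M1 / h)"] allI impI)
    fix s assume s: "0 < Re s \<and> norm (blaschke s) \<le> 1 / 2"
    then have sK: "s \<in> K" unfolding K_def by simp
    have M2: "0 \<le> M2" using M(2)[OF sK] by (smt (verit) norm_ge_zero divide_nonneg_nonneg)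
    have M1: "0 \<le> M1" using M(1)[OF sK] norm_ge_zero order_trans by blast
    have prod: "norm (s - 1) * norm (s - \<sigma>) \<le> M1 * norm (blaschke s)"
    proof -
      have "norm (s - 1) * norm (s - \<sigma>) = norm ((s + 1) * (s + \<sigma>)) * norm (blaschke s)"
        unfolding blaschke_def norm_divide norm_mult[of "s - 1", symmetric] using blaschke_den_nz[of s] s by simp
      also have "\<dots> \<le> M1 * norm (blaschke s)" using M(1)[OF sK] by (intro mult_right_mono) auto
      finally show ?thesis .
    qed
    have near: "norm (disc s - disc (complex_of_real t)) \<le> c * M2 * (M1 / h) * norm (blaschke s)"
      if t: "1 \<le> t" and d: "norm (s - complex_of_real t) * h \<le> M1 * norm (blaschke s)" for t
    proof -
      have "norm (s - complex_of_real t) \<le> M1 / h * norm (blaschke s)"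
        using d h by (simp add: field_simps)
      then have "c * (1 + 1 / norm s) * norm (s - complex_of_real t) \<le> c * M2 * (M1 / h * norm (blaschke s))"
        using M(2)[OF sK] c M2 by (intro mult_mono mult_left_mono) auto
      then show ?thesis using disc_lipschitz[of s t] s t unfolding c_def by (simp add: mult.assoc)
    qed
    have "norm (complex_of_real \<sigma> - 1) \<le> norm (s - 1) + norm (s - \<sigma>)"
      using norm_triangle_ineq4[of "s - 1" "s - \<sigma>"] by simp
    moreover have "norm (complex_of_real \<sigma> - 1) = 2 * h"
    proof -
      have "norm (complex_of_real (\<sigma> - 1)) = \<sigma> - 1" unfolding norm_of_real using \<sigma>1 by simp
      then show ?thesis by (simp add: h_def)
    qed
    ultimately consider "h \<le> norm (s - \<sigma>)" | "h \<le> norm (s - 1)" by linarith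
    then show "norm (disc s - disc 1) \<le> c * M2 * (M1 / h) * norm (blaschke s) \<or>
        norm (disc s - disc \<sigma>) \<le> c * M2 * (M1 / h) * norm (blaschke s)"
    proof cases
      case 1
      then have "norm (s - complex_of_real 1) * h \<le> M1 * norm (blaschke s)"
        using prod by (simp) (meson mult_left_mono norm_ge_zero order_trans)
      from near[OF _ this] show ?thesis by simp
    next
      case 2
      then have "norm (s - complex_of_real \<sigma>) * h \<le> M1 * norm (blaschke s)"
        using prod by (subst mult.commute) (meson mult_right_mono norm_ge_zero order_trans)
      from near[OF _ this] \<sigma>1 show ?thesis by simp
    qed
  qed
qed

lemma
  fixes x :: "complex \<times> complex"
  assumes x: "x \<in> bidisk"
  shows inner_den_nz: "inner_den p q (complex_of_real e * fst x) (complex_of_real e * snd x) \<noteq> 0"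
    and extremal_norm: "norm (extremal x) < 1"
proof -
  have "norm (complex_of_real e * fst x) < 1" "norm (complex_of_real e * snd x) < 1"
    unfolding norm_e_mult using x by auto
  from inner_bound[OF pq p1(1,3) this]
  show "inner_den p q (complex_of_real e * fst x) (complex_of_real e * snd x) \<noteq> 0" "norm (extremal x) < 1"
    unfolding extremal_def by auto
qed

lemma extremal_differentiable:
  assumes "x \<in> bidisk"
  shows "extremal differentiable (at x)"
proof -
  have "(\<lambda>x :: complex \<times> complex. fst x) differentiable (at x)" "(\<lambda>x :: complex \<times> complex. snd x) differentiable (at x)"
    by (auto intro: bounded_linear_imp_differentiable bounded_linear_fst bounded_linear_snd)
  then have n: "(\<lambda>x. inner_num p q (complex_of_real e * fst x) (complex_of_real e * snd x)) differentiable (at x)"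
    "(\<lambda>x. inner_den p q (complex_of_real e * fst x) (complex_of_real e * snd x)) differentiable (at x)"
    unfolding inner_num_def inner_den_def by simp_all
  show ?thesis unfolding extremal_def[abs_def]
    by (rule differentiable_divide[OF n inner_den_nz[OF assms]])
qed

theorem green_on_disc:
  assumes s: "0 < Re s" "blaschke s \<noteq> 0"
  shows "pluricomplex_green bidisk (disc s) (complex_of_real (e * p), 0) (0, complex_of_real (e * q)) = log_abs (extremal (disc s))"
    (is "_ = ?R")
proof -
  let ?P = "(complex_of_real (e * p), 0 :: complex)" and ?Q = "(0 :: complex, complex_of_real (e * q))"
  have PQ: "?P \<in> bidisk" "?Q \<in> bidisk"
    using disc_in[of 1] disc_in[of \<sigma>] disc_poles \<sigma>1 by auto
  have R: "?R = ereal (ln (norm (blaschke s)))"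
    unfolding extremal_disc_eq[OF s(1)] log_abs_def using s(2) by simp
  have open_b: "open bidisk" by (intro open_Times) auto
  have zero: "extremal ?P = 0" "extremal ?Q = 0"
    unfolding extremal_def inner_num_def using ee'[of "complex_of_real p"] ee'[of "complex_of_real q"] by simp_all
  have "plurisubharmonic_on bidisk (\<lambda>x. log_abs (extremal x))"
  proof (rule plurisubharmonic_on_log_abs[OF open_b])
    show "continuous_on bidisk extremal"
      using extremal_differentiable by (intro continuous_at_imp_continuous_on ballI differentiable_imp_continuous_within) 
    show "norm (extremal x) \<le> 1" if "x \<in> bidisk" for x using extremal_norm[OF that] by simp
    show "(\<lambda>w. extremal (a1 + w * b1, a2 + w * b2)) holomorphic_on {w. (a1 + w * b1, a2 + w * b2) \<in> bidisk}" for a1 a2 b1 b2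
    proof -
      have "(\<lambda>w. inner_num p q (e * (a1 + w * b1)) (e * (a2 + w * b2)) / inner_den p q (e * (a1 + w * b1)) (e * (a2 + w * b2)))
          holomorphic_on {w. (a1 + w * b1, a2 + w * b2) \<in> bidisk}"
      proof (rule holomorphic_on_divide)
        show "inner_den p q (e * (a1 + w * b1)) (e * (a2 + w * b2)) \<noteq> 0" if "w \<in> {w. (a1 + w * b1, a2 + w * b2) \<in> bidisk}" for w
          using inner_den_nz[of "(a1 + w * b1, a2 + w * b2)"] that by simp
      qed (unfold inner_num_def inner_den_def, (intro holomorphic_intros)+)
      then show ?thesis unfolding extremal_def by simp
    qed
  qed
  moreover have "log_abs (extremal y) < 0" if "y \<in> bidisk" for y
    using extremal_norm[OF that] by (auto simp: log_abs_def)
  moreover have "has_log_pole bidisk (\<lambda>x. log_abs (extremal x)) ?P" "has_log_pole bidisk (\<lambda>x. log_abs (extremal x)) ?Q"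
    using has_log_pole_log_abs extremal_differentiable PQ zero by auto
  ultimately have "?R \<in> {f (disc s) |f. plurisubharmonic_on bidisk f \<and> (\<forall>y\<in>bidisk. f y < 0) \<and>
                   has_log_pole bidisk f ?P \<and> has_log_pole bidisk f ?Q}"
    by (intro CollectI exI[of _ "\<lambda>x. log_abs (extremal x)"]) simp
  then have ge: "?R \<le> pluricomplex_green bidisk (disc s) ?P ?Q"
    unfolding pluricomplex_green_def by (rule Sup_upper)
  have le: "pluricomplex_green bidisk (disc s) ?P ?Q \<le> ?R"
    unfolding pluricomplex_green_def
  proof (rule Sup_least)
    fix v assume "v \<in> {f (disc s) |f. plurisubharmonic_on bidisk f \<and> (\<forall>y\<in>bidisk. f y < 0) \<and>
                   has_log_pole bidisk f ?P \<and> has_log_pole bidisk f ?Q}"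
    then obtain f where v: "v = f (disc s)" and f: "plurisubharmonic_on bidisk f" "\<And>y. y \<in> bidisk \<Longrightarrow> f y < 0"
      "has_log_pole bidisk f ?P" "has_log_pole bidisk f ?Q" by blast
    obtain L where L: "\<And>s. 0 < Re s \<Longrightarrow> norm (blaschke s) \<le> 1 / 2 \<Longrightarrow>
       norm (disc s - ?P) \<le> L * norm (blaschke s) \<or> norm (disc s - ?Q) \<le> L * norm (blaschke s)"
      using disc_near_poles unfolding disc_poles by blast
    have "f (disc s) \<le> ereal (ln (norm (blaschke s)))"
    proof (rule psh_disc_upper_bound[OF f, where \<Omega> = "{s. 0 < Re s}" and ?\<eta>0.0 = "1 / 2" and L = L
          and \<phi> = disc and B = blaschke and ?t1.0 = s])
      show "open {s. 0 < Re s}" by (intro open_Collect_less continuous_intros)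
      show "compact {t \<in> {s. 0 < Re s}. norm (blaschke t) \<le> b}" if "b < 1" for b
        by (rule blaschke_sublevel_compact[OF that])
      show "norm (blaschke s) < 1" using extremal_norm[OF disc_in[OF s(1)]] extremal_disc_eq[OF s(1)] by simp
    qed (use disc_holomorphic disc_in blaschke_holomorphic L s in auto)
    then show "v \<le> ?R" unfolding v R .
  qed
  show ?thesis using le ge by (rule antisym)
qed

end

section \<open>The level surfaces of \<open>r\<close>\<close>

text \<open>The condition on \<open>z\<close> reads \<open>r = p * level_num p q z1 z2 / level_den p q z1 z2\<close>.  For fixed \<open>r\<close> it
  describes one complex curve of a pencil, and the extremal disc sweeps out the part in the bidisk.\<close>

definition level_num :: "real \<Rightarrow> real \<Rightarrow> complex \<Rightarrow> complex \<Rightarrow> complex" where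
  "level_num p q y1 y2 = p*y1*y2^2 + q*y1^2*y2 - 2*p*y1*y2 - 2*q*y1*y2 + p*y1 + q*y2 - y1^2 + 2*y1*y2 - y2^2"

definition level_den :: "real \<Rightarrow> real \<Rightarrow> complex \<Rightarrow> complex \<Rightarrow> complex" where
  "level_den p q y1 y2 = p*q*y1^2*y2^2 - 2*p*q*y1*y2 - p*y1^2*y2 - q*y1*y2^2 + 2*p*y1*y2 + 2*q*y1*y2 + p*q - p*y2 - q*y1"

text \<open>Divided by \<open>(1 - y1)\<^sup>2 * (1 - y2)\<^sup>2\<close>, both \<open>level_num\<close> and \<open>level_den\<close> become polynomials in \<open>h1, h2\<close> with
  monomials of degree 2 and 0 only.\<close>

lemma level_conic:
  fixes p q r :: real and y1 y2 :: complex
  assumes y: "y1 \<noteq> 1" "y2 \<noteq> 1" and r: "complex_of_real r * level_den p q y1 y2 = complex_of_real p * level_num p q y1 y2"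
  defines "h1 \<equiv> (1 + y1) / (1 - y1)" and "h2 \<equiv> (1 + y2) / (1 - y2)"
  shows "complex_of_real ((1 - p) * (p - r * q)) * h1\<^sup>2 - complex_of_real (2 * p * (1 - r * q)) * (h1 * h2)
    + complex_of_real (p * (1 - r) * (1 - q)) * h2\<^sup>2 = - complex_of_real ((r + p) * (p + q))"
proof -
  define u v where "u = 1 - y1" and "v = 1 - y2"
  have uv: "u \<noteq> 0" "v \<noteq> 0" using y by (auto simp: u_def v_def)
  define P Q R where "P = complex_of_real p" and "Q = complex_of_real q" and "R = complex_of_real r"
  have id: "((1 - P) * (P - R * Q)) * ((1 + y1) * v)\<^sup>2 - (2 * P * (1 - R * Q)) * (((1 + y1) * v) * ((1 + y2) * u))
      + (P * (1 - R) * (1 - Q)) * ((1 + y2) * u)\<^sup>2 + ((R + P) * (P + Q)) * (u * v)\<^sup>2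
      = 4 * (R * level_den p q y1 y2 - P * level_num p q y1 y2)"
    unfolding level_den_def level_num_def u_def v_def P_def[symmetric] Q_def[symmetric]
    by (simp add: power2_eq_square algebra_simps)
  have h: "(1 + y1) * v = h1 * (u * v)" "(1 + y2) * u = h2 * (u * v)"
    unfolding h1_def h2_def u_def[symmetric] v_def[symmetric] using uv by simp_all
  have "(u * v)\<^sup>2 * (((1 - P) * (P - R * Q)) * h1\<^sup>2 - (2 * P * (1 - R * Q)) * (h1 * h2)
      + (P * (1 - R) * (1 - Q)) * h2\<^sup>2 + (R + P) * (P + Q)) = 0"
    using id unfolding h using r by (simp add: P_def R_def power2_eq_square algebra_simps)
  then have "((1 - P) * (P - R * Q)) * h1\<^sup>2 - (2 * P * (1 - R * Q)) * (h1 * h2)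
      + (P * (1 - R) * (1 - Q)) * h2\<^sup>2 + (R + P) * (P + Q) = 0"
    using uv by simp
  then show ?thesis unfolding P_def Q_def R_def by (simp add: eq_neg_iff_add_eq_0)
qed

text \<open>The equation for \<open>m\<^sup>2\<close> makes the disc trace the conic of \<open>r\<close>.  The differences \<open>1 - m\<^sup>2\<close>, \<open>m\<^sup>2 - p\<^sup>2\<close> and
  \<open>m\<^sup>2 - q\<^sup>2\<close> factor, and each of the three bounds on \<open>r\<close> makes one of them positive.\<close>

lemma level_parameter:
  fixes p q r :: real
  assumes p: "- 1 < p" "p < 1" "- 1 < q" "q < 1" "0 < p * q"
    and r: "- p < r" "r < 1" "0 < (p - r * q) * (p + q)"
  obtains m where "\<bar>p\<bar> < m" "\<bar>q\<bar> < m" "m < 1"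
    and "m\<^sup>2 * (p + r - r * p - r * q) = p * (p + q - p * q - r * q)" "0 < p + r - r * p - r * q"
proof -
  define d where "d = p + r - r * p - r * q"
  have pp: "0 < p * (p + q)" using p(5) by (auto simp: zero_less_mult_iff)
  have d: "0 < d"
  proof (cases "0 < p")
    case True
    then have q0: "0 < q" using p(5) by (simp add: zero_less_mult_iff)
    show ?thesis
    proof (cases "0 \<le> r")
      case True
      have "d = p * (1 - r) + r * (1 - q)" unfolding d_def by (simp add: algebra_simps)
      moreover have "0 < p * (1 - r)" using \<open>0 < p\<close> r by simp
      moreover have "0 \<le> r * (1 - q)" using True p by simp
      ultimately show ?thesis by simp
    next
      case False
      have "d = (p + r) + (- r) * (p + q)" unfolding d_def by (simp add: algebra_simps)
      moreover have "0 < (- r) * (p + q)" using False \<open>0 < p\<close> q0 by (intro mult_pos_pos) auto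
      ultimately show ?thesis using r by simp
    qed
  next
    case False
    then have neg: "p < 0" "q < 0" using p(5) by (auto simp: zero_less_mult_iff)
    have "d = (p + r) + r * (- (p + q))" unfolding d_def by (simp add: algebra_simps)
    moreover have "0 < r * (- (p + q))" using neg r by (intro mult_pos_pos) auto
    ultimately show ?thesis using r by simp
  qed
  define M where "M = p * (p + q - p * q - r * q) / d"
  have Md: "M * d = p * (p + q - p * q - r * q)" unfolding M_def using d by simp
  have "(1 - M) * d = (r + p) * (1 - p) * (1 - q)"
    using Md unfolding left_diff_distrib Md unfolding d_def by (simp add: algebra_simps)
  moreover have "0 < (r + p) * (1 - p) * (1 - q)" using r p by simp
  ultimately have M1: "M < 1" using d by (metis diff_gt_0_iff_gt zero_less_mult_pos2)
  have "(M - p\<^sup>2) * d = (p * (p + q)) * (1 - p) * (1 - r)"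
    unfolding left_diff_distrib Md unfolding d_def by (simp add: power2_eq_square algebra_simps)
  moreover have "0 < (p * (p + q)) * (1 - p) * (1 - r)" using pp r p by simp
  ultimately have Mp: "p\<^sup>2 < M" using d by (metis diff_gt_0_iff_gt zero_less_mult_pos2)
  have "(M - q\<^sup>2) * d = ((p - r * q) * (p + q)) * (1 - q)"
    unfolding left_diff_distrib Md unfolding d_def by (simp add: power2_eq_square algebra_simps)
  moreover have "0 < ((p - r * q) * (p + q)) * (1 - q)" using r p by simp
  ultimately have Mq: "q\<^sup>2 < M" using d by (metis diff_gt_0_iff_gt zero_less_mult_pos2)
  have M0: "0 \<le> M" using Mp zero_le_power2[of p] by linarith
  show ?thesis
  proof (rule that[of "sqrt M"])
    show "\<bar>p\<bar> < sqrt M" "\<bar>q\<bar> < sqrt M"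
      using Mp Mq by (auto intro!: real_less_rsqrt)
    show "sqrt M < 1" using M1 by simp
  qed (use Md M0 d in \<open>auto simp: d_def\<close>)
qed

text \<open>Elimination of \<open>s\<close> shows that the disc traces the conic
  \<open>(k2 * h1 - l2 * h2) * (l1 * h2 - k1 * h1) = (l1 * k2 - l2 * k1)\<^sup>2\<close>.  Its coefficients are those of
  \<open>level_conic\<close> times a common factor.\<close>

lemma (in extremal_disc) conic_coefficients:
  assumes m: "m\<^sup>2 * (p + r - r * p - r * q) = p * (p + q - p * q - r * q)" and d: "0 < p + r - r * p - r * q"
  obtains \<rho> where "k1 * k2 = \<rho> * ((1 - p) * (p - r * q))" "l1 * l2 = \<rho> * (p * (1 - r) * (1 - q))"
    "l1 * k2 + l2 * k1 = \<rho> * (2 * p * (1 - r * q))" "(l1 * k2 - l2 * k1)\<^sup>2 = \<rho> * ((r + p) * (p + q))"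
proof -
  define D where "D = p + r - r * p - r * q"
  define M where "M = m\<^sup>2"
  have D: "D \<noteq> 0" using d unfolding D_def by simp
  have M: "M \<noteq> 0" unfolding M_def using m0 by simp
  have Md: "M * D = p * (p + q - p * q - r * q)" unfolding M_def D_def by (rule m)
  have e1: "1 - M = (r + p) * (1 - p) * (1 - q) / D"
    using D Md by (simp add: field_simps) (simp add: D_def algebra_simps)
  have e2: "M - p\<^sup>2 = p * (p + q) * (1 - p) * (1 - r) / D"
    using D Md by (simp add: field_simps power2_eq_square) (simp add: D_def algebra_simps)
  have e3: "M - q\<^sup>2 = (p - r * q) * (p + q) * (1 - q) / D"
    using D Md by (simp add: field_simps power2_eq_square) (simp add: D_def algebra_simps)
  have e4: "M + p * q = p * (p + q) * (1 - r * q) / D"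
    using D Md by (simp add: field_simps power2_eq_square) (simp add: D_def algebra_simps)
  define T where "T = (1 - M) / (4 * M)"
  define a b where "a = 1 - p" and "b = 1 - q"
  have ab: "a \<noteq> 0" "b \<noteq> 0" "m \<noteq> 0" using p1 m0 by (auto simp: a_def b_def)
  have kk: "k1 * k2 = T * (M - q\<^sup>2) / b\<^sup>2" and ll: "l1 * l2 = T * (M - p\<^sup>2) / a\<^sup>2"
    and kl: "l1 * k2 + l2 * k1 = 2 * T * (M + p * q) / (a * b)"
    and dl: "l1 * k2 - l2 * k1 = - ((p + q) * (1 - M)) / (2 * m * a * b)"
    unfolding k1_def k2_def l1_def l2_def T_def M_def a_def[symmetric] b_def[symmetric] using ab
    by (simp_all add: divide_simps) (simp_all add: power2_eq_square algebra_simps)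
  define \<rho> where "\<rho> = T * (p + q) / (a * b * D)"
  show ?thesis
  proof (rule that[of \<rho>])
    show "k1 * k2 = \<rho> * ((1 - p) * (p - r * q))"
      unfolding kk e3 \<rho>_def a_def[symmetric] b_def[symmetric] using ab D by (simp add: power2_eq_square mult_ac)
    show "l1 * l2 = \<rho> * (p * (1 - r) * (1 - q))"
      unfolding ll e2 \<rho>_def a_def[symmetric] b_def[symmetric] using ab D by (simp add: power2_eq_square mult_ac)
    show "l1 * k2 + l2 * k1 = \<rho> * (2 * p * (1 - r * q))"
      unfolding kl e4 \<rho>_def using ab D by (simp add: mult_ac)
    have "(l1 * k2 - l2 * k1)\<^sup>2 = T * (1 - M) * (p + q)\<^sup>2 / (a * b)\<^sup>2"
      unfolding dl T_def M_def using ab by (simp add: power2_eq_square mult_ac)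
    also have "\<dots> = T * ((r + p) * a * b / D) * (p + q)\<^sup>2 / (a * b)\<^sup>2"
      unfolding e1 a_def b_def ..
    also have "\<dots> = \<rho> * ((r + p) * (p + q))"
      unfolding \<rho>_def using ab D by (simp add: power2_eq_square mult_ac)
    finally show "(l1 * k2 - l2 * k1)\<^sup>2 = \<rho> * ((r + p) * (p + q))" .
  qed
qed

text \<open>Solving the linear system \<open>l1 * X + l2 * Y = h1, k1 * X + k2 * Y = h2\<close> gives \<open>X * Y = 1\<close> on the conic,
  so \<open>X\<close> is the parameter; it lies in the right half-plane because \<open>h1\<close> does.\<close>

lemma (in extremal_disc) disc_through:
  assumes y: "norm y1 < 1" "norm y2 < 1"
    and r: "complex_of_real r * level_den p q y1 y2 = complex_of_real p * level_num p q y1 y2"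
    and m: "m\<^sup>2 * (p + r - r * p - r * q) = p * (p + q - p * q - r * q)" and d: "0 < p + r - r * p - r * q"
  obtains s where "0 < Re s" "disc s = (complex_of_real e * y1, complex_of_real e * y2)"
proof -
  have yn: "y1 \<noteq> 1" "y2 \<noteq> 1" using y by auto
  define h1 h2 where "h1 = (1 + y1) / (1 - y1)" and "h2 = (1 + y2) / (1 - y2)"
  obtain \<rho> where \<rho>: "k1 * k2 = \<rho> * ((1 - p) * (p - r * q))" "l1 * l2 = \<rho> * (p * (1 - r) * (1 - q))"
    "l1 * k2 + l2 * k1 = \<rho> * (2 * p * (1 - r * q))" "(l1 * k2 - l2 * k1)\<^sup>2 = \<rho> * ((r + p) * (p + q))"
    using conic_coefficients[OF m d] by blast
  define D where "D = l1 * k2 - l2 * k1"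
  have "D = - ((p + q) * (1 - m\<^sup>2)) / (2 * m * (1 - p) * (1 - q))"
    unfolding D_def k1_def k2_def l1_def l2_def using m0 p1
    by (simp add: divide_simps) (simp add: power2_eq_square algebra_simps)
  moreover have "m\<^sup>2 < 1" using m0 m1 by (simp add: power_less_one_iff)
  ultimately have "D \<noteq> 0" using pq_sum m0 p1 by simp
  then have D: "complex_of_real D \<noteq> 0" by simp
  define L1 L2 K1 K2 where "L1 = complex_of_real l1" and "L2 = complex_of_real l2"
    and "K1 = complex_of_real k1" and "K2 = complex_of_real k2"
  have Dc: "complex_of_real D = L1 * K2 - L2 * K1" unfolding D_def L1_def L2_def K1_def K2_def by simp
  define X Y where "X = (K2 * h1 - L2 * h2) / complex_of_real D" and "Y = (L1 * h2 - K1 * h1) / complex_of_real D"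
  have XY1: "L1 * X + L2 * Y = h1" "K1 * X + K2 * Y = h2"
  proof -
    have "L1 * X + L2 * Y = (L1 * K2 - L2 * K1) * h1 / complex_of_real D"
      "K1 * X + K2 * Y = (L1 * K2 - L2 * K1) * h2 / complex_of_real D"
      unfolding X_def Y_def by (simp_all add: algebra_simps diff_divide_distrib add_divide_distrib)
    then show "L1 * X + L2 * Y = h1" "K1 * X + K2 * Y = h2"
      unfolding Dc[symmetric] using D by simp_all
  qed
  have "(K2 * h1 - L2 * h2) * (L1 * h2 - K1 * h1) = - (K1 * K2) * h1\<^sup>2 + (L1 * K2 + L2 * K1) * (h1 * h2) - (L1 * L2) * h2\<^sup>2"
    by (simp add: power2_eq_square algebra_simps)
  also have "K1 * K2 = complex_of_real \<rho> * complex_of_real ((1 - p) * (p - r * q))"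
    unfolding K1_def K2_def of_real_mult[symmetric] by (simp only: \<rho>(1))
  also have "L1 * L2 = complex_of_real \<rho> * complex_of_real (p * (1 - r) * (1 - q))"
    unfolding L1_def L2_def of_real_mult[symmetric] by (simp only: \<rho>(2))
  also have "L1 * K2 + L2 * K1 = complex_of_real \<rho> * complex_of_real (2 * p * (1 - r * q))"
    unfolding L1_def L2_def K1_def K2_def of_real_mult[symmetric] of_real_add[symmetric] by (simp only: \<rho>(3))
  also have "- (complex_of_real \<rho> * complex_of_real ((1 - p) * (p - r * q))) * h1\<^sup>2
      + complex_of_real \<rho> * complex_of_real (2 * p * (1 - r * q)) * (h1 * h2)
      - complex_of_real \<rho> * complex_of_real (p * (1 - r) * (1 - q)) * h2\<^sup>2
      = - complex_of_real \<rho> * (complex_of_real ((1 - p) * (p - r * q)) * h1\<^sup>2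
        - complex_of_real (2 * p * (1 - r * q)) * (h1 * h2) + complex_of_real (p * (1 - r) * (1 - q)) * h2\<^sup>2)"
  proof -
    have "- (c * x) * x' + c * y * y' - c * z * z' = - c * (x * x' - y * y' + z * z')" for c x y z x' y' z' :: complex
      by (simp add: algebra_simps)
    then show ?thesis by blast
  qed
  also have "\<dots> = complex_of_real \<rho> * complex_of_real ((r + p) * (p + q))"
    unfolding h1_def h2_def level_conic[OF yn r] by simp
  also have "\<dots> = (complex_of_real D)\<^sup>2"
    unfolding of_real_mult[symmetric] of_real_power[symmetric] D_def by (simp only: \<rho>(4))
  finally have XY: "X * Y = 1" unfolding X_def Y_def using D by (simp add: power2_eq_square)
  then have "X \<noteq> 0" by auto
  moreover from this have "Y = 1 / X" using XY by (metis nonzero_mult_div_cancel_left)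
  ultimately have X: "X \<noteq> 0" "Y = 1 / X" by auto
  have H: "H1 X = h1" "H2 X = h2"
    using XY1 unfolding H1_def H2_def X(2) L1_def L2_def K1_def K2_def by simp_all
  have "0 < Re h1" unfolding h1_def by (rule Re_cayley_pos[OF y(1)])
  then have ReX: "0 < Re X"
    unfolding H(1)[symmetric] H1_def using Re_lin_pos_iff[OF X(1) coeff_pos(1,2)] by blast
  moreover have "disc X = (complex_of_real e * y1, complex_of_real e * y2)"
    unfolding disc_def H unfolding h1_def h2_def cayley_inv_cayley[OF yn(1)] cayley_inv_cayley[OF yn(2)] ..
  ultimately show ?thesis by (rule that)
qed

theorem green_on_level:
  fixes p q r e :: real and y1 y2 :: complex
  assumes p: "- 1 < p" "p < 1" "- 1 < q" "q < 1" "0 < p * q" and e: "e = 1 \<or> e = - 1"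
    and r: "- p < r" "r < 1" "0 < (p - r * q) * (p + q)"
    and y: "norm y1 < 1" "norm y2 < 1" and den: "level_den p q y1 y2 \<noteq> 0"
    and level: "complex_of_real r = complex_of_real p * level_num p q y1 y2 / level_den p q y1 y2"
  shows "pluricomplex_green bidisk (complex_of_real e * y1, complex_of_real e * y2) (complex_of_real (e * p), 0) (0, complex_of_real (e * q))
    = log_abs (inner_num p q y1 y2 / inner_den p q y1 y2)"
proof -
  obtain m where m: "\<bar>p\<bar> < m" "\<bar>q\<bar> < m" "m < 1"
    and m2: "m\<^sup>2 * (p + r - r * p - r * q) = p * (p + q - p * q - r * q)" "0 < p + r - r * p - r * q"
    using level_parameter[OF p r] by blast
  interpret extremal_disc p q m e by unfold_locales (use m p e in auto)
  have lev: "complex_of_real r * level_den p q y1 y2 = complex_of_real p * level_num p q y1 y2"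
    using level den by simp
  obtain s where s: "0 < Re s" "disc s = (complex_of_real e * y1, complex_of_real e * y2)"
    using disc_through[OF y lev m2] by blast
  \<comment> \<open>At the two poles \<open>level_den\<close> vanishes, so the point is none of them.\<close>
  have "blaschke s \<noteq> 0"
  proof
    assume "blaschke s = 0"
    then have "s = 1 \<or> s = \<sigma>"
      unfolding blaschke_def using blaschke_den_nz[of s] s(1) by auto
    then have "(complex_of_real e * y1, complex_of_real e * y2) = (complex_of_real (e * p), 0) \<or>
      (complex_of_real e * y1, complex_of_real e * y2) = (0, complex_of_real (e * q))"
      using disc_poles s(2) by auto
    then have "(y1 = p \<and> y2 = 0) \<or> (y1 = 0 \<and> y2 = q)" using e by auto
    then have "level_den p q y1 y2 = 0" unfolding level_den_def by auto
    then show False using den by simp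
  qed
  from green_on_disc[OF s(1) this] show ?thesis
    unfolding s(2) extremal_def fst_conv snd_conv ee' .
qed

theorem corollary6p1:
  fixes p q :: real and z1 z2 :: complex
  assumes "0 < p" "p < 1" "0 < q" "q < 1" and "(z1, z2) \<in> bidisk"
  shows
    "((\<exists>r::real. - p < r \<and> r < min 1 (p / q) \<and>
        p*q*z1^2*z2^2 - 2*p*q*z1*z2 - p*z1^2*z2 - q*z1*z2^2 + 2*p*z1*z2 + 2*q*z1*z2 + p*q - p*z2 - q*z1 \<noteq> 0 \<and>
        complex_of_real r =
          p * (p*z1*z2^2 + q*z1^2*z2 - 2*p*z1*z2 - 2*q*z1*z2 + p*z1 + q*z2 - z1^2 + 2*z1*z2 - z2^2) /
          (p*q*z1^2*z2^2 - 2*p*q*z1*z2 - p*z1^2*z2 - q*z1*z2^2 + 2*p*z1*z2 + 2*q*z1*z2 + p*q - p*z2 - q*z1))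
      \<longrightarrow>
      pluricomplex_green bidisk (z1, z2) (complex_of_real p, 0) (0, complex_of_real q) =
        log_abs ((p*q*z1*z2 - p*z1*z2 - q*z1*z2 - p*q + p*z2 + q*z1) /
                 (p*q*z1*z2 - p*q - p*z1 - q*z2 + p + q)))
     \<and>
     ((\<exists>r::real. max (- 1) (- p / q) < r \<and> r < - p \<and>
        p*q*z1^2*z2^2 - 2*p*q*z1*z2 - p*z1^2*z2 - q*z1*z2^2 - 2*p*z1*z2 - 2*q*z1*z2 + p*q - p*z2 - q*z1 \<noteq> 0 \<and>
        complex_of_real r =
          p * (p*z1*z2^2 + q*z1^2*z2 + 2*p*z1*z2 + 2*q*z1*z2 + p*z1 + q*z2 - z1^2 + 2*z1*z2 - z2^2) /
          (p*q*z1^2*z2^2 - 2*p*q*z1*z2 - p*z1^2*z2 - q*z1*z2^2 - 2*p*z1*z2 - 2*q*z1*z2 + p*q - p*z2 - q*z1))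
      \<longrightarrow>
      pluricomplex_green bidisk (z1, z2) (complex_of_real p, 0) (0, complex_of_real q) =
        log_abs ((p*q*z1*z2 + p*z1*z2 + q*z1*z2 - p*q + p*z2 + q*z1) /
                 (p*q*z1*z2 - p*q - p*z1 - q*z2 - p - q)))"
proof -
  have z: "norm z1 < 1" "norm z2 < 1" using assms(5) by auto
  have first: "pluricomplex_green bidisk (z1, z2) (complex_of_real p, 0) (0, complex_of_real q) =
      log_abs (inner_num p q z1 z2 / inner_den p q z1 z2)"
    if r: "- p < r" "r < min 1 (p / q)" and den: "level_den p q z1 z2 \<noteq> 0"
      and level: "complex_of_real r = complex_of_real p * level_num p q z1 z2 / level_den p q z1 z2" for r
  proof -
    have "r * q < p" using r(2) assms(3) by (simp add: pos_less_divide_eq)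
    then have "0 < (p - r * q) * (p + q)" using assms by simp
    then show ?thesis
      using green_on_level[of p q 1 r z1 z2] assms r z den level by simp
  qed
  have second: "pluricomplex_green bidisk (z1, z2) (complex_of_real p, 0) (0, complex_of_real q) =
      log_abs (inner_num (- p) (- q) (- z1) (- z2) / inner_den (- p) (- q) (- z1) (- z2))"
    if r: "max (- 1) (- p / q) < r" "r < - p" and den: "level_den (- p) (- q) (- z1) (- z2) \<noteq> 0"
      and level: "complex_of_real r = complex_of_real p * level_num (- p) (- q) (- z1) (- z2) / level_den (- p) (- q) (- z1) (- z2)" for r
  proof -
    have "- (p / q) < r" using r(1) by simp
    then have "- p < r * q" using assms(3) by (simp add: field_simps)
    \<comment> \<open>The second half is the first one at \<open>(- z1, - z2)\<close> with the signs of \<open>p, q, r\<close> reversed.\<close>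
    then have "0 < (- p - - r * - q) * (- p + - q)" using assms by (intro mult_neg_neg) auto
    then show ?thesis
      using green_on_level[of "- p" "- q" "- 1" "- r" "- z1" "- z2"] assms r z den level by simp
  qed
  show ?thesis
    using first second
    unfolding level_num_def level_den_def inner_num_def inner_den_def
    by (auto simp: power2_eq_square)
qed

end
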